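(* Let $\Gamma$ be a thick locally finitely generated generalized $8$-gon, and let $\gamma:\Gamma\to\Delta$ be an epimorphism, with $\Delta$ a thin generalized $8$-gon of order $(s,1)$. Then $s=1$ (so $\Delta$ is an ordinary octagon), and exactly two classes of such epimorphisms occur: those of class (a) and those of class (b), as defined in the context.
   Context: A point-line geometry $\Gamma=(\mathcal{P},\mathcal{L},\mathbf{I})$ consists of disjoint sets $\mathcal P$ (points) and $\mathcal L$ (lines) with a symmetric incidence relation $\mathbf{I}$ between points and lines. An ordinary $k$-gon is the geometry of $k$ points and $k$ lines whose incidence graph is a cycle of length $2k$ (for $k=2$: two points and two lines, all incident). For $m\ge 3$, $\Gamma$ is a weak generalized $m$-gon if any two elements of $\mathcal{P}\cup\mathcal{L}$ are contained in at least one ordinary sub $m$-gon (as a subgeometry of $\Gamma$), and $\Gamma$ contains no ordinary sub $k$-gons with $2\le k<m$. It is thick (and is then called a thick generalized $m$-gon) if every point is incident with at least three lines and every line with at least three points; otherwise it is thin. It has order $(u,v)$ (possibly infinite cardinals) if each line is incident with exactly $u+1$ points and each point is incident with exactly $v+1$ lines; every thick generalized $m$-gon has an order. A thin generalized $m$-gon of order $(u,1)$ is a weak generalized $m$-gon having order $(u,1)$, $u\geq 1$. Octagon means $8$-gon. A (thin or thick) sub $n$-gon of a generalized $n$-gon $\Gamma=(\mathcal P,\mathcal L,\mathbf I)$ is a (thin or thick) weak generalized $n$-gon $(\mathcal P',\mathcal L',\mathbf I')$ with $\mathcal P'\subseteq\mathcal P$, $\mathcal L'\subseteq\mathcal L$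 and $\mathbf I'$ the induced incidence. For a point set $S$ of $\Gamma$, $\langle S\rangle$ is the intersection of all (thin and thick) sub $n$-gons of $\Gamma$ containing $S$; it is called the subgeometry generated by $S$ (it need not be a sub $n$-gon). A thick generalized $n$-gon $\Gamma$ is locally finitely generated if for every finite point subset $S$ for which $\langle S\rangle$ is a (possibly thin) sub $n$-gon, $\langle S\rangle$ is finite. A morphism between weak generalized polygons is a map sending points to points and lines to lines and preserving incidence; an epimorphism is a morphism that is surjective on the point set and on the line set. Two distinct points $x,y$ are collinear, $x\sim y$, if they are incident with a common line, denoted $xy$. The point-line dual of a geometry is obtained by interchanging the roles of points and lines. Let $\Phi$ be an epimorphism from a thick generalized octagon $\mathcal{S}$ of order $(u,v)$ onto an ordinary octagon $\mathcal{G}$. Class (a): the points of $\mathcal{G}$ can be labelled $\overline{a},\overline{b},\overline{c},\overline{d},\overline{e},\overline{f},\overline{g},\overline{h}$ with $\overline{a}\sim\overline{b}\sim\overline{c}\sim\overline{d}\sim\overline{e}\sim\overline{f}\sim\overline{g}\sim\overline{h}\sim\overline{a}$ such that, writing $\widetilde{X}=\Phi^{-1}(\overline{x})$ for each such point (so $\widetilde A=\Phi^{-1}(\overline a)$, etc.), there is a line $L$ of $\mathcal{S}$ for which: $(\widetilde{C},\widetilde{B})$ is a partition of the set of all points incident with $L$, with $1\le|\widetilde{C}|\le u$ and $1\le|\widetilde{B}|\le u$; $\widetilde{D}$ consists of the points not incident with $L$ but collinear with a point of $\widetilde{C}$; $\widetilde{A}$ consists of the points not incident with $L$ but collinear with a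 point of $\widetilde{B}$; $\widetilde{E}$ consists of the points not in $\widetilde{C}\cup\widetilde{D}$ but collinear with a point of $\widetilde{D}$; $\widetilde{H}$ consists of the points not in $\widetilde{A}\cup\widetilde{B}$ but collinear with a point of $\widetilde{A}$; $\widetilde{F}$ consists of the points not in $\widetilde{D}\cup\widetilde{E}$ but collinear with a point of $\widetilde{E}$; $\widetilde{G}$ consists of the points not in $\widetilde{A}\cup\widetilde{H}$ but collinear with a point of $\widetilde{H}$; $\Phi^{-1}(\overline{c}\,\overline{b})=\{L\}$; $\Phi^{-1}(\overline{c}\,\overline{d})$ is the set of all lines distinct from $L$ but incident with a point of $\widetilde{C}$; $\Phi^{-1}(\overline{a}\,\overline{b})$ is the set of all lines distinct from $L$ but incident with a point of $\widetilde{B}$; $\Phi^{-1}(\overline{d}\,\overline{e})$ is the set of all lines not in $\Phi^{-1}(\overline{d}\,\overline{c})$ but incident with a point of $\widetilde{D}$; $\Phi^{-1}(\overline{a}\,\overline{h})$ is the set of all lines not in $\Phi^{-1}(\overline{a}\,\overline{b})$ but incident with a point of $\widetilde{A}$; $\Phi^{-1}(\overline{e}\,\overline{f})$ is the set of all lines not in $\Phi^{-1}(\overline{d}\,\overline{e})$ but incident with a point of $\widetilde{E}$; $\Phi^{-1}(\overline{g}\,\overline{h})$ is the set of all lines not in $\Phi^{-1}(\overline{a}\,\overline{h})$ but incident with a point of $\widetilde{H}$; and $\Phi^{-1}(\overline{g}\,\overline{f})$ is the set of all lines not in $\Phi^{-1}(\overline{h}\,\overline{g})$ but incident with a point of $\widetilde{G}$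 (that is, the set of all lines not in $\Phi^{-1}(\overline{e}\,\overline{f})$ but incident with a point of $\widetilde{F}$). Class (b) (the dual of (a)): $\Phi$, regarded as an epimorphism from the point-line dual of $\mathcal{S}$ (of order $(v,u)$) onto the point-line dual of $\mathcal{G}$ (again an ordinary octagon), is of class (a). "Exactly two classes occur" means that each epimorphism belongs to class (a) or class (b), and both classes occur. *)

theory Defs
  imports Main
begin

unbundle cardinal_syntax

section \<open>Point-line geometries\<close>

text \<open>Points and lines live in two different types, so that they are automatically disjoint; the
  symmetric incidence relation is recorded by its point-line half.\<close>

record ('p, 'l) geometry =
  Points :: "'p set"
  Lines :: "'l set"
  Incid :: "('p \<times> 'l) set"

definition geometry :: "('p, 'l) geometry \<Rightarrow> bool" where
  "geometry G \<longleftrightarrow> Incid G \<subseteq> Points G \<times> Lines G"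

definition dual :: "('p, 'l) geometry \<Rightarrow> ('l, 'p) geometry" where
  "dual G = \<lparr>Points = Lines G, Lines = Points G, Incid = (Incid G)\<inverse>\<rparr>"

definition elements :: "('p, 'l) geometry \<Rightarrow> ('p + 'l) set" where
  "elements G = Points G <+> Lines G"

definition points_on :: "('p, 'l) geometry \<Rightarrow> 'l \<Rightarrow> 'p set" where
  "points_on G M = {x \<in> Points G. (x, M) \<in> Incid G}"

definition lines_through :: "('p, 'l) geometry \<Rightarrow> 'p \<Rightarrow> 'l set" where
  "lines_through G x = {M \<in> Lines G. (x, M) \<in> Incid G}"

definition collinear :: "('p, 'l) geometry \<Rightarrow> 'p \<Rightarrow> 'p \<Rightarrow> bool" where
  "collinear G x y \<longleftrightarrow> x \<in> Points G \<and> y \<in> Points G \<and> x \<noteq> y \<and>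
     (\<exists>M\<in>Lines G. (x, M) \<in> Incid G \<and> (y, M) \<in> Incid G)"

text \<open>Only meaningful when \<open>x\<close> and \<open>y\<close> are on exactly one common line, as is the case for collinear
  points of a generalized polygon.\<close>

definition joining_line :: "('p, 'l) geometry \<Rightarrow> 'p \<Rightarrow> 'p \<Rightarrow> 'l" where
  "joining_line G x y = (THE M. M \<in> Lines G \<and> (x, M) \<in> Incid G \<and> (y, M) \<in> Incid G)"

definition subgeometry :: "('p, 'l) geometry \<Rightarrow> ('p, 'l) geometry \<Rightarrow> bool" where
  "subgeometry G' G \<longleftrightarrow> Points G' \<subseteq> Points G \<and> Lines G' \<subseteq> Lines G \<and>
     Incid G' = Incid G \<inter> (Points G' \<times> Lines G')"


section \<open>Generalized polygons\<close>

text \<open>The incidence graph is the cycle \<open>p 0, l 0, p 1, l 1, \<dots>, p (k - 1), l (k - 1)\<close>.\<close>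

definition ordinary_gon :: "nat \<Rightarrow> ('p, 'l) geometry \<Rightarrow> bool" where
  "ordinary_gon k G \<longleftrightarrow> 2 \<le> k \<and> geometry G \<and>
     (\<exists>p l. bij_betw p {..<k} (Points G) \<and> bij_betw l {..<k} (Lines G) \<and>
        (\<forall>i<k. \<forall>j<k. (p i, l j) \<in> Incid G \<longleftrightarrow> i = j \<or> i = (j + 1) mod k))"

text \<open>Non-emptiness is explicit, since the empty geometry would satisfy all other conditions
  vacuously. The two elements \<open>x\<close> and \<open>y\<close> are allowed to coincide.\<close>

definition weak_generalized_gon :: "nat \<Rightarrow> ('p, 'l) geometry \<Rightarrow> bool" where
  "weak_generalized_gon m G \<longleftrightarrow> 3 \<le> m \<and> geometry G \<and> elements G \<noteq> {} \<and>
     (\<forall>x\<in>elements G. \<forall>y\<in>elements G.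
        \<exists>A. subgeometry A G \<and> ordinary_gon m A \<and> x \<in> elements A \<and> y \<in> elements A) \<and>
     (\<forall>k. 2 \<le> k \<and> k < m \<longrightarrow> \<not> (\<exists>A. subgeometry A G \<and> ordinary_gon k A))"

text \<open>Stated without \<^const>\<open>card\<close> on the whole set, which may be infinite.\<close>

definition at_least_three :: "'a set \<Rightarrow> bool" where
  "at_least_three A \<longleftrightarrow> (\<exists>T\<subseteq>A. card T = 3)"

definition thick_generalized_gon :: "nat \<Rightarrow> ('p, 'l) geometry \<Rightarrow> bool" where
  "thick_generalized_gon m G \<longleftrightarrow> weak_generalized_gon m G \<and>
     (\<forall>x\<in>Points G. at_least_three (lines_through G x)) \<and>
     (\<forall>M\<in>Lines G. at_least_three (points_on G M))"

text \<open>The entries \<open>u\<close> and \<open>v\<close> of an order are arbitrary cardinals, finite or infinite, represented as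
  cardinal orders; \<^term>\<open>cone\<close> is the cardinal 1.\<close>

definition has_order :: "('p, 'l) geometry \<Rightarrow> 'u rel \<Rightarrow> 'v rel \<Rightarrow> bool" where
  "has_order G u v \<longleftrightarrow> Card_order u \<and> Card_order v \<and>
     (\<forall>M\<in>Lines G. |points_on G M| =o u +c cone) \<and>
     (\<forall>x\<in>Points G. |lines_through G x| =o v +c cone)"

definition thin_generalized_gon_of_order :: "nat \<Rightarrow> ('p, 'l) geometry \<Rightarrow> 'u rel \<Rightarrow> bool" where
  "thin_generalized_gon_of_order m G u \<longleftrightarrow>
     weak_generalized_gon m G \<and> has_order G u cone \<and> cone \<le>o u"

definition sub_gon :: "nat \<Rightarrow> ('p, 'l) geometry \<Rightarrow> ('p, 'l) geometry \<Rightarrow> bool" where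
  "sub_gon n A G \<longleftrightarrow> subgeometry A G \<and> weak_generalized_gon n A"

definition generated :: "nat \<Rightarrow> ('p, 'l) geometry \<Rightarrow> 'p set \<Rightarrow> ('p, 'l) geometry" where
  "generated n G S =
     \<lparr>Points = \<Inter> {Points A | A. sub_gon n A G \<and> S \<subseteq> Points A},
      Lines = \<Inter> {Lines A | A. sub_gon n A G \<and> S \<subseteq> Points A},
      Incid = \<Inter> {Incid A | A. sub_gon n A G \<and> S \<subseteq> Points A}\<rparr>"

definition locally_finitely_generated :: "nat \<Rightarrow> ('p, 'l) geometry \<Rightarrow> bool" where
  "locally_finitely_generated n G \<longleftrightarrow>
     (\<forall>S. finite S \<and> S \<subseteq> Points G \<and> sub_gon n (generated n G S) G \<longrightarrow>
        finite (Points (generated n G S)) \<and> finite (Lines (generated n G S)))"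


section \<open>Epimorphisms\<close>

text \<open>A morphism is given by its action \<open>f\<close> on points and its action \<open>g\<close> on lines; the values of
  \<open>f\<close> and \<open>g\<close> outside the geometry are irrelevant.\<close>

definition morphism ::
  "('p, 'l) geometry \<Rightarrow> ('q, 'm) geometry \<Rightarrow> ('p \<Rightarrow> 'q) \<Rightarrow> ('l \<Rightarrow> 'm) \<Rightarrow> bool" where
  "morphism G H f g \<longleftrightarrow> f ` Points G \<subseteq> Points H \<and> g ` Lines G \<subseteq> Lines H \<and>
     (\<forall>x M. (x, M) \<in> Incid G \<longrightarrow> (f x, g M) \<in> Incid H)"

definition epimorphism ::
  "('p, 'l) geometry \<Rightarrow> ('q, 'm) geometry \<Rightarrow> ('p \<Rightarrow> 'q) \<Rightarrow> ('l \<Rightarrow> 'm) \<Rightarrow> bool" where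
  "epimorphism G H f g \<longleftrightarrow> morphism G H f g \<and> f ` Points G = Points H \<and> g ` Lines G = Lines H"

definition point_fibre :: "('p, 'l) geometry \<Rightarrow> ('p \<Rightarrow> 'q) \<Rightarrow> 'q \<Rightarrow> 'p set" where
  "point_fibre S f x = {y \<in> Points S. f y = x}"

definition line_fibre ::
  "('p, 'l) geometry \<Rightarrow> ('q, 'm) geometry \<Rightarrow> ('l \<Rightarrow> 'm) \<Rightarrow> 'q \<Rightarrow> 'q \<Rightarrow> 'l set" where
  "line_fibre S G g x y = {M \<in> Lines S. g M = joining_line G x y}"

definition collinear_with_some :: "('p, 'l) geometry \<Rightarrow> 'p set \<Rightarrow> 'p set" where
  "collinear_with_some S X = {y \<in> Points S. \<exists>x\<in>X. collinear S y x}"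

definition lines_meeting :: "('p, 'l) geometry \<Rightarrow> 'p set \<Rightarrow> 'l set" where
  "lines_meeting S X = {M \<in> Lines S. \<exists>x\<in>X. (x, M) \<in> Incid S}"

text \<open>The condition that \<open>(f, g)\<close> is an epimorphism from \<open>S\<close> onto the ordinary octagon \<open>G\<close> is not part
  of the two class definitions. The cardinals \<open>u\<close> and \<open>v\<close> of the order of \<open>S\<close> do not exceed the
  cardinals of the point set and of the line set, respectively, so they can be represented on the
  types of points and lines.\<close>

definition class_a ::
  "('p, 'l) geometry \<Rightarrow> ('q, 'm) geometry \<Rightarrow> ('p \<Rightarrow> 'q) \<Rightarrow> ('l \<Rightarrow> 'm) \<Rightarrow> bool" where
  "class_a S G f g \<longleftrightarrow>
   (\<exists>(u :: 'p rel) (v :: 'l rel) a b c d e f' g' h. has_order S u v \<and>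
      distinct [a, b, c, d, e, f', g', h] \<and> Points G = {a, b, c, d, e, f', g', h} \<and>
      collinear G a b \<and> collinear G b c \<and> collinear G c d \<and> collinear G d e \<and>
      collinear G e f' \<and> collinear G f' g' \<and> collinear G g' h \<and> collinear G h a \<and>
      (let A = point_fibre S f a; B = point_fibre S f b; C = point_fibre S f c;
           D = point_fibre S f d; E = point_fibre S f e; F = point_fibre S f f';
           K = point_fibre S f g'; H = point_fibre S f h
       in \<exists>L\<in>Lines S.
         C \<union> B = points_on S L \<and> C \<inter> B = {} \<and>
         cone \<le>o |C| \<and> |C| \<le>o u \<and> cone \<le>o |B| \<and> |B| \<le>o u \<and>
         D = collinear_with_some S C - points_on S L \<and>
         A = collinear_with_some S B - points_on S L \<and>
         E = collinear_with_some S D - (C \<union> D) \<and>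
         H = collinear_with_some S A - (A \<union> B) \<and>
         F = collinear_with_some S E - (D \<union> E) \<and>
         K = collinear_with_some S H - (A \<union> H) \<and>
         line_fibre S G g c b = {L} \<and>
         line_fibre S G g c d = lines_meeting S C - {L} \<and>
         line_fibre S G g a b = lines_meeting S B - {L} \<and>
         line_fibre S G g d e = lines_meeting S D - line_fibre S G g d c \<and>
         line_fibre S G g a h = lines_meeting S A - line_fibre S G g a b \<and>
         line_fibre S G g e f' = lines_meeting S E - line_fibre S G g d e \<and>
         line_fibre S G g g' h = lines_meeting S H - line_fibre S G g a h \<and>
         line_fibre S G g g' f' = lines_meeting S K - line_fibre S G g h g' \<and>
         line_fibre S G g g' f' = lines_meeting S F - line_fibre S G g e f'))"

definition class_b ::
  "('p, 'l) geometry \<Rightarrow> ('q, 'm) geometry \<Rightarrow> ('p \<Rightarrow> 'q) \<Rightarrow> ('l \<Rightarrow> 'm) \<Rightarrow> bool" where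
  "class_b S G f g \<longleftrightarrow> class_a (dual S) (dual G) g f"

end

theory Submission
  imports Defs
begin

text \<open>Pass to the incidence graph, and view the map onto an ordinary octagon as a homomorphism
  of graphs onto the cycle of length 16. Elements over opposite vertices of the cycle are opposite,
  and projection is a bijection between their neighbours. Hence the number \<open>a\<^sub>i\<close> of
  neighbours over \<open>i + 1\<close> of an element over \<open>i\<close> depends on \<open>i\<close> only, the
  degrees are \<open>a\<^sub>i + a\<^sub>j\<close> with \<open>j = i + 8\<close>, and the fibre over
  \<open>i\<close> has \<open>a\<^sub>j \<dots> a\<^sub>k\<close> elements, with \<open>j = i - 7\<close> and
  \<open>k = i - 1\<close>. So the number of points of a finite octagon is a multi-affine function of
  \<open>a\<^sub>0, \<dots>, a\<^sub>7\<close>. On the box given by the degrees, its maximum is the actual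
  number of points, and at a vertex of the box this is attained only if seven consecutive
  \<open>a\<^sub>i\<close> are 1. Then some fibre is a singleton, which is what the classes (a) and (b)
  amount to. Finitely many elements decide which \<open>a\<^sub>i\<close> are 1, so local finite
  generation reduces the general case to the finite one.

  Suppose that the lines of the target have at least three points. Fold it at a point \<open>b\<close>
  onto the cycle: by the above, \<open>b\<close> or one of the two lines through \<open>b\<close> has a
  singleton fibre. It follows that all lines have singleton fibres, so that a point of the thick
  octagon would be on only two lines.\<close>

text \<open>Seven consecutive ones are the signature of one particular kind of map: the retraction
  centred at an element \<open>L\<close>, which records the signed distance from \<open>L\<close>.
  Every octagon has such maps (\<open>fold_map\<close>), and they also supply the number of elements
  with which the fibre count of an arbitrary map is compared, as well as the examples for both
  classes. The comparison works because a product of seven consecutive \<open>a i\<close> never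
  contains both members of a pair \<open>a k\<close>, \<open>a (k + 8)\<close>, whose sum is a
  degree; so the count is affine along each edge of the box.

  In an infinite octagon counting says nothing, and the finiteness hypothesis speaks only about
  generated subgeometries that are themselves octagons. A subset closed under projections is one as
  soon as each member has two neighbours in it, and projecting from opposite members provides even
  three. Keeping points and lines in one graph turns the two classes into one statement: the
  singleton fibre consists of a line or of a point.\<close>

section \<open>Fibre sizes: a multi-affine inequality\<close>

text \<open>The sum over all even \<open>j\<close> of the size of the fibre over \<open>j\<close>, which is the product of the
  \<open>a i\<close> over the seven indices \<open>i\<close> modulo 16 that precede \<open>j\<close>.\<close>

definition fibre_sum :: "(nat \<Rightarrow> nat) \<Rightarrow> nat" where
  "fibre_sum a =
     a 9 * a 10 * a 11 * a 12 * a 13 * a 14 * a 15 + a 11 * a 12 * a 13 * a 14 * a 15 * a 0 * a 1 +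
     a 13 * a 14 * a 15 * a 0 * a 1 * a 2 * a 3 + a 15 * a 0 * a 1 * a 2 * a 3 * a 4 * a 5 +
     a 1 * a 2 * a 3 * a 4 * a 5 * a 6 * a 7 + a 3 * a 4 * a 5 * a 6 * a 7 * a 8 * a 9 +
     a 5 * a 6 * a 7 * a 8 * a 9 * a 10 * a 11 + a 7 * a 8 * a 9 * a 10 * a 11 * a 12 * a 13"

text \<open>The number of points of an octagon of order \<open>(s, t)\<close>.\<close>

definition octagon_size :: "nat \<Rightarrow> nat \<Rightarrow> nat" where
  "octagon_size s t = (1 + s) * (1 + s * t + (s * t)^2 + (s * t)^3)"

text \<open>Seven ones following \<open>j\<close> cyclically; by the product formula for fibres they
  make the fibre over \<open>j + 8\<close> a singleton.\<close>

definition half_pattern :: "(nat \<Rightarrow> nat) \<Rightarrow> bool" where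
  "half_pattern a \<longleftrightarrow> (\<exists>j<16. \<forall>i\<in>{1..7}. a ((j + i) mod 16) = 1)"

lemma half_pattern_unfold:
  "half_pattern a \<longleftrightarrow>
    a 1 = 1 \<and> a 2 = 1 \<and> a 3 = 1 \<and> a 4 = 1 \<and> a 5 = 1 \<and> a 6 = 1 \<and> a 7 = 1 \<or>
    a 2 = 1 \<and> a 3 = 1 \<and> a 4 = 1 \<and> a 5 = 1 \<and> a 6 = 1 \<and> a 7 = 1 \<and> a 8 = 1 \<or>
    a 3 = 1 \<and> a 4 = 1 \<and> a 5 = 1 \<and> a 6 = 1 \<and> a 7 = 1 \<and> a 8 = 1 \<and> a 9 = 1 \<or>
    a 4 = 1 \<and> a 5 = 1 \<and> a 6 = 1 \<and> a 7 = 1 \<and> a 8 = 1 \<and> a 9 = 1 \<and> a 10 = 1 \<or>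
    a 5 = 1 \<and> a 6 = 1 \<and> a 7 = 1 \<and> a 8 = 1 \<and> a 9 = 1 \<and> a 10 = 1 \<and> a 11 = 1 \<or>
    a 6 = 1 \<and> a 7 = 1 \<and> a 8 = 1 \<and> a 9 = 1 \<and> a 10 = 1 \<and> a 11 = 1 \<and> a 12 = 1 \<or>
    a 7 = 1 \<and> a 8 = 1 \<and> a 9 = 1 \<and> a 10 = 1 \<and> a 11 = 1 \<and> a 12 = 1 \<and> a 13 = 1 \<or>
    a 8 = 1 \<and> a 9 = 1 \<and> a 10 = 1 \<and> a 11 = 1 \<and> a 12 = 1 \<and> a 13 = 1 \<and> a 14 = 1 \<or>
    a 9 = 1 \<and> a 10 = 1 \<and> a 11 = 1 \<and> a 12 = 1 \<and> a 13 = 1 \<and> a 14 = 1 \<and> a 15 = 1 \<or>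
    a 10 = 1 \<and> a 11 = 1 \<and> a 12 = 1 \<and> a 13 = 1 \<and> a 14 = 1 \<and> a 15 = 1 \<and> a 0 = 1 \<or>
    a 11 = 1 \<and> a 12 = 1 \<and> a 13 = 1 \<and> a 14 = 1 \<and> a 15 = 1 \<and> a 0 = 1 \<and> a 1 = 1 \<or>
    a 12 = 1 \<and> a 13 = 1 \<and> a 14 = 1 \<and> a 15 = 1 \<and> a 0 = 1 \<and> a 1 = 1 \<and> a 2 = 1 \<or>
    a 13 = 1 \<and> a 14 = 1 \<and> a 15 = 1 \<and> a 0 = 1 \<and> a 1 = 1 \<and> a 2 = 1 \<and> a 3 = 1 \<or>
    a 14 = 1 \<and> a 15 = 1 \<and> a 0 = 1 \<and> a 1 = 1 \<and> a 2 = 1 \<and> a 3 = 1 \<and> a 4 = 1 \<or>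
    a 15 = 1 \<and> a 0 = 1 \<and> a 1 = 1 \<and> a 2 = 1 \<and> a 3 = 1 \<and> a 4 = 1 \<and> a 5 = 1 \<or>
    a 0 = 1 \<and> a 1 = 1 \<and> a 2 = 1 \<and> a 3 = 1 \<and> a 4 = 1 \<and> a 5 = 1 \<and> a 6 = 1"
proof -
  have "{1..7::nat} = {1,2,3,4,5,6,7}" by auto
  moreover have "(\<exists>j<16. P j) \<longleftrightarrow> P 0 \<or> P 1 \<or> P 2 \<or> P 3 \<or> P 4 \<or> P 5 \<or> P 6 \<or> P 7 \<or> P 8 \<or> P 9 \<or>
     P 10 \<or> P 11 \<or> P 12 \<or> P 13 \<or> P 14 \<or> P (15::nat)" for P
    proof -
    have "{..<16::nat} = {0,1,2,3,4,5,6,7,8,9,10,11,12,13,14,15}"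
      by (simp add: lessThan_nat_numeral insert_commute lessThan_Suc)
    then show ?thesis by (metis (no_types, lifting) insert_iff lessThan_iff empty_iff)
  qed
  ultimately show ?thesis unfolding half_pattern_def
    by (simp flip: numeral_2_eq_2)
qed

text \<open>At a vertex each of the eight products is a monomial dividing
  \<open>s ^ 4 * t ^ 3\<close>. Since \<open>s\<close> and \<open>t\<close> are at least 2, each
  missing factor costs a factor of at least 2, and a linear comparison with these bounds settles
  every pattern.\<close>

lemma fibre_sum_vertex:
  fixes s t :: nat
  assumes st: "s \<ge> 2" "t \<ge> 2"
  assumes ev: "\<And>k. k \<in> {0,2,4,6} \<Longrightarrow> a k = 1 \<and> a (k+8) = t \<or> a k = t \<and> a (k+8) = 1"
  assumes od: "\<And>k. k \<in> {1,3,5,7} \<Longrightarrow> a k = 1 \<and> a (k+8) = s \<or> a k = s \<and> a (k+8) = 1"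
  shows "fibre_sum a < octagon_size s t \<or> fibre_sum a = octagon_size s t \<and> half_pattern a"
proof -
  define M where "M = (\<lambda>i j. s ^ i * t ^ j)"
  have mult: "M i j * M k l = M (i + k) (j + l)" for i j k l
    by (simp add: M_def power_add)
  have le: "2 ^ (7 - i - j) * M i j \<le> M 4 3" if "i \<le> 4" "j \<le> 3" for i j
  proof -
    have "2 ^ (7 - i - j) * M i j = 2 ^ (4 - i) * 2 ^ (3 - j) * M i j"
      using that by (simp flip: power_add)
    also have "\<dots> \<le> s ^ (4 - i) * t ^ (3 - j) * M i j"
      using st by (intro mult_right_mono mult_mono power_mono) auto
    also have "\<dots> = M 4 3"
      using that by (simp add: M_def mult_ac flip: power_add) (metis le_add_diff_inverse mult.assoc mult.commute power_add)
    finally show ?thesis .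
  qed
  have bds: "16 * M 0 3 \<le> M 4 3" "32 * M 0 2 \<le> M 4 3" "64 * M 0 1 \<le> M 4 3"
    "8 * M 1 3 \<le> M 4 3" "16 * M 1 2 \<le> M 4 3" "32 * M 1 1 \<le> M 4 3"
    "4 * M 2 3 \<le> M 4 3" "8 * M 2 2 \<le> M 4 3" "16 * M 2 1 \<le> M 4 3" "32 * M 2 0 \<le> M 4 3"
    "4 * M 3 2 \<le> M 4 3" "8 * M 3 1 \<le> M 4 3" "16 * M 3 0 \<le> M 4 3"
    "2 * M 4 2 \<le> M 4 3" "4 * M 4 1 \<le> M 4 3" "8 * M 4 0 \<le> M 4 3"
    using le[of 0 3] le[of 0 2] le[of 0 1] le[of 1 3] le[of 1 2] le[of 1 1] le[of 2 3] le[of 2 2] le[of 2 1] le[of 2 0]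
      le[of 3 2] le[of 3 1] le[of 3 0] le[of 4 2] le[of 4 1] le[of 4 0] by simp_all
  have N: "octagon_size s t = M 4 3 + M 3 3 + M 3 2 + M 2 2 + M 2 1 + M 1 1 + M 1 0 + M 0 0"
    by (simp add: M_def octagon_size_def algebra_simps eval_nat_numeral)
  \<comment> \<open>Writing 1, \<open>s\<close> and \<open>t\<close> as values of \<open>M\<close>
    lets products collapse by mere addition of exponents.\<close>
  have M00: "M 0 0 = 1" "M 1 0 = s" "M 0 1 = t" by (simp_all add: M_def)
  then have ne: "M 1 0 \<noteq> M 0 0" "M 0 1 \<noteq> M 0 0" "M 0 0 > 0" using st by auto
  note exps = mult arith_simps one_add_one numeral_plus_one one_plus_numeral
  have ev': "a k = M 0 0 \<and> a (k+8) = M 0 1 \<or> a k = M 0 1 \<and> a (k+8) = M 0 0" if "k \<in> {0,2,4,6}" for k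
    using ev[OF that] M00 by simp
  have od': "a k = M 0 0 \<and> a (k+8) = M 1 0 \<or> a k = M 1 0 \<and> a (k+8) = M 0 0" if "k \<in> {1,3,5,7}" for k
    using od[OF that] M00 by simp
  \<comment> \<open>Up to rotation, these are all patterns other than the half pattern.\<close>
  have less:
    "M 4 2 + M 3 3 + M 3 1 + M 2 3 + M 2 0 + M 1 2 + M 1 0 + M 0 1 < octagon_size s t"
    "M 4 2 + M 3 2 + M 3 2 + M 2 2 + M 2 1 + M 1 1 + M 1 1 + M 0 1 < octagon_size s t"
    "M 4 2 + M 3 2 + M 3 1 + M 2 2 + M 2 1 + M 1 2 + M 1 1 + M 0 1 < octagon_size s t"
    "M 4 1 + M 3 2 + M 3 1 + M 2 2 + M 2 1 + M 1 2 + M 1 1 + M 0 2 < octagon_size s t"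
    "M 4 1 + M 3 2 + M 3 0 + M 2 3 + M 2 0 + M 1 3 + M 1 1 + M 0 2 < octagon_size s t"
    "M 4 1 + M 3 1 + M 3 1 + M 2 2 + M 2 1 + M 1 2 + M 1 2 + M 0 2 < octagon_size s t"
    "M 4 0 + M 3 1 + M 3 0 + M 2 2 + M 2 1 + M 1 3 + M 1 2 + M 0 3 < octagon_size s t"
    "M 3 3 + M 3 2 + M 2 3 + M 2 2 + M 2 1 + M 2 0 + M 1 1 + M 1 0 < octagon_size s t"
    "M 3 3 + M 3 1 + M 2 3 + M 2 2 + M 2 1 + M 2 0 + M 1 2 + M 1 0 < octagon_size s t"
    "M 3 2 + M 3 2 + M 2 2 + M 2 2 + M 2 1 + M 2 1 + M 1 1 + M 1 1 < octagon_size s t"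
    "M 3 2 + M 3 1 + M 2 2 + M 2 2 + M 2 1 + M 2 1 + M 1 2 + M 1 1 < octagon_size s t"
    "M 3 2 + M 3 0 + M 2 3 + M 2 2 + M 2 1 + M 2 0 + M 1 3 + M 1 1 < octagon_size s t"
    "M 3 1 + M 3 1 + M 2 2 + M 2 2 + M 2 1 + M 2 1 + M 1 2 + M 1 2 < octagon_size s t"
    "M 3 1 + M 3 0 + M 2 3 + M 2 2 + M 2 1 + M 2 0 + M 1 3 + M 1 2 < octagon_size s t"
    unfolding N using bds ne(3) by linarith+
  have "a 0 = M 0 0 \<and> a 8 = M 0 1 \<or> a 0 = M 0 1 \<and> a 8 = M 0 0"
   "a 1 = M 0 0 \<and> a 9 = M 1 0 \<or> a 1 = M 1 0 \<and> a 9 = M 0 0"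
   "a 2 = M 0 0 \<and> a 10 = M 0 1 \<or> a 2 = M 0 1 \<and> a 10 = M 0 0"
   "a 3 = M 0 0 \<and> a 11 = M 1 0 \<or> a 3 = M 1 0 \<and> a 11 = M 0 0"
   "a 4 = M 0 0 \<and> a 12 = M 0 1 \<or> a 4 = M 0 1 \<and> a 12 = M 0 0"
   "a 5 = M 0 0 \<and> a 13 = M 1 0 \<or> a 5 = M 1 0 \<and> a 13 = M 0 0"
   "a 6 = M 0 0 \<and> a 14 = M 0 1 \<or> a 6 = M 0 1 \<and> a 14 = M 0 0"
   "a 7 = M 0 0 \<and> a 15 = M 1 0 \<or> a 7 = M 1 0 \<and> a 15 = M 0 0"
    using ev'[of 0] ev'[of 2] ev'[of 4] ev'[of 6] od'[of 1] od'[of 3] od'[of 5] od'[of 7]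
      by simp_all
  \<comment> \<open>Splits into the 256 vertices. Each is closed by one of the strict bounds
    \<open>less\<close> or, for a half pattern, by an exact evaluation.\<close>
  then show ?thesis
    by (elim disjE conjE)
      (((rule disjI1, unfold fibre_sum_def, simp only: exps, use less in \<open>simp only: add_ac\<close>; fail) |
        (rule disjI2, rule conjI, unfold fibre_sum_def N, simp only: exps,
          (simp only: add_ac)?; simp add: half_pattern_unfold M00; fail))+)
qed


text \<open>\<open>a k\<close> and \<open>a (k + 8)\<close> never occur in the same product, so the
  sum is affine on the segment where \<open>a k + a (k + 8)\<close> is constant. The point
  \<open>(m + 1, n + 1)\<close> is the mean of its two ends with weights \<open>m\<close> and
  \<open>n\<close>.\<close>

lemma fibre_sum_interpolate:
  assumes "k < 8" "a k = Suc m" "a (k + 8) = Suc n"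
  shows "(m + n) * fibre_sum a =
    m * fibre_sum (a(k := Suc (m + n), k + 8 := 1)) + n * fibre_sum (a(k := 1, k + 8 := Suc (m + n)))"
proof -
  consider "k=0"|"k=1"|"k=2"|"k=3"|"k=4"|"k=5"|"k=6"|"k=7" using assms(1) by linarith
  then show ?thesis using assms(2,3)
    by cases (simp_all add: fibre_sum_def algebra_simps)
qed



text \<open>Two half patterns that differ in the pair \<open>(k, k + 8)\<close> only are one step of rotation apart.\<close>

lemma half_pattern_join:
  assumes "k < 8" "\<And>i. i < 8 \<Longrightarrow> a i \<noteq> 1 \<or> a (i + 8) \<noteq> 1" "a k \<noteq> 1" "a (k + 8) \<noteq> 1" "r \<noteq> 1"
    "half_pattern (a(k := r, k + 8 := 1))" "half_pattern (a(k := 1, k + 8 := r))"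
  shows "half_pattern a"
proof -
  \<comment> \<open>Only equality with 1 matters, so each equation becomes a propositional atom. A
    run that avoids the new 1 is already a run of \<open>a\<close>. Otherwise the two runs contain
    \<open>k + 8\<close> and \<open>k\<close>. As \<open>a i\<close> and \<open>a (i + 8)\<close>
    are never both 1, one run ends where it meets its place and the other starts there, and all
    seven places strictly between the two are ones.\<close>
  define P where "P i \<longleftrightarrow> a i = 1" for i
  note P = P_def[symmetric]
  have nk: "\<not> P k" "\<not> P (k + 8)" using assms(3,4) by (simp_all add: P_def)
  have ne: "\<not> P 0 \<or> \<not> P 8" "\<not> P 1 \<or> \<not> P 9" "\<not> P 2 \<or> \<not> P 10" "\<not> P 3 \<or> \<not> P 11"
    "\<not> P 4 \<or> \<not> P 12" "\<not> P 5 \<or> \<not> P 13" "\<not> P 6 \<or> \<not> P 14" "\<not> P 7 \<or> \<not> P 15"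
    using assms(2)[of 0] assms(2)[of 1] assms(2)[of 2] assms(2)[of 3] assms(2)[of 4] assms(2)[of 5]
      assms(2)[of 6] assms(2)[of 7] by (simp_all add: P_def)
  note h = assms(6,7)[unfolded half_pattern_unfold]
  consider "k=0"|"k=1"|"k=2"|"k=3"|"k=4"|"k=5"|"k=6"|"k=7" using assms(1) by linarith
  then show ?thesis
    using h nk ne unfolding half_pattern_unfold P
    by cases (simp del: One_nat_def add: P assms(5), argo)+
qed

text \<open>The pairs are moved to the ends of their segments one after another; in the induction
  those from \<open>K\<close> on are already at an end.\<close>

lemma fibre_sum_le:
  fixes s t :: nat and a :: "nat \<Rightarrow> nat"
  defines "q \<equiv> \<lambda>k::nat. if even k then t else s"
  assumes st: "s \<ge> 2" "t \<ge> 2"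
    and pos: "\<And>k. k < 16 \<Longrightarrow> a k \<ge> 1"
    and sum: "\<And>k. k < 8 \<Longrightarrow> a k + a (k + 8) = q k + 1"
  shows "fibre_sum a < octagon_size s t \<or> fibre_sum a = octagon_size s t \<and> half_pattern a"
proof -
  have *: "fibre_sum a < octagon_size s t \<or> fibre_sum a = octagon_size s t \<and> half_pattern a"
    if "K \<le> 8" "\<And>k. k < 16 \<Longrightarrow> a k \<ge> 1" "\<And>k. k < 8 \<Longrightarrow> a k + a (k + 8) = q k + 1"
      "\<And>k. K \<le> k \<Longrightarrow> k < 8 \<Longrightarrow> a k = 1 \<or> a (k + 8) = 1" for K a
    using that
  proof (induction K arbitrary: a)
    case 0
    have v: "a k = 1 \<and> a (k + 8) = q k \<or> a k = q k \<and> a (k + 8) = 1" if "k < 8" for k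
      using "0.prems"(3)[OF that] "0.prems"(4)[of k] that by auto
    show ?case
    proof (rule fibre_sum_vertex[OF st])
      show "a k = 1 \<and> a (k + 8) = t \<or> a k = t \<and> a (k + 8) = 1" if "k \<in> {0, 2, 4, 6}" for k
      proof -
        have "k < 8" "q k = t" using that by (auto simp: q_def)
        then show ?thesis using v[of k] by simp
      qed
      show "a k = 1 \<and> a (k + 8) = s \<or> a k = s \<and> a (k + 8) = 1" if "k \<in> {1, 3, 5, 7}" for k
      proof -
        have "k < 8" "q k = s" using that by (auto simp: q_def)
        then show ?thesis using v[of k] by simp
      qed
    qed
  next
    case (Suc K)
    show ?case
    proof (cases "a K = 1 \<or> a (K + 8) = 1")
      case True
      show ?thesis
      proof (rule Suc.IH)
        show "a k = 1 \<or> a (k + 8) = 1" if "K \<le> k" "k < 8" for k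
          using Suc.prems(4)[of k] True that by (cases "k = K") auto
      qed (use Suc.prems in auto)
    next
      case False
      have K: "K < 8" using Suc.prems(1) by simp
      obtain m n where mn: "a K = Suc m" "a (K + 8) = Suc n"
        using Suc.prems(2)[of K] Suc.prems(2)[of "K + 8"] K
        by (metis One_nat_def Suc_le_D add_less_cancel_right numeral_Bit0 trans_less_add1)
      have mn0: "m > 0" "n > 0" using False mn by auto
      let ?b = "a(K := Suc (m + n), K + 8 := 1)" and ?c = "a(K := 1, K + 8 := Suc (m + n))"
      have q: "q K = m + n + 1" using Suc.prems(3)[OF K] mn by simp
      have b: "fibre_sum ?b < octagon_size s t \<or> fibre_sum ?b = octagon_size s t \<and> half_pattern ?b"
      proof (rule Suc.IH)
        show "?b k + ?b (k + 8) = q k + 1" if "k < 8" for k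
          using Suc.prems(3)[OF that] q K that by auto
        show "?b k = 1 \<or> ?b (k + 8) = 1" if "K \<le> k" "k < 8" for k
          using Suc.prems(4)[of k] K that by auto
      qed (use Suc.prems in auto)
      have c: "fibre_sum ?c < octagon_size s t \<or> fibre_sum ?c = octagon_size s t \<and> half_pattern ?c"
      proof (rule Suc.IH)
        show "?c k + ?c (k + 8) = q k + 1" if "k < 8" for k
          using Suc.prems(3)[OF that] q K that by auto
        show "?c k = 1 \<or> ?c (k + 8) = 1" if "K \<le> k" "k < 8" for k
          using Suc.prems(4)[of k] K that by auto
      qed (use Suc.prems in auto)
      have eq: "(m + n) * fibre_sum a = m * fibre_sum ?b + n * fibre_sum ?c"
        by (rule fibre_sum_interpolate[of K a m n]) (use K mn in auto)
      show ?thesis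
      \<comment> \<open>A mean with positive weights attains the maximum only if both ends do, and
        then two half patterns are at hand to be joined.\<close>
      proof (cases "fibre_sum ?b = octagon_size s t \<and> fibre_sum ?c = octagon_size s t")
        case True
        then have "(m + n) * fibre_sum a = (m + n) * octagon_size s t"
          using eq by (simp add: algebra_simps)
        then have "fibre_sum a = octagon_size s t" using mn0 by simp
        moreover have "half_pattern a"
        proof (rule half_pattern_join[OF K])
          show "a i \<noteq> 1 \<or> a (i + 8) \<noteq> 1" if "i < 8" for i
            using Suc.prems(3)[OF that] st by (auto simp: q_def split: if_splits)
          show "half_pattern ?b" "half_pattern ?c" using True b c by auto
        qed (use False mn mn0 in auto)
        ultimately show ?thesis by simp
      next
        case False
        have "m * fibre_sum ?b \<le> m * octagon_size s t" "n * fibre_sum ?c \<le> n * octagon_size s t"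
          using b c by (auto intro!: mult_le_mono2)
        moreover have "m * fibre_sum ?b < m * octagon_size s t \<or>
          n * fibre_sum ?c < n * octagon_size s t"
          using b c False mn0 by auto
        ultimately have "(m + n) * fibre_sum a < (m + n) * octagon_size s t"
          unfolding eq unfolding distrib_right by linarith
        then show ?thesis by simp
      qed
    qed
  qed
  show ?thesis by (rule *[of 8]) (use pos sum in auto)
qed

section \<open>Octagons as graphs of girth 16 and diameter 8\<close>

text \<open>The distance is a parameter rather than computed from \<open>adj\<close>: a subset
  closed under projections then inherits it unchanged. \<open>dist_le\<close> bounds the diameter,
  and \<open>closer_unique\<close> encodes the absence of cycles shorter than 16.\<close>

locale octagon =
  fixes V :: "'a set" and adj :: "'a \<Rightarrow> 'a \<Rightarrow> bool" and d :: "'a \<Rightarrow> 'a \<Rightarrow> nat"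
  assumes dist_sym: "\<lbrakk>x \<in> V; y \<in> V\<rbrakk> \<Longrightarrow> d x y = d y x"
    and dist_0: "\<lbrakk>x \<in> V; y \<in> V\<rbrakk> \<Longrightarrow> d x y = 0 \<longleftrightarrow> x = y"
    and dist_1: "\<lbrakk>x \<in> V; y \<in> V\<rbrakk> \<Longrightarrow> d x y = 1 \<longleftrightarrow> adj x y"
    and dist_le: "\<lbrakk>x \<in> V; y \<in> V\<rbrakk> \<Longrightarrow> d x y \<le> 8"
    and dist_step: "\<lbrakk>x \<in> V; y \<in> V; z \<in> V; adj y z\<rbrakk> \<Longrightarrow> d x z = Suc (d x y) \<or> d x y = Suc (d x z)"
    and closer_ex: "\<lbrakk>x \<in> V; y \<in> V; x \<noteq> y\<rbrakk> \<Longrightarrow> \<exists>z\<in>V. adj y z \<and> d x y = Suc (d x z)"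
    and closer_unique: "\<lbrakk>x \<in> V; y \<in> V; z \<in> V; z' \<in> V; d x y < 8; adj y z; adj y z';
          d x y = Suc (d x z); d x y = Suc (d x z')\<rbrakk> \<Longrightarrow> z = z'"
    and two_neighbours: "x \<in> V \<Longrightarrow> \<exists>y\<in>V. \<exists>z\<in>V. adj x y \<and> adj x z \<and> y \<noteq> z"
begin

definition nb :: "'a \<Rightarrow> 'a set" where
  "nb x = {y \<in> V. adj x y}"

text \<open>The projection of \<open>x\<close> onto \<open>y\<close> when \<open>x\<close> and \<open>y\<close> are neither equal nor opposite;
  unspecified for \<open>x = y\<close>, and an arbitrary neighbour of \<open>y\<close> if they are opposite.\<close>

definition closer :: "'a \<Rightarrow> 'a \<Rightarrow> 'a" where
  "closer x y = (SOME z. z \<in> V \<and> adj y z \<and> d x y = Suc (d x z))"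

lemma adj_sym: "\<lbrakk>x \<in> V; y \<in> V; adj x y\<rbrakk> \<Longrightarrow> adj y x"
  using dist_1 dist_sym by metis

lemma nbD: "y \<in> nb x \<Longrightarrow> y \<in> V \<and> adj x y"
  by (simp add: nb_def)

lemma nb_sym: "\<lbrakk>x \<in> V; y \<in> nb x\<rbrakk> \<Longrightarrow> x \<in> nb y"
  using adj_sym by (auto simp: nb_def)

lemma dist_nb: "\<lbrakk>x \<in> V; y \<in> nb x\<rbrakk> \<Longrightarrow> d x y = 1"
  using dist_1 by (auto simp: nb_def)

lemma nb_step: "\<lbrakk>x \<in> V; y \<in> V; z \<in> nb y\<rbrakk> \<Longrightarrow> d x z = Suc (d x y) \<or> d x y = Suc (d x z)"
  using dist_step by (auto simp: nb_def)

lemma closer: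
  assumes "x \<in> V" "y \<in> V" "x \<noteq> y"
  shows "closer x y \<in> nb y" "d x y = Suc (d x (closer x y))"
proof -
  have "\<exists>z. z \<in> V \<and> adj y z \<and> d x y = Suc (d x z)" using closer_ex[OF assms] by auto
  from someI_ex[OF this] show "closer x y \<in> nb y" "d x y = Suc (d x (closer x y))"
    unfolding closer_def[symmetric] nb_def by auto
qed

lemma closer_eq:
  assumes "x \<in> V" "y \<in> V" "z \<in> nb y" "d x y < 8" "d x y = Suc (d x z)"
  shows "closer x y = z"
proof -
  have "x \<noteq> y" using assms dist_0[of x y] by auto
  then show ?thesis
    using closer[OF assms(1,2)] assms closer_unique[of x y] by (auto simp: nb_def)
qed

lemma farther:
  assumes "x \<in> V" "y \<in> V" "z \<in> nb y" "d x y < 8" "z \<noteq> closer x y"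
  shows "d x z = Suc (d x y)"
  using nb_step[OF assms(1-3)] closer_eq[OF assms(1-4)] assms(5) by auto

lemma other_neighbour:
  assumes "x \<in> V" obtains y where "y \<in> nb x" "y \<noteq> w"
proof -
  obtain y z where "y \<in> nb x" "z \<in> nb x" "y \<noteq> z" using two_neighbours[OF assms]
    by (auto simp: nb_def)
  then show ?thesis using that by (cases "y = w") auto
qed

text \<open>\<open>w\<close> lies behind \<open>z\<close> as seen from \<open>m\<close>. A step away
  from \<open>m\<close> is also one away from \<open>z\<close>, since distances to the neighbours
  \<open>m\<close> and \<open>z\<close> differ by exactly one. Iterating prolongs a geodesic through
  \<open>z\<close> up to length 8.\<close>

lemma extend_Suc:
  assumes m: "m \<in> V" and z: "z \<in> nb m" and w: "w \<in> V" "d m w = k" "Suc (d z w) = k" and k: "k < 8"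
    and w': "w' \<in> nb w" "w' \<noteq> closer m w"
  shows "w' \<in> V \<and> d m w' = Suc k \<and> d z w' = k"
proof -
  have zV: "z \<in> V" using nbD[OF z] by simp
  have wV: "w' \<in> V" using w'(1) nbD by blast
  have 1: "d m w' = Suc k" using farther[OF m w(1) w'(1) _ w'(2)] w(2) k by simp
  have "d w' z = Suc (d w' m) \<or> d w' m = Suc (d w' z)" by (rule nb_step[OF wV m z])
  moreover have "d z w' = Suc (d z w) \<or> d z w = Suc (d z w')" by (rule nb_step[OF zV w(1) w'(1)])
  ultimately have "d z w' = k" using 1 w dist_sym[OF zV wV] dist_sym[OF m wV] by auto
  with 1 wV show ?thesis by simp
qed

lemma extend:
  assumes m: "m \<in> V" and z: "z \<in> nb m" and "1 \<le> k" "k \<le> 8"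
  shows "\<exists>w\<in>V. d m w = k \<and> Suc (d z w) = k"
  using assms(3,4)
proof (induction k rule: dec_induct)
  case base
  show ?case using m z dist_nb[of m z] dist_0[of z z] nbD[of z m] by auto
next
  case (step k)
  then obtain w where w: "w \<in> V" "d m w = k" "Suc (d z w) = k" by auto
  obtain w' where w': "w' \<in> nb w" "w' \<noteq> closer m w" using other_neighbour[OF w(1)] by blast
  show ?case using extend_Suc[OF m z w _ w'] step by auto
qed

lemma opposite_bij:
  assumes x: "x \<in> V" and y: "y \<in> V" and xy: "d x y = 8"
  shows "bij_betw (\<lambda>z. closer z y) (nb x) (nb y)"
    and "\<And>z. z \<in> nb x \<Longrightarrow> closer z y \<in> nb y \<and> d z (closer z y) = 6"
proof -
  \<comment> \<open>Proved for every opposite pair, so that exchanging \<open>x\<close> and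
    \<open>y\<close> shows projection back to be the inverse. A neighbour of \<open>x\<close> has
    distance 7 from \<open>y\<close>, which makes its projection unique.\<close>
  have 1: "closer z y \<in> nb y \<and> d z (closer z y) = 6 \<and> closer (closer z y) x = z"
    if "z \<in> nb x" "x \<in> V" "y \<in> V" "d x y = 8" for x y z
  proof -
    have zV: "z \<in> V" using nbD[OF that(1)] by simp
    have yz: "d y z = 7"
      using nb_step[OF that(3,2,1)] dist_sym[OF that(3,2)] that(4) dist_le[OF that(3) zV] by auto
    then have zy: "d z y = 7" "z \<noteq> y" using dist_sym[OF that(3) zV] dist_0[OF that(3) zV] by auto
    note c = closer[OF zV that(3) zy(2)]
    have cV: "closer z y \<in> V" using nbD[OF c(1)] by simp
    have d6: "d z (closer z y) = 6" using c(2) zy(1) by simp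
    have "d x (closer z y) = 7"
      using nb_step[OF that(2,3) c(1)] that(4) dist_le[OF that(2) cV] by auto
    then have "closer (closer z y) x = z"
      using d6 dist_sym[OF cV that(2)] dist_sym[OF cV zV] by (intro closer_eq[OF cV that(2,1)]) auto
    then show ?thesis using c(1) d6 by simp
  qed
  have yx: "d y x = 8" using dist_sym[OF x y] xy by simp
  show "bij_betw (\<lambda>z. closer z y) (nb x) (nb y)"
    by (rule bij_betw_byWitness[of _ "\<lambda>w. closer w x"]) (use 1[OF _ x y xy] 1[OF _ y x yx] in auto)
  show "\<And>z. z \<in> nb x \<Longrightarrow> closer z y \<in> nb y \<and> d z (closer z y) = 6"
    using 1[OF _ x y xy] by simp
qed

text \<open>Two neighbours of \<open>m\<close> have a common opposite: prolong a geodesic from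
  \<open>m\<close> through a third neighbour \<open>z\<close> to distance 7; every neighbour of
  \<open>m\<close> except \<open>z\<close> is then at distance 8 from its end. Composition along an
  even path gives a bijection, also between infinite neighbourhoods.\<close>

lemma thick_bij:
  assumes thick: "\<And>x y z. x \<in> V \<Longrightarrow> \<exists>w\<in>nb x. w \<noteq> y \<and> w \<noteq> z"
  assumes "x \<in> V" "y \<in> V" "even (d x y)"
  shows "\<exists>f. bij_betw f (nb x) (nb y)"
  using assms(3,4)
proof (induction "d x y" arbitrary: y rule: less_induct)
  case less
  show ?case
  proof (cases "x = y")
    case True
    then show ?thesis by auto
  next
    case False
    define m where "m = closer x y"
    have m: "m \<in> nb y" "d x y = Suc (d x m)" using closer[OF assms(2) less(2) False]
      by (simp_all add: m_def)
    have mV: "m \<in> V" using m(1) nbD by blast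
    have "x \<noteq> m" using m(2) less(3) dist_0[OF assms(2) mV] by auto
    define v where "v = closer x m"
    have v: "v \<in> nb m" "d x m = Suc (d x v)" using closer[OF assms(2) mV \<open>x \<noteq> m\<close>]
      by (simp_all add: v_def)
    have vV: "v \<in> V" using v(1) nbD by blast
    have ex: "\<exists>f. bij_betw f (nb x) (nb v)" using less(1)[of v] less(3) m v vV by auto
    obtain z where z: "z \<in> nb m" "z \<noteq> v" "z \<noteq> y" using thick[OF mV] by blast
    obtain w where w: "w \<in> V" "d m w = 7" "d z w = 6" using extend[OF mV z(1), of 7] by auto
    have zV: "z \<in> V" using z(1) nbD by blast
    have op: "d u w = 8" if "u \<in> nb m" "u \<noteq> z" for u
    proof -
      have uV: "u \<in> V" using that nbD by blast
      have "closer w m = z"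
        by (rule closer_eq[OF w(1) mV z(1)]) (use w dist_sym[OF w(1) mV] dist_sym[OF w(1) zV] in auto)
      then have "d w u = Suc (d w m)"
        using that w dist_sym[OF w(1) mV] by (intro farther[OF w(1) mV]) auto
      then show ?thesis using w dist_sym[OF w(1) mV] dist_sym[OF w(1) uV] by simp
    qed
    have "bij_betw (\<lambda>z. closer z w) (nb v) (nb w)"
      by (rule opposite_bij[OF vV w(1)]) (use op v z in auto)
    moreover have "bij_betw (\<lambda>z. closer z w) (nb y) (nb w)"
      by (rule opposite_bij[OF less(2) w(1)]) (use op nb_sym[OF less(2) m(1)] z in auto)
    ultimately show ?thesis using ex by (meson bij_betw_inv bij_betw_trans)
  qed
qed

end

lemma dvd_cong_diff: "(m :: int) dvd a - b \<Longrightarrow> m dvd a \<longleftrightarrow> m dvd b"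
  by (metis diff_add_cancel dvd_add_right_iff)

text \<open>The vertices of the cycle of length 16 are represented by integers modulo 16.\<close>

locale octagon_map = octagon +
  fixes \<psi> :: "'a \<Rightarrow> int"
  assumes hom: "\<lbrakk>x \<in> V; y \<in> V; adj x y\<rbrakk> \<Longrightarrow> 16 dvd \<psi> y - \<psi> x - 1 \<or> 16 dvd \<psi> y - \<psi> x + 1"
    and onto: "\<exists>x\<in>V. 16 dvd \<psi> x - i"
begin

definition fib :: "int \<Rightarrow> 'a set" where
  "fib i = {x \<in> V. 16 dvd \<psi> x - i}"

definition up :: "'a \<Rightarrow> 'a set" where
  "up x = {y \<in> nb x. 16 dvd \<psi> y - \<psi> x - 1}"

definition dn :: "'a \<Rightarrow> 'a set" where
  "dn x = {y \<in> nb x. 16 dvd \<psi> y - \<psi> x + 1}"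

lemma fib_cong: "16 dvd i - j \<Longrightarrow> fib i = fib j"
proof -
  assume "16 dvd i - j"
  then have "16 dvd z - i \<longleftrightarrow> 16 dvd z - j" for z :: int
    by (intro dvd_cong_diff) (simp add: dvd_diff_commute)
  then show ?thesis by (simp add: fib_def)
qed

lemma fib_nonempty: "\<exists>x. x \<in> fib i"
  using onto[of i] by (auto simp: fib_def)

lemma fibD: "x \<in> fib i \<Longrightarrow> x \<in> V \<and> 16 dvd \<psi> x - i"
  by (simp add: fib_def)

lemma nb_cases: "x \<in> V \<Longrightarrow> nb x = up x \<union> dn x"
  using hom[of x] by (auto simp: up_def dn_def nb_def)

lemma up_dn_disjoint: "up x \<inter> dn x = {}"
proof -
  have "\<not> (16 dvd z - 1 \<and> 16 dvd z + 1)" for z :: int by presburger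
  then show ?thesis unfolding up_def dn_def by blast
qed

lemma up_fib: "x \<in> fib i \<Longrightarrow> up x = nb x \<inter> fib (i + 1)"
proof -
  assume "x \<in> fib i"
  then have "16 dvd \<psi> x - i" by (simp add: fib_def)
  then have "16 dvd z - \<psi> x - 1 \<longleftrightarrow> 16 dvd z - (i + 1)" for z :: int
    by (intro dvd_cong_diff) (simp add: dvd_diff_commute)
  then show ?thesis by (auto simp: up_def fib_def nb_def)
qed

lemma dn_fib: "x \<in> fib i \<Longrightarrow> dn x = nb x \<inter> fib (i - 1)"
proof -
  assume "x \<in> fib i"
  then have "16 dvd \<psi> x - i" by (simp add: fib_def)
  then have "16 dvd z - \<psi> x + 1 \<longleftrightarrow> 16 dvd z - (i - 1)" for z :: int
    by (intro dvd_cong_diff) (simp add: dvd_diff_commute)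
  then show ?thesis by (auto simp: dn_def fib_def nb_def)
qed

lemma up_dn_sym: "x \<in> V \<Longrightarrow> y \<in> V \<Longrightarrow> y \<in> up x \<longleftrightarrow> x \<in> dn y"
proof -
  have "16 dvd \<psi> y - \<psi> x - 1 \<longleftrightarrow> 16 dvd \<psi> x - \<psi> y + 1" by presburger
  then show "x \<in> V \<Longrightarrow> y \<in> V \<Longrightarrow> y \<in> up x \<longleftrightarrow> x \<in> dn y"
    using nb_sym by (auto simp: up_def dn_def dest: nbD)
qed

text \<open>\<open>e\<close> is the number of steps up minus the number of steps down in the image
  of a geodesic; it lifts the difference of positions from residues to integers.\<close>

lemma winding:
  assumes "x \<in> V" "y \<in> V"
  shows "\<exists>e. \<bar>e\<bar> \<le> int (d x y) \<and> 16 dvd \<psi> y - \<psi> x - e \<and> even (e - int (d x y))"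
  using assms(2)
proof (induction "d x y" arbitrary: y)
  case 0
  then show ?case using dist_0[OF assms(1), of y] by auto
next
  case (Suc n)
  then have "x \<noteq> y" using dist_0[OF assms(1), of y] by auto
  note c = closer[OF assms(1) Suc(3) this]
  have cV: "closer x y \<in> V" using nbD[OF c(1)] by simp
  have dc: "d x (closer x y) = n" using c(2) Suc(2) by simp
  obtain e where e: "\<bar>e\<bar> \<le> int n" "16 dvd \<psi> (closer x y) - \<psi> x - e" "even (e - int n)"
    using Suc(1)[OF dc[symmetric] cV] dc by auto
  have "16 dvd \<psi> (closer x y) - \<psi> y - 1 \<or> 16 dvd \<psi> (closer x y) - \<psi> y + 1"
    using hom[OF Suc(3) cV] nbD[OF c(1)] by auto
  then have "16 dvd \<psi> y - \<psi> x - (e - 1) \<or> 16 dvd \<psi> y - \<psi> x - (e + 1)"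
    using dvd_diff[OF e(2), of "\<psi> (closer x y) - \<psi> y - 1"] dvd_diff[OF e(2), of
      "\<psi> (closer x y) - \<psi> y + 1"]
    by (auto simp: algebra_simps)
  moreover have "\<bar>e - 1\<bar> \<le> int (d x y)" "\<bar>e + 1\<bar> \<le> int (d x y)" using e(1) Suc(2) by auto
  moreover have "even (e - 1 - int (d x y))" "even (e + 1 - int (d x y))"
    using e(3) Suc(2)[symmetric] by auto
  ultimately show ?case by blast
qed

lemma dist_ge:
  assumes "x \<in> fib i" "y \<in> fib (i + k)" "0 \<le> k" "k \<le> 8"
  shows "k \<le> int (d x y)" and "even (k - int (d x y))"
proof -
  obtain e where e: "\<bar>e\<bar> \<le> int (d x y)" "16 dvd \<psi> y - \<psi> x - e" "even (e - int (d x y))"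
    using winding[of x y] assms fibD by blast
  have "16 dvd \<psi> x - i" "16 dvd \<psi> y - (i + k)" using assms fibD by blast+
  from dvd_diff[OF dvd_diff[OF this(2,1)] e(2)] have 16: "16 dvd e - k" by (simp add: algebra_simps)
  then show "k \<le> int (d x y)" using e(1) assms(3,4) by presburger
  show "even (k - int (d x y))" using 16 e(3) by presburger
qed

text \<open>The gap in position bounds the distance from below, the diameter bounds it from above,
  and parity excludes 8. So the fibres alone decide the distances 7 and 8.\<close>

lemma dist_7: "\<lbrakk>x \<in> fib i; y \<in> fib (i + 7)\<rbrakk> \<Longrightarrow> d x y = 7"
proof -
  assume a: "x \<in> fib i" "y \<in> fib (i + 7)"
  have "d x y \<le> 8" using a dist_le fibD by blast
  then show "d x y = 7" using dist_ge[OF a] by presburger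
qed

lemma dist_8: "\<lbrakk>x \<in> fib i; y \<in> fib (i + 8)\<rbrakk> \<Longrightarrow> d x y = 8"
proof -
  assume a: "x \<in> fib i" "y \<in> fib (i + 8)"
  have "d x y \<le> 8" using a dist_le fibD by blast
  then show "d x y = 8" using dist_ge(1)[OF a] by presburger
qed

text \<open>The projection of a neighbour over \<open>i + 1\<close> lies over \<open>i + 7\<close>,
  because over \<open>i + 9\<close> it would be at distance 8 instead of 6. Geodesics that leave
  \<open>x\<close> upwards thus arrive at \<open>y\<close> from below.\<close>

lemma opposite_up_dn:
  assumes x: "x \<in> fib i" and y: "y \<in> fib (i + 8)"
  shows "bij_betw (\<lambda>z. closer z y) (up x) (dn y)"
    and "bij_betw (\<lambda>z. closer z y) (dn x) (up y)"
proof -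
  have V: "x \<in> V" "y \<in> V" using x y fibD by blast+
  note b = opposite_bij[OF V dist_8[OF x y]]
  have y': "dn y = nb y \<inter> fib (i + 7)" "up y = nb y \<inter> fib (i + 9)"
    using dn_fib[OF y] up_fib[OF y] by (simp_all add: add.commute)
  have u: "closer z y \<in> dn y" if "z \<in> up x" for z
  proof -
    have z: "z \<in> nb x" "z \<in> fib (i + 1)" using that up_fib[OF x] by auto
    have "closer z y \<notin> fib (i + 9)" using dist_8[OF z(2), of "closer z y"] b(2)[OF z(1)]
      by (auto simp: add.commute)
    then show ?thesis using b(2)[OF z(1)] nb_cases[OF V(2)] y' by blast
  qed
  have w: "closer z y \<in> up y" if "z \<in> dn x" for z
  proof -
    have z: "z \<in> nb x" "z \<in> fib (i - 1)" using that dn_fib[OF x] by auto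
    have "closer z y \<notin> fib (i + 7)" using dist_8[OF z(2), of "closer z y"] b(2)[OF z(1)]
      by (auto simp: add.commute)
    then show ?thesis using b(2)[OF z(1)] nb_cases[OF V(2)] y' by blast
  qed
  have inj: "inj_on (\<lambda>z. closer z y) (nb x)" and img: "(\<lambda>z. closer z y) ` nb x = nb y"
    using b(1) by (auto simp: bij_betw_def)
  note c = nb_cases[OF V(1)] nb_cases[OF V(2)]
  have ex: "\<exists>z\<in>nb x. v = closer z y" if "v \<in> nb y" for v using that img by blast
  have "v \<in> (\<lambda>z. closer z y) ` up x" if v: "v \<in> dn y" for v
  proof -
    obtain z where z: "z \<in> nb x" "v = closer z y" using ex[of v] v y' by blast
    then have "z \<notin> dn x" using w[of z] v up_dn_disjoint[of y] by blast
    then show ?thesis using z c(1) by blast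
  qed
  moreover have "v \<in> (\<lambda>z. closer z y) ` dn x" if v: "v \<in> up y" for v
  proof -
    obtain z where z: "z \<in> nb x" "v = closer z y" using ex[of v] v y' by blast
    then have "z \<notin> up x" using u[of z] v up_dn_disjoint[of y] by blast
    then show ?thesis using z c(1) by blast
  qed
  moreover have "up x \<subseteq> nb x" "dn x \<subseteq> nb x" using c(1) by blast+
  ultimately show "bij_betw (\<lambda>z. closer z y) (up x) (dn y)"
    "bij_betw (\<lambda>z. closer z y) (dn x) (up y)"
    using u w inj unfolding bij_betw_def by (blast intro: inj_on_subset)+
qed

text \<open>Surjectivity on vertices implies local surjectivity: some element lies over
  \<open>\<psi> x + 7\<close>, at distance 7, and its projection onto \<open>x\<close> cannot lie
  below \<open>x\<close>, since the distance between the two would then be 8.\<close>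

lemma up_nonempty:
  assumes "x \<in> V" shows "up x \<noteq> {}"
proof -
  have x: "x \<in> fib (\<psi> x)" using assms by (simp add: fib_def)
  obtain z where z: "z \<in> fib (\<psi> x + 7)" using fib_nonempty by blast
  have zx: "d z x = 7" "z \<noteq> x"
    using dist_7[OF x z] dist_sym[OF assms, of z] dist_0[OF assms, of z] z by (auto simp: fib_def)
  have zV: "z \<in> V" using z fibD by blast
  note c = closer[OF zV assms zx(2)]
  have "closer z x \<notin> fib (\<psi> x - 1)"
  proof
    assume a: "closer z x \<in> fib (\<psi> x - 1)"
    have "d (closer z x) z = 8" by (rule dist_8[OF a]) (use z in \<open>simp add: add.commute\<close>)
    then show False using c zx dist_sym[OF zV, of "closer z x"] nbD[OF c(1)] by simp
  qed
  then show ?thesis using c(1) nb_cases[OF assms] dn_fib[OF x] by blast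
qed

lemma dn_nonempty:
  assumes "x \<in> V" shows "dn x \<noteq> {}"
proof -
  have x: "x \<in> fib (\<psi> x)" using assms by (simp add: fib_def)
  obtain y where y: "y \<in> fib (\<psi> x + 8)" using fib_nonempty by blast
  have "up y \<noteq> {}" using up_nonempty y fibD by blast
  then show ?thesis using opposite_up_dn(2)[OF x y] by (auto simp: bij_betw_def)
qed

text \<open>A path no longer than the rise in position cannot contain a step down.\<close>

lemma closer_dn:
  assumes x: "x \<in> fib i" and n: "n < 7" and w: "w \<in> fib (i + int (Suc n))" "d x w = Suc n"
  shows "closer x w \<in> dn w" "closer x w \<in> fib (i + int n)" "d x (closer x w) = n"
proof -
  have V: "x \<in> V" "w \<in> V" using x w fibD by blast+
  have "x \<noteq> w" using w(2) dist_0[OF V] by auto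
  note c = closer[OF V this]
  show dc: "d x (closer x w) = n" using c(2) w(2) by simp
  have "closer x w \<notin> fib (i + int (Suc n) + 1)"
  proof
    assume "closer x w \<in> fib (i + int (Suc n) + 1)"
    then have "closer x w \<in> fib (i + (int (Suc n) + 1))" by (simp only: add.assoc)
    from dist_ge(1)[OF x this] show False using dc n by simp
  qed
  then show dn: "closer x w \<in> dn w" using c(1) nb_cases[OF V(2)] up_fib[OF w(1)] by blast
  then show "closer x w \<in> fib (i + int n)" using dn_fib[OF w(1)] by auto
qed

text \<open>From an element over \<open>i + 7\<close> only one descending path leads to level
  \<open>i\<close>, and by \<open>dist_7\<close> every element over \<open>i\<close> is the end of
  such a path.\<close>

lemma fib_singleton:
  assumes one: "\<And>k x. 1 \<le> k \<Longrightarrow> k \<le> 7 \<Longrightarrow> x \<in> fib (i + k) \<Longrightarrow> is_singleton (dn x)"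
  shows "is_singleton (fib i)"
proof -
  have *: "x = x'" if "x \<in> fib i" "x' \<in> fib i" "n \<le> 7" "y \<in> fib (i + int n)" "d x y = n"
    "d x' y = n" for n x x' y
    using that
  proof (induction n arbitrary: y)
    case 0
    then have "x \<in> V" "x' \<in> V" "y \<in> V" using fibD by blast+
    then show ?case using 0 dist_0[of x y] dist_0[of x' y] by simp
  next
    case (Suc n)
    have n: "n < 7" using Suc.prems(3) by simp
    note c = closer_dn[OF Suc.prems(1) n Suc.prems(4,5)]
      and c' = closer_dn[OF Suc.prems(2) n Suc.prems(4,6)]
    have "is_singleton (dn y)" by (rule one[of "int (Suc n)"]) (use Suc.prems in auto)
    then have "closer x y = closer x' y" using c(1) c'(1) by (auto simp: is_singleton_def)
    then show ?case using Suc.IH[OF Suc.prems(1,2), of "closer x y"] n c c' by simp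
  qed
  obtain z where z: "z \<in> fib (i + 7)" using fib_nonempty by blast
  have "x = x'" if "x \<in> fib i" "x' \<in> fib i" for x x'
    using *[OF that, of 7 z] dist_7[OF that(1) z] dist_7[OF that(2) z] z by simp
  then show ?thesis using fib_nonempty[of i] by (auto simp: is_singleton_def)
qed

end

section \<open>Counting fibres\<close>

context octagon_map
begin

lemma dn_subset: "dn x \<subseteq> nb x"
  by (auto simp: dn_def)

text \<open>Below distance 8 an element has a unique neighbour closer to \<open>x\<close>, so the
  sets \<open>up y\<close> do not overlap and partition the next layer.\<close>

lemma layer_Suc:
  assumes x: "x \<in> fib i" and n: "n < 7"
  shows "{y \<in> fib (i + int (Suc n)). d x y = Suc n} = (\<Union>y \<in> {y \<in> fib (i + int n). d x y = n}. up y)"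
    and "\<lbrakk>y \<in> fib (i + int n); d x y = n; z \<in> fib (i + int n); d x z = n; y \<noteq> z\<rbrakk> \<Longrightarrow> up y \<inter> up z = {}"
proof -
  have xV: "x \<in> V" using x fibD by blast
  have 1: "w \<in> fib (i + int (Suc n)) \<and> d x w = Suc n \<and> w \<in> nb y \<and> w \<in> V" 
    if y: "y \<in> fib (i + int n)" "d x y = n" and w: "w \<in> up y" for y w
  proof -
    have yV: "y \<in> V" using y fibD by blast
    have wf: "w \<in> fib (i + int (Suc n))" and wn: "w \<in> nb y"
      using w up_fib[OF y(1)] by (auto simp: add.commute add.left_commute)
    have "int (Suc n) \<le> int (d x w)" by (rule dist_ge(1)[OF x wf]) (use n in auto)
    moreover have "d x w \<le> Suc (d x y)" using nb_step[OF xV yV wn] by auto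
    ultimately have "d x w = Suc n" using y(2) by simp
    then show ?thesis using wf wn fibD by blast
  qed
  have 2: "closer x w \<in> fib (i + int n) \<and> d x (closer x w) = n \<and> w \<in> up (closer x w)"
    if w: "w \<in> fib (i + int (Suc n))" "d x w = Suc n" for w
    using closer_dn[OF x n w] up_dn_sym[of "closer x w" w] fibD[OF w(1)] fibD by blast
  show "{y \<in> fib (i + int (Suc n)). d x y = Suc n} = (\<Union>y \<in> {y \<in> fib (i + int n). d x y = n}. up y)"
    using 1 2 by blast
  show "up y \<inter> up z = {}"
    if "y \<in> fib (i + int n)" "d x y = n" "z \<in> fib (i + int n)" "d x z = n" "y \<noteq> z"
  proof (rule ccontr)
    assume "up y \<inter> up z \<noteq> {}"
    then obtain w where w: "w \<in> up y" "w \<in> up z" by blast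
    have V: "y \<in> V" "z \<in> V" using that fibD by blast+
    note wy = 1[OF that(1,2) w(1)] and wz = 1[OF that(3,4) w(2)]
    have "closer x w = y" by (rule closer_eq) (use wy xV V n that nb_sym in auto)
    moreover have "closer x w = z" by (rule closer_eq) (use wz xV V n that nb_sym in auto)
    ultimately show False using that(5) by simp
  qed
qed

text \<open>This is the number \<open>a i\<close> of the overview; \<open>card_up_dn\<close> shows
  that it does not depend on the choice, and that down-degrees over \<open>i\<close> are up-degrees
  over \<open>i + 8\<close>.\<close>

definition upsize :: "int \<Rightarrow> nat" where
  "upsize i = card (up (SOME x. x \<in> fib i))"

lemma upsize_cong: "16 dvd i - j \<Longrightarrow> upsize i = upsize j"
  using fib_cong by (simp add: upsize_def)

lemma card_up_dn:
  assumes "x \<in> fib i"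
  shows "card (up x) = upsize i" "card (dn x) = upsize (i + 8)"
proof -
  obtain y where y: "y \<in> fib (i + 8)" using fib_nonempty by blast
  have s: "(SOME x. x \<in> fib j) \<in> fib j" for j using fib_nonempty by (rule someI_ex)
  have *: "card (up u) = card (dn y)" if "u \<in> fib i" for u
    by (rule bij_betw_same_card[OF opposite_up_dn(1)[OF that y]])
  show "card (up x) = upsize i" using *[OF assms] *[OF s] by (simp add: upsize_def)
  show "card (dn x) = upsize (i + 8)"
    unfolding upsize_def by (rule bij_betw_same_card[OF opposite_up_dn(2)[OF assms s]])
qed

end

locale finite_octagon_map = octagon_map +
  assumes finite_V: "finite V"
begin

lemma finite_fib: "finite (fib i)" and finite_up: "finite (up x)" and finite_dn: "finite (dn x)"
  using finite_V by (auto simp: nb_def fib_def up_def dn_def)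

lemma upsize_pos: "upsize i \<ge> 1"
proof -
  obtain x where "x \<in> fib i" using fib_nonempty by blast
  then show ?thesis using card_up_dn(1)[of x i] up_nonempty[of x] finite_up[of x] fibD[of x i]
    by (metis One_nat_def Suc_leI card_gt_0_iff)
qed

lemma card_nb:
  assumes "x \<in> fib i" shows "card (nb x) = upsize i + upsize (i + 8)"
proof -
  have "card (nb x) = card (up x) + card (dn x)"
    using nb_cases fibD[OF assms] card_Un_disjoint[OF finite_up finite_dn up_dn_disjoint] by metis
  then show ?thesis using card_up_dn[OF assms] by simp
qed

lemma card_layer:
  assumes x: "x \<in> fib i" and "n \<le> 7"
  shows "card {y \<in> fib (i + int n). d x y = n} = (\<Prod>k<n. upsize (i + int k))"
  using assms(2)
proof (induction n)
  case 0
  have "{y \<in> fib (i + int 0). d x y = 0} = {x}" using x dist_0 fibD by auto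
  then show ?case by simp
next
  case (Suc n)
  have "card {y \<in> fib (i + int (Suc n)). d x y = Suc n} = (\<Sum>y \<in> {y \<in> fib (i + int n). d x y = n}. card (up y))"
    unfolding layer_Suc(1)[OF x, of n, OF Suc_le_lessD[OF Suc.prems]]
    by (rule card_UN_disjoint) (use finite_fib finite_up layer_Suc(2)[OF x, of n] Suc.prems in auto)
  also have "\<dots> = (\<Sum>y \<in> {y \<in> fib (i + int n). d x y = n}. upsize (i + int n))"
    by (rule sum.cong) (use card_up_dn(1) in auto)
  also have "\<dots> = card {y \<in> fib (i + int n). d x y = n} * upsize (i + int n)"
    by simp
  finally show ?case using Suc by simp
qed

lemma card_fib: "card (fib (i + 7)) = (\<Prod>k<7. upsize (i + int k))"
proof -
  obtain x where x: "x \<in> fib i" using fib_nonempty by blast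
  have "{y \<in> fib (i + int 7). d x y = 7} = fib (i + 7)" using dist_7[OF x] by auto
  then show ?thesis using card_layer[OF x, of 7] by simp
qed

lemma card_even: "card {x \<in> V. even (\<psi> x)} = fibre_sum (\<lambda>n. upsize (int n))"
proof -
  have e: "{x \<in> V. even (\<psi> x)} = (\<Union>j\<in>{..<8::nat}. fib (2 * int j))"
  proof -
    have "even z \<longleftrightarrow> (\<exists>j\<in>{..<8::nat}. 16 dvd z - 2 * int j)" for z :: int
    proof
      assume "even z"
      then obtain w where w: "z = 2 * w" by blast
      have "16 dvd 2 * w - 2 * (w mod 8)" by presburger
      then have "16 dvd z - 2 * int (nat (w mod 8))" "nat (w mod 8) < 8"
        by (simp_all add: w nat_less_iff)
      then show "\<exists>j\<in>{..<8::nat}. 16 dvd z - 2 * int j" by blast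
    next
      assume "\<exists>j\<in>{..<8::nat}. 16 dvd z - 2 * int j"
      then obtain j where "16 dvd z - 2 * int j" by blast
      then show "even z" by presburger
    qed
    then show ?thesis by (auto simp: fib_def)
  qed
  have "card {x \<in> V. even (\<psi> x)} = (\<Sum>j<8. card (fib (2 * int j)))"
    unfolding e
  proof (rule card_UN_disjoint)
    show "\<forall>i\<in>{..<8}. \<forall>j\<in>{..<8}. i \<noteq> j \<longrightarrow> fib (2 * int i) \<inter> fib (2 * int j) = {}"
    proof (intro ballI impI)
      fix i j :: nat assume ij: "i \<in> {..<8}" "j \<in> {..<8}" "i \<noteq> j"
      have "i < 8" "j < 8" using ij by auto
      then have "\<not> 16 dvd 2 * int j - 2 * int i" using ij(3) by presburger
      then have "\<not> (16 dvd z - 2 * int i \<and> 16 dvd z - 2 * int j)" for z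
        using dvd_diff[of 16 "z - 2 * int i" "z - 2 * int j"] by auto
      then show "fib (2 * int i) \<inter> fib (2 * int j) = {}" by (auto simp: fib_def)
    qed
  qed (use finite_fib in auto)
  \<comment> \<open>\<open>2 * j - 7 + k\<close> may be negative, whereas \<open>fibre_sum\<close>
    takes naturals; \<open>2 * j + 9 + k\<close> is congruent to it modulo 16.\<close>
  also have "\<dots> = (\<Sum>j<8. \<Prod>k<7. upsize (int ((2 * j + 9 + k) mod 16)))"
  proof (rule sum.cong)
    fix j :: nat
    have "card (fib (2 * int j)) = (\<Prod>k<7. upsize (2 * int j - 7 + int k))"
      using card_fib[of "2 * int j - 7"] by simp
    also have "\<dots> = (\<Prod>k<7. upsize (int ((2 * j + 9 + k) mod 16)))"
    proof (rule prod.cong)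
      fix k :: nat
      let ?w = "2 * int j + 9 + int k"
      have "16 dvd ?w - ?w mod 16 - 16" by (intro dvd_diff dvd_minus_mod) simp
      then have "16 dvd (2 * int j - 7 + int k) - int ((2 * j + 9 + k) mod 16)"
        by (simp add: of_nat_mod algebra_simps)
      then show "upsize (2 * int j - 7 + int k) = upsize (int ((2 * j + 9 + k) mod 16))"
        by (rule upsize_cong)
    qed simp
    finally show "card (fib (2 * int j)) = (\<Prod>k<7. upsize (int ((2 * j + 9 + k) mod 16)))" .
  qed simp
  also have "\<dots> = fibre_sum (\<lambda>n. upsize (int n))"
  proof -
    have "{..<7::nat} = {0,1,2,3,4,5,6}" "{..<8::nat} = {0,1,2,3,4,5,6,7}"
      by (simp_all add: lessThan_nat_numeral lessThan_Suc insert_commute)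
    then show ?thesis by (simp add: fibre_sum_def mult_ac)
  qed
  finally show ?thesis .
qed

end

section \<open>Folding an octagon onto the cycle\<close>

context octagon
begin

text \<open>The signed distance from \<open>L\<close>: the sign tells on which side of a partition
  of the neighbours of \<open>L\<close> a geodesic from \<open>L\<close> starts. At distances 0 and
  8 no first step is determined, but 8 and -8 agree modulo 16.\<close>

definition fold_map :: "'a \<Rightarrow> 'a set \<Rightarrow> 'a \<Rightarrow> int" where
  "fold_map L C x = (if d L x = 0 then 0 else if d L x = 8 then 8
     else if closer x L \<in> C then int (d L x) else - int (d L x))"

text \<open>A step away from \<open>L\<close> that stays below distance 8 keeps the first step of
  the geodesic from \<open>L\<close>, hence the sign in \<open>fold_map\<close>.\<close>

lemma closer_base_eq:
  assumes "L \<in> V" "x \<in> V" "y \<in> nb x" "0 < d L x" "d L y = Suc (d L x)" "d L y < 8"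
  shows "closer y L = closer x L"
proof -
  have yV: "y \<in> V" using assms nbD by blast
  have "x \<noteq> L" using assms(1,4) dist_0[of L x] by auto
  note c = closer[OF assms(2,1) this]
  have cV: "closer x L \<in> V" using c(1) nbD by blast
  have "d (closer x L) y = Suc (d (closer x L) x) \<or> d (closer x L) x = Suc (d (closer x L) y)"
    by (rule nb_step[OF cV assms(2,3)])
  moreover have "d y (closer x L) = Suc (d y L) \<or> d y L = Suc (d y (closer x L))"
    by (rule nb_step[OF yV assms(1) c(1)])
  ultimately have "d y L = Suc (d y (closer x L))"
    using c(2) assms(5) dist_sym[OF assms(1,2)] dist_sym[OF assms(1) yV] dist_sym[OF cV yV]
      dist_sym[OF cV assms(2)] by arith
  then show ?thesis
    using assms(6) dist_sym[OF assms(1) yV] by (intro closer_eq[OF yV assms(1) c(1)]) auto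
qed

lemma fold_map_cases:
  assumes "L \<in> V" "x \<in> V"
  shows "fold_map L C x = int (d L x) \<or> fold_map L C x = - int (d L x)"
  by (auto simp: fold_map_def)

lemma fold_map_step:
  assumes L: "L \<in> V" and x: "x \<in> V" and y: "y \<in> nb x" and s: "d L y = Suc (d L x)"
  shows "16 dvd fold_map L C y - fold_map L C x - 1 \<or> 16 dvd fold_map L C y - fold_map L C x + 1"
proof -
  have yV: "y \<in> V" using y nbD by blast
  have le: "d L y \<le> 8" by (rule dist_le[OF L yV])
  consider "d L x = 0" | "0 < d L x" "d L y < 8" | "d L y = 8" using le by linarith
  then show ?thesis
  proof cases
    case 1
    then show ?thesis using s by (auto simp: fold_map_def)
  next
    case 2
    then show ?thesis using closer_base_eq[OF L x y 2(1) s 2(2)] s by (auto simp: fold_map_def)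
  next
    case 3
    then have "d L x = 7" using s by simp
    then show ?thesis using 3 by (auto simp: fold_map_def)
  qed
qed

lemma octagon_map_fold:
  assumes L: "L \<in> V" and C: "c \<in> nb L" "c \<in> C" and B: "b \<in> nb L" "b \<notin> C"
  shows "octagon_map V adj d (fold_map L C)"
proof
  fix x y assume xy: "x \<in> V" "y \<in> V" "adj x y"
  then have n: "y \<in> nb x" "x \<in> nb y" using adj_sym by (auto simp: nb_def)
  show "16 dvd fold_map L C y - fold_map L C x - 1 \<or> 16 dvd fold_map L C y - fold_map L C x + 1"
    using nb_step[OF L xy(1) n(1)]
  proof
    assume "d L y = Suc (d L x)"
    then show ?thesis by (rule fold_map_step[OF L xy(1) n(1)])
  next
    assume "d L x = Suc (d L y)"
    from fold_map_step[OF L xy(2) n(2) this, of C] show ?thesis by presburger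
  qed
next
  fix i :: int
  \<comment> \<open>Geodesics prolonged through \<open>c\<close> reach the values 1 to 7, those
    through \<open>b\<close> the values -1 to -7.\<close>
  have *: "\<exists>x\<in>V. fold_map L C x = (if z \<in> C then int k else - int k)" if z: "z \<in> nb L" and k:
    "1 \<le> k" "k < 8" for z k
  proof -
    obtain w where w: "w \<in> V" "d L w = k" "Suc (d z w) = k" using extend[OF L z, of k] k by auto
    have zV: "z \<in> V" using z nbD by blast
    have "closer w L = z"
      using w k dist_sym[OF L w(1)] dist_sym[OF zV w(1)] by (intro closer_eq[OF w(1) L z]) auto
    then show ?thesis using w k by (intro bexI[of _ w]) (auto simp: fold_map_def)
  qed
  define r where "r = i mod 16"
  have r: "0 \<le> r" "r < 16" "16 dvd r - i" by (simp_all add: r_def) presburger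
  consider "r = 0" | "0 < r" "r < 8" | "r = 8" | "8 < r" using r by linarith
  then have "\<exists>x\<in>V. 16 dvd fold_map L C x - r"
  proof cases
    case 1
    then show ?thesis using L dist_0[OF L L] by (intro bexI[of _ L]) (auto simp: fold_map_def)
  next
    case 2
    then have "1 \<le> nat r" "nat r < 8" by auto
    from *[OF C(1) this] obtain x where "x \<in> V" "fold_map L C x = int (nat r)" using C(2) by auto
    then show ?thesis using 2 by (intro bexI[of _ x]) auto
  next
    case 3
    obtain w where "w \<in> V" "d L w = 8" using extend[OF L C(1), of 8] by auto
    then show ?thesis using 3 by (intro bexI[of _ w]) (auto simp: fold_map_def)
  next
    case 4
    then have "1 \<le> nat (16 - r)" "nat (16 - r) < 8" using r by auto
    from *[OF B(1) this] obtain x where "x \<in> V" "fold_map L C x = - int (nat (16 - r))" using B(2)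
      by auto
    then show ?thesis using 4 r by (intro bexI[of _ x]) auto
  qed
  then obtain x where "x \<in> V" "16 dvd fold_map L C x - r" by blast
  moreover from this(2) have "16 dvd fold_map L C x - i" using r(3) by presburger
  ultimately show "\<exists>x\<in>V. 16 dvd fold_map L C x - i" by blast
qed

end

context octagon
begin

lemma fold_map_bounds:
  assumes "L \<in> V" "x \<in> V"
  shows "- 8 \<le> fold_map L C x" "fold_map L C x \<le> 8"
proof -
  have "int (d L x) \<le> 8" "0 \<le> int (d L x)" using dist_le[OF assms] by auto
  then show "- 8 \<le> fold_map L C x" "fold_map L C x \<le> 8" using fold_map_cases[OF assms, of C]
    by arith+
qed

lemma fold_map_eq_iff:
  assumes "L \<in> V" "x \<in> V" "1 \<le> k" "k \<le> 7"
  shows "16 dvd fold_map L C x - k \<longleftrightarrow> fold_map L C x = k"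
  using fold_map_bounds[OF assms(1,2), of C] assms(3,4) by presburger

lemma fold_map_0_iff:
  assumes L: "L \<in> V" and x: "x \<in> V"
  shows "16 dvd fold_map L C x \<longleftrightarrow> x = L"
proof -
  have "16 dvd fold_map L C x \<longleftrightarrow> fold_map L C x = 0"
    using fold_map_bounds[OF assms, of C] by presburger
  also have "\<dots> \<longleftrightarrow> x = L" using dist_0[OF L x] by (auto simp: fold_map_def)
  finally show ?thesis .
qed

lemma fold_map_pos: "fold_map L C x = k \<Longrightarrow> k > 0 \<Longrightarrow> k = int (d L x)"
  by (auto simp: fold_map_def split: if_splits)

text \<open>A lower neighbour of \<open>x\<close> farther from \<open>L\<close> would have the value
  \<open>k + 1\<close> or \<open>- (k + 1)\<close>, and neither is congruent to \<open>k - 1\<close>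
  modulo 16. So a lower neighbour is closer to \<open>L\<close>, and that one is unique.\<close>

lemma fold_dn_singleton:
  assumes L: "L \<in> V" and C: "c \<in> nb L" "c \<in> C" and B: "b \<in> nb L" "b \<notin> C"
    and k: "1 \<le> k" "k \<le> 7" and x: "x \<in> octagon_map.fib V (fold_map L C) k"
  shows "is_singleton (octagon_map.dn V adj (fold_map L C) x)"
proof -
  interpret F: octagon_map V adj d "fold_map L C" by (rule octagon_map_fold[OF L C B])
  have xV: "x \<in> V" and xk: "fold_map L C x = k"
    using x fold_map_eq_iff[OF L _ k, of x C] by (auto simp: F.fib_def)
  have dx: "int (d L x) = k" using fold_map_pos[OF xk] k by simp
  have "y = closer L x" if y: "y \<in> F.dn x" for y
  proof -
    have yn: "y \<in> nb x" "y \<in> F.fib (k - 1)" using y F.dn_fib[OF x] by auto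
    have yV: "y \<in> V" using yn nbD by blast
    have "d L y = Suc (d L x) \<or> d L x = Suc (d L y)" by (rule nb_step[OF L xV yn(1)])
    moreover have "16 dvd fold_map L C y - (k - 1)" using yn(2) by (simp add: F.fib_def)
    moreover have "d L y \<noteq> Suc (d L x)"
    proof
      assume "d L y = Suc (d L x)"
      then have "fold_map L C y = k + 1 \<or> fold_map L C y = - (k + 1)"
        using fold_map_cases[OF L yV, of C] dx by auto
      then have "16 dvd (2 :: int) \<or> 16 dvd 2 * k"
        using \<open>16 dvd fold_map L C y - (k - 1)\<close> dvd_minus_iff[of 16 "2 * k"] by auto
      then show False using k by presburger
    qed
    ultimately have "d L x = Suc (d L y)" by simp
    then show ?thesis using dx k by (intro closer_eq[symmetric] L xV yn(1)) auto
  qed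
  then show ?thesis using F.dn_nonempty[OF xV] by (auto simp: is_singleton_def)
qed

text \<open>For the fold at \<open>L\<close> seven of the \<open>a i\<close> are 1 and the opposite
  seven are determined by the degrees, so \<open>card_even\<close> yields the closed
  formula.\<close>

lemma card_even_dist:
  assumes fin: "finite V" and L: "L \<in> V"
    and ev: "\<And>x. x \<in> V \<Longrightarrow> even (d L x) \<Longrightarrow> card (nb x) = t + 1"
    and od: "\<And>x. x \<in> V \<Longrightarrow> odd (d L x) \<Longrightarrow> card (nb x) = s + 1"
  shows "card {x \<in> V. even (d L x)} = octagon_size s t"
proof -
  obtain c b where cb: "c \<in> nb L" "b \<in> nb L" "b \<noteq> c" using two_neighbours[OF L]
    by (auto simp: nb_def)
  interpret F: octagon_map V adj d "fold_map L {c}"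
    by (rule octagon_map_fold[OF L cb(1) _ cb(2)]) (use cb in auto)
  interpret F: finite_octagon_map V adj d "fold_map L {c}" by unfold_locales (rule fin)
  have dn: "F.upsize (k + 8) = 1" if k: "1 \<le> k" "k \<le> 7" for k
  proof -
    obtain x where x: "x \<in> F.fib k" using F.fib_nonempty by blast
    have "is_singleton (F.dn x)"
      by (rule fold_dn_singleton[OF L cb(1) _ cb(2) _ k x]) (use cb in auto)
    then show ?thesis using F.card_up_dn(2)[OF x] by (simp add: is_singleton_altdef)
  qed
  have nbk: "F.upsize k + F.upsize (k + 8) = (if even k then t + 1 else s + 1)" if k: "0 \<le> k"
    "k \<le> 7" for k
  proof -
    obtain x where x: "x \<in> F.fib k" using F.fib_nonempty by blast
    have xV: "x \<in> V" using x F.fibD by blast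
    have "16 dvd fold_map L {c} x - k" using F.fibD[OF x] by blast
    then have "even k \<longleftrightarrow> even (fold_map L {c} x)" by presburger
    also have "\<dots> \<longleftrightarrow> even (d L x)" using fold_map_cases[OF L xV, of "{c}"] by auto
    finally have "even k \<longleftrightarrow> even (d L x)" .
    then show ?thesis using F.card_nb[OF x] ev[OF xV] od[OF xV] by auto
  qed
  have a: "F.upsize 9 = 1" "F.upsize 10 = 1" "F.upsize 11 = 1" "F.upsize 12 = 1" "F.upsize 13 = 1"
    "F.upsize 14 = 1" "F.upsize 15 = 1"
    using dn[of 1] dn[of 2] dn[of 3] dn[of 4] dn[of 5] dn[of 6] dn[of 7] by simp_all
  have b: "F.upsize 1 = s" "F.upsize 2 = t" "F.upsize 3 = s" "F.upsize 4 = t" "F.upsize 5 = s"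
    "F.upsize 6 = t" "F.upsize 7 = s" and c: "F.upsize 0 + F.upsize 8 = t + 1"
    using nbk[of 0] nbk[of 1] nbk[of 2] nbk[of 3] nbk[of 4] nbk[of 5] nbk[of 6] nbk[of 7] a
      by simp_all
  have "even (fold_map L {c} x) \<longleftrightarrow> even (d L x)" if "x \<in> V" for x
    using fold_map_cases[OF L that, of "{c}"] by auto
  then have "{x \<in> V. even (d L x)} = {x \<in> V. even (fold_map L {c} x)}" by auto
  then have "card {x \<in> V. even (d L x)} = fibre_sum (\<lambda>n. F.upsize (int n))"
    using F.card_even by simp
  \<comment> \<open>\<open>a 0\<close> and \<open>a 8\<close> enter only through their sum
    \<open>t + 1\<close>: how the neighbours of \<open>L\<close> are divided between the two sides
    is immaterial.\<close>
  also have "\<dots> = 1 + (F.upsize 0 + F.upsize 8) * (s + s * t * s + s * t * s * t * s) + s * t * s * t * s * t * s"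
    by (simp add: fibre_sum_def a b algebra_simps)
  also have "\<dots> = octagon_size s t"
    unfolding c by (simp add: octagon_size_def algebra_simps eval_nat_numeral)
  finally show ?thesis .
qed

text \<open>At distance 8 every neighbour is closer, so closure under projection below 8 keeps
  geodesics inside \<open>A\<close>. Apart from the two neighbours, the other conditions are
  universal and pass to subsets.\<close>

lemma octagon_subset:
  assumes "A \<subseteq> V" and closed: "\<And>x y. x \<in> A \<Longrightarrow> y \<in> A \<Longrightarrow> x \<noteq> y \<Longrightarrow> d x y < 8 \<Longrightarrow> closer x y \<in> A"
    and two: "\<And>x. x \<in> A \<Longrightarrow> \<exists>y\<in>A. \<exists>z\<in>A. adj x y \<and> adj x z \<and> y \<noteq> z"
  shows "octagon A adj d"
proof
  fix x y assume xy: "x \<in> A" "y \<in> A"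
  then have V: "x \<in> V" "y \<in> V" using assms(1) by auto
  show "d x y = d y x" "d x y = 0 \<longleftrightarrow> x = y" "d x y = 1 \<longleftrightarrow> adj x y" "d x y \<le> 8"
    using dist_sym[OF V] dist_0[OF V] dist_1[OF V] dist_le[OF V] by auto
  show "\<exists>z\<in>A. adj y z \<and> d x y = Suc (d x z)" if "x \<noteq> y"
  proof (cases "d x y < 8")
    case True
    then show ?thesis using closer[OF V that] closed[OF xy that] by (auto simp: nb_def)
  next
    case False
    obtain z where z: "z \<in> A" "adj y z" using two[OF xy(2)] by blast
    then have "z \<in> V" using assms(1) by auto
    then have "d x y = Suc (d x z)"
      using False dist_step[OF V \<open>z \<in> V\<close> z(2)] dist_le[OF V(1) \<open>z \<in> V\<close>] by auto
    then show ?thesis using z by auto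
  qed
next
  show "\<lbrakk>x \<in> A; y \<in> A; z \<in> A; adj y z\<rbrakk> \<Longrightarrow> d x z = Suc (d x y) \<or> d x y = Suc (d x z)" for x y z
    using dist_step assms(1) by blast
  show "\<lbrakk>x \<in> A; y \<in> A; z \<in> A; z' \<in> A; d x y < 8; adj y z; adj y z';
          d x y = Suc (d x z); d x y = Suc (d x z')\<rbrakk> \<Longrightarrow> z = z'" for x y z z'
    using closer_unique assms(1) by blast
  show "x \<in> A \<Longrightarrow> \<exists>y\<in>A. \<exists>z\<in>A. adj x y \<and> adj x z \<and> y \<noteq> z" for x by (rule two)
qed

end

section \<open>The equality case, and the passage to locally finite octagons\<close>

lemma (in octagon_map) even_dist:
  assumes "x \<in> V" "y \<in> V" shows "even (d x y) \<longleftrightarrow> even (\<psi> y - \<psi> x)"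
proof -
  obtain e where "16 dvd \<psi> y - \<psi> x - e" "even (e - int (d x y))"
    using winding[OF assms] by blast
  moreover from this(1) have "2 dvd \<psi> y - \<psi> x - e" by (rule dvd_trans[rotated]) simp
  ultimately show ?thesis by auto
qed

theorem (in finite_octagon_map) thick_pattern:
  assumes thick: "\<And>x. x \<in> V \<Longrightarrow> 3 \<le> card (nb x)"
  shows "\<exists>i. \<forall>k x. 1 \<le> k \<longrightarrow> k \<le> 7 \<longrightarrow> x \<in> fib (i + k) \<longrightarrow> card (dn x) = 1"
proof -
  obtain L where L: "L \<in> fib 0" using fib_nonempty by blast
  have LV: "L \<in> V" "16 dvd \<psi> L" using fibD[OF L] by auto
  obtain M where M: "M \<in> nb L" using two_neighbours[OF LV(1)] by (auto simp: nb_def)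
  have MV: "M \<in> V" using M nbD by blast
  define t s where "t = card (nb L) - 1" and "s = card (nb M) - 1"
  have ts: "t + 1 = card (nb L)" "s + 1 = card (nb M)" "t \<ge> 2" "s \<ge> 2"
    using thick[OF LV(1)] thick[OF MV] by (auto simp: t_def s_def)
  have three: "\<exists>w\<in>nb x. w \<noteq> y \<and> w \<noteq> z" if "x \<in> V" for x y z
  proof (rule ccontr)
    assume "\<not> (\<exists>w\<in>nb x. w \<noteq> y \<and> w \<noteq> z)"
    then have "nb x \<subseteq> {y, z}" by blast
    then have "card (nb x) \<le> card {y, z}" by (intro card_mono) auto
    then show False using thick[OF that] card_insert_le_m1[of 2 "{z}" y]
      by (simp add: card_insert_if split: if_splits)
  qed
  have ev: "card (nb x) = t + 1" if "x \<in> V" "even (d L x)" for x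
    using thick_bij[OF three LV(1) that] ts(1) bij_betw_same_card by metis
  have od: "card (nb x) = s + 1" if "x \<in> V" "odd (d L x)" for x
  proof -
    have "even (d M x)" using nb_step[OF that(1) LV(1) M] that dist_sym[OF that(1) LV(1)] dist_sym[OF that(1) MV]
      by (metis even_Suc)
    then show ?thesis using thick_bij[OF three MV that(1)] ts(2) bij_betw_same_card by metis
  qed
  have "even (d L x) \<longleftrightarrow> even (\<psi> x)" if "x \<in> V" for x
    using even_dist[OF LV(1) that] LV(2) by presburger
  then have "{x \<in> V. even (d L x)} = {x \<in> V. even (\<psi> x)}" by auto
  \<comment> \<open>The same set is counted by the given map and by the fold at \<open>L\<close>.
    This rules out the strict alternative in \<open>fibre_sum_le\<close>.\<close>
  then have F: "fibre_sum (\<lambda>n. upsize (int n)) = octagon_size s t"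
    using card_even card_even_dist[OF finite_V LV(1) ev od] by simp
  have "fibre_sum (\<lambda>n. upsize (int n)) < octagon_size s t \<or>
    fibre_sum (\<lambda>n. upsize (int n)) = octagon_size s t \<and> half_pattern (\<lambda>n. upsize (int n))"
  proof (rule fibre_sum_le[OF ts(4,3) upsize_pos])
    fix k :: nat
    obtain x where x: "x \<in> fib (int k)" using fib_nonempty by blast
    have xV: "x \<in> V" using x fibD by blast
    have "16 dvd \<psi> x - int k" using x fibD by blast
    then have "even (int k) \<longleftrightarrow> even (\<psi> x - \<psi> L)" using LV(2) by presburger
    then have "even k \<longleftrightarrow> even (d L x)" using even_dist[OF LV(1) xV] by simp
    then show "upsize (int k) + upsize (int (k + 8)) = (if even k then t else s) + 1"
      using card_nb[OF x] ev[OF xV] od[OF xV] by auto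
  qed
  then obtain j where j: "j < 16" "\<And>k. k \<in> {1..7} \<Longrightarrow> upsize (int ((j + k) mod 16)) = 1"
    using F by (auto simp: half_pattern_def)
  show ?thesis
  \<comment> \<open>The shift by 8 turns the ones \<open>a (j + k)\<close> into down-degrees over
    \<open>j - 8 + k\<close>.\<close>
  proof (intro exI[of _ "int j - 8"] allI impI)
    fix k :: int and x assume k: "1 \<le> k" "k \<le> 7" and x: "x \<in> fib (int j - 8 + k)"
    obtain n where n: "k = int n" using k(1) by (metis nonneg_int_cases order_trans zero_le_one)
    have "16 dvd (int j - 8 + int n + 8) - int ((j + n) mod 16)" by presburger
    then have "upsize (int j - 8 + k + 8) = upsize (int ((j + n) mod 16))" unfolding n
      by (rule upsize_cong)
    then show "card (dn x) = 1" using card_up_dn(2)[OF x] j(2)[of n] k n by auto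
  qed
qed


lemma is_singleton_bij: "bij_betw f A B \<Longrightarrow> is_singleton A \<longleftrightarrow> is_singleton B"
  by (simp add: is_singleton_altdef bij_betw_same_card)

lemma not_singleton_two:
  assumes "A \<noteq> {}" "\<not> is_singleton A"
  obtains x y where "x \<in> A" "y \<in> A" "x \<noteq> y"
  using assms that is_singletonI'[of A] by blast

text \<open>Local finite generation for graphs: \<open>A\<close> stands for the elements of a
  generated subgeometry. It is always closed under projections, and two neighbours for each member
  are what turns it into a suboctagon, to which the finiteness hypothesis applies.\<close>

definition (in octagon) locally_finite :: bool where
  "locally_finite \<longleftrightarrow> (\<forall>T. finite T \<and> T \<subseteq> V \<longrightarrow>
     (\<exists>A. T \<subseteq> A \<and> A \<subseteq> V \<and> (\<forall>x\<in>A. \<forall>y\<in>A. x \<noteq> y \<and> d x y < 8 \<longrightarrow> closer x y \<in> A) \<and>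
       ((\<forall>x\<in>A. \<exists>y\<in>A. \<exists>z\<in>A. adj x y \<and> adj x z \<and> y \<noteq> z) \<longrightarrow> finite A)))"

theorem (in octagon_map) singleton_fibre:
  assumes thick: "\<And>x. x \<in> V \<Longrightarrow> at_least_three (nb x)"
    and lf: locally_finite
  shows "\<exists>i. is_singleton (fib i)"
proof -
  have dn_eq: "is_singleton (dn x) \<longleftrightarrow> is_singleton (dn y)" if "x \<in> fib i" "y \<in> fib i" for x y i
  proof -
    obtain z where z: "z \<in> fib (i + 8)" using fib_nonempty by blast
    show ?thesis
      using is_singleton_bij[OF opposite_up_dn(2)[OF that(1) z]] is_singleton_bij[OF opposite_up_dn(2)[OF that(2) z]]
      by simp
  qed
  \<comment> \<open>\<open>W\<close> keeps three neighbours for thickness and, where possible, two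
    distinct lower neighbours, so that a down-degree 1 observed in a subset containing
    \<open>W\<close> is genuine.\<close>
  have "\<exists>W. finite W \<and> W \<subseteq> nb x \<and> 3 \<le> card W \<and> (\<not> is_singleton (dn x) \<longrightarrow> (\<exists>y\<in>W. \<exists>z\<in>W. y \<in> dn x \<and>
    z \<in> dn x \<and> y \<noteq> z))"
    if x: "x \<in> V" for x
  proof -
    obtain W where W: "W \<subseteq> nb x" "card W = 3" using thick[OF x] by (auto simp: at_least_three_def)
    then have fW: "finite W" by (metis card.infinite zero_neq_numeral)
    show ?thesis
    proof (cases "is_singleton (dn x)")
      case True
      then show ?thesis using W fW by auto
    next
      case False
      obtain y z where yz: "y \<in> dn x" "z \<in> dn x" "y \<noteq> z"
        by (rule not_singleton_two[OF dn_nonempty[OF x] False])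
      have "card W \<le> card (insert y (insert z W))" using fW by (intro card_mono) auto
      then show ?thesis using W fW yz dn_subset[of x]
        by (intro exI[of _ "insert y (insert z W)"]) auto
    qed
  qed
  then obtain W where W: "\<And>x. x \<in> V \<Longrightarrow> finite (W x)" "\<And>x. x \<in> V \<Longrightarrow> W x \<subseteq> nb x"
    "\<And>x. x \<in> V \<Longrightarrow> 3 \<le> card (W x)"
    "\<And>x. x \<in> V \<Longrightarrow> \<not> is_singleton (dn x) \<Longrightarrow> \<exists>y\<in>W x. \<exists>z\<in>W x. y \<in> dn x \<and> z \<in> dn x \<and> y \<noteq> z"
    by metis
  obtain v where v: "\<And>i. v i \<in> fib i" using fib_nonempty by metis
  have vV: "v i \<in> V" for i using v fibD by blast
  \<comment> \<open>One representative per residue suffices: by \<open>dn_eq\<close> the fibre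
    decides whether \<open>dn\<close> is a singleton.\<close>
  define T where "T = (\<Union>i\<in>{0..15}. insert (v i) (W (v i)))"
  have T: "finite T" "T \<subseteq> V" using W(1,2)[OF vV] vV by (auto simp: T_def nb_def)
  from lf[unfolded locally_finite_def, THEN spec, THEN mp, OF conjI, OF T]
  obtain A where A: "T \<subseteq> A" "A \<subseteq> V" "\<forall>x\<in>A. \<forall>y\<in>A. x \<noteq> y \<and> d x y < 8 \<longrightarrow> closer x y \<in> A"
    "(\<forall>x\<in>A. \<exists>y\<in>A. \<exists>z\<in>A. adj x y \<and> adj x z \<and> y \<noteq> z) \<longrightarrow> finite A"
    by (elim exE conjE)
  have closed: "closer x y \<in> A" if "x \<in> A" "y \<in> A" "x \<noteq> y" "d x y < 8" for x y using A(3) that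
    by blast
  have rep: "\<exists>u\<in>fib i. u \<in> A \<and> W u \<subseteq> A" for i
  proof (intro bexI conjI)
    have "16 dvd i mod 16 - i" by presburger
    then show "v (i mod 16) \<in> fib i" using v[of "i mod 16"] fib_cong by blast
    have "i mod 16 \<in> {0..15}" using pos_mod_bound[of 16 i] pos_mod_sign[of 16 i] by auto
    then show "v (i mod 16) \<in> A" "W (v (i mod 16)) \<subseteq> A" using A(1) unfolding T_def by blast+
  qed
  \<comment> \<open>Thickness spreads from the representatives. Each \<open>x\<close> is opposite
    one of them, whose three kept neighbours project injectively to neighbours of \<open>x\<close>,
    and these lie in \<open>A\<close> by closure.\<close>
  have three: "\<exists>(f :: 'a \<Rightarrow> 'a) W. inj_on f W \<and> finite W \<and> 3 \<le> card W \<and> f ` W \<subseteq> nb x \<inter> A" if x: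
    "x \<in> A" for x
  proof -
    have xV: "x \<in> V" using x A(2) by blast
    have xf: "x \<in> fib (\<psi> x)" using xV by (simp add: fib_def)
    obtain u where u: "u \<in> fib (\<psi> x - 8)" "u \<in> A" "W u \<subseteq> A" using rep by blast
    have uV: "u \<in> V" using u(2) A(2) by blast
    have ux: "d u x = 8" by (rule dist_8[OF u(1)]) (use xf in simp)
    note b = opposite_bij[OF uV xV ux]
    have "closer z x \<in> nb x \<inter> A" if "z \<in> W u" for z
    proof -
      have z: "z \<in> nb u" "z \<in> A" "z \<in> V" using that W(2)[OF uV] u(3) A(2) by auto
      have c: "closer z x \<in> nb x" "d z (closer z x) = 6" using b(2)[OF z(1)] by auto
      have cV: "closer z x \<in> V" using c(1) nbD by blast
      have "d z x < 8" using nb_step[OF z(3) cV nb_sym[OF xV c(1)]] c(2) by auto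
      moreover have "z \<noteq> x" using dist_nb[OF uV z(1)] ux by auto
      ultimately show ?thesis using closed[OF z(2) x] c(1) by auto
    qed
    moreover have "inj_on (\<lambda>z. closer z x) (W u)"
      using b(1) W(2)[OF uV] by (auto simp: bij_betw_def intro: inj_on_subset)
    ultimately show ?thesis
      using W(1,3)[OF uV] by (intro exI[of _ "\<lambda>z. closer z x"] exI[of _ "W u"]) auto
  qed
  have "\<exists>y\<in>A. \<exists>z\<in>A. adj x y \<and> adj x z \<and> y \<noteq> z" if "x \<in> A" for x
  proof -
    obtain f :: "'a \<Rightarrow> 'a" and U where f: "inj_on f U" "finite U" "3 \<le> card U" "f ` U \<subseteq> nb x \<inter> A"
      using three[OF \<open>x \<in> A\<close>] by blast
    have "U \<noteq> {}" "\<not> is_singleton U" using f(3) by (auto simp: is_singleton_altdef)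
    then obtain y z where "y \<in> U" "z \<in> U" "y \<noteq> z" by (rule not_singleton_two)
    then have "f y \<noteq> f z" "f y \<in> nb x \<inter> A" "f z \<in> nb x \<inter> A" using f inj_onD by fastforce+
    then show ?thesis by (auto simp: nb_def)
  qed
  note two = this
  \<comment> \<open>The two neighbours are the condition under which \<open>A\<close> is known to be
    finite; from here on counting is available.\<close>
  have finA: "finite A" using A(4) two by blast
  interpret A: octagon A adj d by (rule octagon_subset[OF A(2) closed two])
  interpret A: finite_octagon_map A adj d \<psi>
  proof
    show "16 dvd \<psi> y - \<psi> x - 1 \<or> 16 dvd \<psi> y - \<psi> x + 1" if "x \<in> A" "y \<in> A" "adj x y" for x y
      using hom that A(2) by blast
    show "\<exists>x\<in>A. 16 dvd \<psi> x - i" for i using rep[of i] by (auto simp: fib_def)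
  qed (rule finA)
  have Afib: "A.fib i = fib i \<inter> A" for i using A(2) by (auto simp: A.fib_def fib_def)
  have Anb: "A.nb x = nb x \<inter> A" for x using A(2) by (auto simp: A.nb_def nb_def)
  have Adn: "A.dn x = dn x \<inter> A" for x by (auto simp: A.dn_def dn_def Anb)
  have "3 \<le> card (A.nb x)" if x: "x \<in> A" for x
  proof -
    obtain f :: "'a \<Rightarrow> 'a" and U where f: "inj_on f U" "finite U" "3 \<le> card U" "f ` U \<subseteq> nb x \<inter> A"
      using three[OF x] by blast
    have "card U = card (f ` U)" using card_image[OF f(1)] by simp
    also have "\<dots> \<le> card (A.nb x)" using f(4) finA by (intro card_mono) (auto simp: Anb)
    finally show ?thesis using f(3) by simp
  qed
  then obtain i where i: "1 \<le> k \<Longrightarrow> k \<le> 7 \<Longrightarrow> x \<in> A.fib (i + k) \<Longrightarrow> card (A.dn x) = 1" for k x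
    using A.thick_pattern by blast
  have "is_singleton (fib i)"
  proof (rule fib_singleton, rule ccontr)
    fix k x assume k: "1 \<le> k" "k \<le> 7" and x: "x \<in> fib (i + k)" and ns: "\<not> is_singleton (dn x)"
    obtain u where u: "u \<in> fib (i + k)" "u \<in> A" "W u \<subseteq> A" using rep by blast
    have uV: "u \<in> V" using u(2) A(2) by blast
    \<comment> \<open>Two lower neighbours anywhere in the fibre imply two at its representative,
      and the choice of \<open>W\<close> puts them into \<open>A\<close>.\<close>
    have "\<not> is_singleton (dn u)" using dn_eq[OF x u(1)] ns by simp
    then obtain y z where yz: "y \<in> W u" "z \<in> W u" "y \<in> dn u" "z \<in> dn u" "y \<noteq> z" using W(4)[OF uV]
      by blast
    have "card (A.dn u) = 1" using i[OF k] u by (simp add: Afib)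
    then obtain w where "dn u \<inter> A = {w}" unfolding Adn by (rule card_1_singletonE)
    moreover have "y \<in> dn u \<inter> A" "z \<in> dn u \<inter> A" using yz u(3) by auto
    ultimately show False using yz(5) by simp
  qed
  then show ?thesis by blast
qed

section \<open>Epimorphisms onto thin octagons\<close>

context octagon
begin

text \<open>Elements at equal distance from \<open>b\<close> behind the same \<open>z\<close> have
  the same value under a fold at \<open>b\<close>, so this measures how far a fold is from
  injective. The two remain distinct when prolonged, since projecting from \<open>b\<close> recovers
  their predecessors.\<close>

lemma two_at_distance:
  assumes b: "b \<in> V" and z: "z \<in> nb b" and u: "u1 \<in> nb z" "u2 \<in> nb z" "u1 \<noteq> u2" "u1 \<noteq> b" "u2 \<noteq> b"
    and k: "2 \<le> k" "k \<le> 7"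
  shows "\<exists>w1 w2. w1 \<in> V \<and> w2 \<in> V \<and> w1 \<noteq> w2 \<and> d b w1 = k \<and> Suc (d z w1) = k \<and> d b w2 = k \<and>
    Suc (d z w2) = k"
  using k
proof (induction k rule: dec_induct)
  case base
  have zV: "z \<in> V" using z nbD by blast
  have bz: "d b z = 1" "b \<in> nb z" using dist_nb[OF b z] nb_sym[OF b z] by auto
  have "d b b = 0" using dist_0[OF b b] by simp
  then have "closer b z = b" using bz by (intro closer_eq[OF b zV]) auto
  then have "d b u = 2 \<and> u \<in> V \<and> d z u = 1" if "u \<in> nb z" "u \<noteq> b" for u
    using farther[OF b zV that(1)] that bz(1) dist_nb[OF zV] nbD by auto
  then show ?case using u by (intro exI[of _ u1] exI[of _ u2]) auto
next
  case (step k)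
  then obtain w1 w2 where w: "w1 \<in> V" "w2 \<in> V" "w1 \<noteq> w2" "d b w1 = k" "Suc (d z w1) = k"
    "d b w2 = k" "Suc (d z w2) = k"
    by auto
  obtain y1 where y1: "y1 \<in> nb w1" "y1 \<noteq> closer b w1" using other_neighbour[OF w(1)] by blast
  obtain y2 where y2: "y2 \<in> nb w2" "y2 \<noteq> closer b w2" using other_neighbour[OF w(2)] by blast
  have k8: "k < 8" using step by simp
  note e1 = extend_Suc[OF b z w(1,4,5) k8 y1] and e2 = extend_Suc[OF b z w(2,6,7) k8 y2]
  have "closer b y1 = w1" "closer b y2 = w2"
    by (rule closer_eq[OF b _ nb_sym[OF w(1) y1(1)]] closer_eq[OF b _ nb_sym[OF w(2) y2(1)]]; use e1 e2 w step in simp)+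
  then show ?case using e1 e2 w by (intro exI[of _ y1] exI[of _ y2]) auto
qed

end

locale octagon_epi =
  G: octagon V adj d + D: octagon V' adj' d'
  for V :: "'a set" and adj d and V' :: "'b set" and adj' d' +
  fixes h :: "'a \<Rightarrow> 'b"
  assumes h_onto: "h ` V = V'"
    and h_adj: "\<lbrakk>x \<in> V; y \<in> V; adj x y\<rbrakk> \<Longrightarrow> adj' (h x) (h y)"
begin

lemma hV: "x \<in> V \<Longrightarrow> h x \<in> V'"
  using h_onto by blast

lemma octagon_map_comp:
  assumes "octagon_map V' adj' d' \<psi>"
  shows "octagon_map V adj d (\<psi> \<circ> h)"
proof -
  interpret F: octagon_map V' adj' d' \<psi> by (rule assms)
  show ?thesis
  proof
    show "16 dvd (\<psi> \<circ> h) y - (\<psi> \<circ> h) x - 1 \<or> 16 dvd (\<psi> \<circ> h) y - (\<psi> \<circ> h) x + 1"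
      if "x \<in> V" "y \<in> V" "adj x y" for x y
      using F.hom[OF hV hV h_adj] that by simp
    show "\<exists>x\<in>V. 16 dvd (\<psi> \<circ> h) x - i" for i
    proof -
      obtain y where "y \<in> V'" "16 dvd \<psi> y - i" using F.onto by blast
      moreover then obtain x where "x \<in> V" "y = h x" using h_onto by blast
      ultimately show ?thesis by auto
    qed
  qed
qed

text \<open>For the fold at \<open>b\<close> with \<open>m\<close> alone on the positive side, the
  fibres of the composite over 0 and 1 are exactly the preimages of \<open>b\<close> and
  \<open>m\<close>. The lifts then come from \<open>dn_nonempty\<close> and
  \<open>up_nonempty\<close>.\<close>

lemma lift_neighbour:
  assumes b: "b \<in> V'" and m: "m \<in> D.nb b" and x: "x \<in> V"
  shows "h x = m \<Longrightarrow> \<exists>y\<in>G.nb x. h y = b" and "h x = b \<Longrightarrow> \<exists>y\<in>G.nb x. h y = m"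
proof -
  obtain m' where m': "m' \<in> D.nb b" "m' \<noteq> m" using D.other_neighbour[OF b] by blast
  let ?\<psi> = "D.fold_map b {m}"
  have mp: "octagon_map V' adj' d' ?\<psi>" by (rule D.octagon_map_fold[OF b m _ m'(1)]) (use m' in auto)
  interpret H: octagon_map V adj d "?\<psi> \<circ> h" by (rule octagon_map_comp[OF mp])
  have mV: "m \<in> V'" using m D.nbD by blast
  have db: "d' b b = 0" "d' b m = 1" using D.dist_0[OF b b] D.dist_nb[OF b m] by auto
  have mb: "D.closer m b = m"
    using D.dist_sym[OF b mV] db D.dist_0[OF mV mV] by (intro D.closer_eq[OF mV b m]) auto
  have f0: "y \<in> H.fib 0 \<longleftrightarrow> y \<in> V \<and> h y = b" for y
    using D.fold_map_0_iff[OF b hV, of y "{m}"] by (auto simp: H.fib_def)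
  have f1: "y \<in> H.fib 1 \<longleftrightarrow> y \<in> V \<and> h y = m" for y
  proof -
    have "?\<psi> v = 1 \<longleftrightarrow> v = m" if v: "v \<in> V'" for v
    proof
      assume a: "?\<psi> v = 1"
      then have 1: "d' b v = 1" using D.fold_map_pos[OF a] by simp
      then have "D.closer v b = m" using a by (auto simp: D.fold_map_def split: if_splits)
      moreover have "D.closer v b = v"
        using 1 D.dist_1[OF b v] D.dist_sym[OF b v] D.dist_0[OF v v] v
        by (intro D.closer_eq[OF v b]) (auto simp: D.nb_def)
      ultimately show "v = m" by simp
    qed (use mb db in \<open>auto simp: D.fold_map_def\<close>)
    then show ?thesis using D.fold_map_eq_iff[OF b hV, of y 1 "{m}"] hV by (auto simp: H.fib_def)
  qed
  show "\<exists>y\<in>G.nb x. h y = b" if "h x = m"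
  proof -
    have "x \<in> H.fib 1" using that x f1 by simp
    from H.dn_fib[OF this] H.dn_nonempty[OF x] show ?thesis using f0 by auto
  qed
  show "\<exists>y\<in>G.nb x. h y = m" if "h x = b"
  proof -
    have "x \<in> H.fib 0" using that x f0 by simp
    from H.up_fib[OF this] H.up_nonempty[OF x] show ?thesis using f1 by auto
  qed
qed

text \<open>The map folding \<open>V'\<close> at a point \<open>b\<close> is injective only near \<open>b\<close>,
  which locates the singleton fibre.\<close>

lemma singleton_fibre_near:
  assumes sing: "\<And>\<psi>. octagon_map V adj d \<psi> \<Longrightarrow> \<exists>i. is_singleton (octagon_map.fib V \<psi> i)"
    and b: "b \<in> V'"
    and thick: "\<And>x. x \<in> V' \<Longrightarrow> odd (d' b x) \<Longrightarrow> at_least_three (D.nb x)"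
  shows "\<exists>e\<in>insert b (D.nb b). is_singleton {x \<in> V. h x = e}"
proof -
  have three: "\<exists>u1\<in>D.nb x. \<exists>u2\<in>D.nb x. u1 \<noteq> u2 \<and> u1 \<noteq> y \<and> u2 \<noteq> y" if x: "x \<in> V'" "odd (d' b x)"
    for x y
  proof -
    obtain W where W: "W \<subseteq> D.nb x" "card W = 3" using thick[OF x] by (auto simp: at_least_three_def)
    then have "finite W" by (metis card.infinite zero_neq_numeral)
    then have "card (W - {y}) \<ge> 2" using W(2) by (simp add: card_Diff_singleton_if)
    then have "W - {y} \<noteq> {}" "\<not> is_singleton (W - {y})"
      by (metis card.empty not_numeral_le_zero) (use \<open>card (W - {y}) \<ge> 2\<close> in \<open>simp add: is_singleton_altdef\<close>)
    then obtain u1 u2 where "u1 \<in> W - {y}" "u2 \<in> W - {y}" "u1 \<noteq> u2" by (rule not_singleton_two)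
    then show ?thesis using W(1) by blast
  qed
  obtain m where m: "m \<in> D.nb b" using D.other_neighbour[OF b] by blast
  obtain m' where m': "m' \<in> D.nb b" "m' \<noteq> m" using D.other_neighbour[OF b] by blast
  let ?\<psi> = "D.fold_map b {m}"
  interpret F: octagon_map V' adj' d' ?\<psi>
    by (rule D.octagon_map_fold[OF b m _ m'(1)]) (use m' in auto)
  have H: "octagon_map V adj d (?\<psi> \<circ> h)" by (rule octagon_map_comp) unfold_locales
  interpret H: octagon_map V adj d "?\<psi> \<circ> h" by (rule H)
  obtain i x where x: "H.fib i = {x}" using sing[OF H] by (auto simp: is_singleton_def)
  define e where "e = h x"
  have xV: "x \<in> V" "16 dvd ?\<psi> e - i" using x by (auto simp: H.fib_def e_def)
  have eV: "e \<in> V'" using xV(1) hV by (simp add: e_def)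
  \<comment> \<open>A singleton fibre of the composite meets the preimage of only one element, so
    the fold takes its value at \<open>e\<close> nowhere else.\<close>
  have uniq: "w = e" if w: "w \<in> V'" "?\<psi> w = ?\<psi> e" for w
  proof -
    obtain y where y: "y \<in> V" "w = h y" using w(1) h_onto by blast
    then have "y \<in> H.fib i" using w(2) xV(2) by (simp add: H.fib_def)
    then show ?thesis using x y by (simp add: e_def)
  qed
  have "{y \<in> V. h y = e} = {x}"
  proof -
    have "y \<in> H.fib i" if "y \<in> V" "h y = e" for y using that xV(2) by (simp add: H.fib_def)
    then show ?thesis using x xV(1) by (auto simp: e_def)
  qed
  then have sgl: "is_singleton {y \<in> V. h y = e}" by (simp add: is_singleton_def)
  have "d' b e < 2"
  proof (rule ccontr)
    assume "\<not> d' b e < 2"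
    then have ge: "2 \<le> d' b e" by simp
    have be: "e \<noteq> b" using ge D.dist_0[OF b b] by auto
    show False
    proof (cases "d' b e = 8")
      case True
      \<comment> \<open>All opposites of \<open>b\<close> fold to 8, and an element at distance 7,
        thick by parity, has two of them as neighbours.\<close>
      obtain w where w: "w \<in> V'" "d' b w = 7" using D.extend[OF b m, of 7] by auto
      have odd: "odd (d' b w)" using w(2) by simp
      obtain u1 u2 where u: "u1 \<in> D.nb w" "u2 \<in> D.nb w" "u1 \<noteq> u2" "u1 \<noteq> D.closer b w"
        "u2 \<noteq> D.closer b w"
        using three[OF w(1) odd] by blast
      have "d' b u1 = 8" "d' b u2 = 8" using D.farther[OF b w(1)] u w(2) by auto
      then have "?\<psi> u1 = ?\<psi> e" "?\<psi> u2 = ?\<psi> e" using True by (auto simp: D.fold_map_def)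
      then show False using uniq u D.nbD by metis
    next
      case False
      then have le: "d' b e \<le> 7" using D.dist_le[OF b eV] by simp
      \<comment> \<open>The first step \<open>z\<close> towards \<open>e\<close> is thick as well;
        branching there produces two elements at distance \<open>d' b e\<close> with the same
        sign.\<close>
      define z where "z = D.closer e b"
      have z: "z \<in> D.nb b" using D.closer[OF eV b be] by (simp add: z_def)
      have zV: "z \<in> V'" using z D.nbD by blast
      have "odd (d' b z)" using D.dist_nb[OF b z] by simp
      then obtain u1 u2 where u: "u1 \<in> D.nb z" "u2 \<in> D.nb z" "u1 \<noteq> u2" "u1 \<noteq> b" "u2 \<noteq> b"
        using three[OF zV] by blast
      obtain w1 w2 where w: "w1 \<in> V'" "w2 \<in> V'" "w1 \<noteq> w2" "d' b w1 = d' b e"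
        "Suc (d' z w1) = d' b e"
         "d' b w2 = d' b e" "Suc (d' z w2) = d' b e"
        using D.two_at_distance[OF b z u ge le] by blast
      have "?\<psi> w = ?\<psi> e" if v: "w \<in> V'" "d' b w = d' b e" "Suc (d' z w) = d' b e" for w
      proof -
        have "D.closer w b = z"
          by (rule D.closer_eq[OF v(1) b z])
            (use v le D.dist_sym[OF b v(1)] D.dist_sym[OF zV v(1)] in arith)+
        then show ?thesis using v(2) by (simp add: D.fold_map_def z_def)
      qed
      then show False using uniq w by metis
    qed
  qed
  then have "e = b \<or> e \<in> D.nb b"
    using D.dist_0[OF b eV] D.dist_1[OF b eV] eV by (cases "d' b e") (auto simp: D.nb_def)
  then show ?thesis using sgl by blast
qed


text \<open>The singleton fibre near \<open>b\<close> ties \<open>M1\<close> and \<open>M2\<close>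
  together. It does not lie over \<open>m\<close>, since \<open>M1\<close> and \<open>M2\<close>
  differ. Over \<open>b\<close> it is a common neighbour; over another neighbour of \<open>b\<close>
  it is the middle of a path of length 4. Either way the projection of \<open>M1\<close> onto
  \<open>M2\<close> lies over \<open>b\<close>.\<close>

lemma line_fibre_closer:
  assumes m: "m \<in> V'" and b: "b \<in> D.nb m" and two:
    "\<And>x y z. \<lbrakk>x \<in> D.nb b; y \<in> D.nb b; z \<in> D.nb b\<rbrakk> \<Longrightarrow> x = y \<or> x = z \<or> y = z"
    and e: "e \<in> insert b (D.nb b)" "is_singleton {x \<in> V. h x = e}"
    and M: "M1 \<in> V" "M2 \<in> V" "h M1 = m" "h M2 = m" "M1 \<noteq> M2"
  shows "\<exists>u\<in>G.nb M2. h u = b \<and> d M1 M2 < 8 \<and> d M1 M2 = Suc (d M1 u)"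
proof -
  have bV: "b \<in> V'" using b D.nbD by blast
  have mb: "m \<in> D.nb b" by (rule D.nb_sym[OF m b])
  have one: "x = y" if "x \<in> V" "y \<in> V" "h x = e" "h y = e" for x y
  proof -
    obtain w where "{x \<in> V. h x = e} = {w}" using e(2) by (rule is_singletonE)
    moreover have "x \<in> {x \<in> V. h x = e}" "y \<in> {x \<in> V. h x = e}" using that by auto
    ultimately show ?thesis by simp
  qed
  obtain x1 where x1: "x1 \<in> G.nb M1" "h x1 = b" using lift_neighbour(1)[OF bV mb M(1,3)] by blast
  obtain x2 where x2: "x2 \<in> G.nb M2" "h x2 = b" using lift_neighbour(1)[OF bV mb M(2,4)] by blast
  have xV: "x1 \<in> V" "x2 \<in> V" using x1 x2 G.nbD by blast+
  have d1: "d M1 x1 = 1" using G.dist_nb[OF M(1) x1(1)] .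
  have d0: "d M1 v = 0 \<longleftrightarrow> M1 = v" if "v \<in> V" for v using G.dist_0[OF M(1) that] .
  have M2x2: "M2 \<in> G.nb x2" using G.nb_sym[OF M(2) x2(1)] .
  show ?thesis
  proof (cases "x1 = x2")
    case True
    have "d M1 M2 = 2"
      using G.nb_step[OF M(1) xV(2) M2x2] d1 d0[OF M(2)] M(5) True by auto
    then show ?thesis using d1 True x2 by (intro bexI[of _ x2]) auto
  next
    case False
    have "e \<noteq> b" using one[OF xV] x1 x2 False by auto
    moreover have em: "e \<noteq> m" using one[OF M(1,2)] M by auto
    ultimately have eb: "e \<in> D.nb b" using e(1) by auto
    obtain N where N: "N \<in> G.nb x1" "h N = e" using lift_neighbour(2)[OF bV eb xV(1) x1(2)] by blast
    obtain N' where N': "N' \<in> G.nb x2" "h N' = e" using lift_neighbour(2)[OF bV eb xV(2) x2(2)]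
      by blast
    have NV: "N \<in> V" "N' \<in> V" using N N' G.nbD by blast+
    have "N' = N" using one[OF NV] N N' by simp
    then have x2N: "x2 \<in> G.nb N" using G.nb_sym[OF xV(2) N'(1)] by simp
    have "M1 \<noteq> N" "M2 \<noteq> N" using N(2) M em by auto
    then have dN: "d M1 N = 2" using G.nb_step[OF M(1) xV(1) N(1)] d1 d0[OF NV(1)] by auto
    have "G.closer M1 N = x1"
      by (rule G.closer_eq[OF M(1) NV(1) G.nb_sym[OF xV(1) N(1)]]) (use dN d1 in auto)
    then have dx2: "d M1 x2 = 3" using G.farther[OF M(1) NV(1) x2N] dN False by auto
    have "G.closer M1 x2 = N"
      by (rule G.closer_eq[OF M(1) xV(2) G.nb_sym[OF NV(1) x2N]]) (use dN dx2 in auto)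
    then have "d M1 M2 = 4" using G.farther[OF M(1) xV(2) M2x2] dx2 \<open>M2 \<noteq> N\<close> by auto
    then show ?thesis using dx2 x2 by (intro bexI[of _ x2]) auto
  qed
qed

text \<open>If \<open>M1\<close> and \<open>M2\<close> were distinct over the same \<open>m\<close>
  outside \<open>P\<close>, the unique projection of \<open>M1\<close> onto \<open>M2\<close> would
  lie over each neighbour of \<open>m\<close>, and there are at least two. Hence fibres outside
  \<open>P\<close> have at most one element.\<close>

lemma no_epi_onto_double:
  assumes sing: "\<And>\<psi>. octagon_map V adj d \<psi> \<Longrightarrow> \<exists>i. is_singleton (octagon_map.fib V \<psi> i)"
    and thick: "\<And>x. x \<in> V \<Longrightarrow> at_least_three (G.nb x)"
    and P: "P \<subseteq> V'" "b0 \<in> P"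
    and two: "\<And>b x y z. \<lbrakk>b \<in> P; x \<in> D.nb b; y \<in> D.nb b; z \<in> D.nb b\<rbrakk> \<Longrightarrow> x = y \<or> x = z \<or> y = z"
    and thick': "\<And>x. x \<in> V' - P \<Longrightarrow> at_least_three (D.nb x)"
    and alt: "\<And>x y. x \<in> V' \<Longrightarrow> y \<in> D.nb x \<Longrightarrow> y \<in> P \<longleftrightarrow> x \<notin> P"
  shows False
proof -
  have par: "even (d' b x) \<longleftrightarrow> x \<in> P" if "b \<in> P" "x \<in> V'" for b x
    using that(2)
  proof (induction "d' b x" arbitrary: x)
    case 0
    then show ?case using D.dist_0[of b x] that(1) P(1) by auto
  next
    case (Suc n)
    have bV: "b \<in> V'" using that(1) P(1) by blast
    have "b \<noteq> x" using Suc.hyps(2) D.dist_0[OF bV Suc.prems] by auto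
    note c = D.closer[OF bV Suc.prems this]
    have cV: "D.closer b x \<in> V'" using c(1) D.nbD by blast
    have "even (d' b (D.closer b x)) \<longleftrightarrow> D.closer b x \<in> P"
      by (rule Suc.hyps(1)[OF _ cV]) (use c(2) Suc.hyps(2) in simp)
    then show ?case using alt[OF Suc.prems c(1)] c(2) by simp
  qed
  have near: "\<exists>e\<in>insert b (D.nb b). is_singleton {x \<in> V. h x = e}" if "b \<in> P" for b
    by (rule singleton_fibre_near[OF sing]) (use that P(1) par[OF that] thick' in auto)
  have line: "M1 = M2" if m: "m \<in> V' - P" and M: "M1 \<in> V" "M2 \<in> V" "h M1 = m" "h M2 = m" for m M1 M2
  proof (rule ccontr)
    assume ne: "M1 \<noteq> M2"
    have mV: "m \<in> V'" using m by blast
    obtain b c where bc: "b \<in> D.nb m" "c \<in> D.nb m" "b \<noteq> c"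
      using D.two_neighbours[OF mV] by (auto simp: D.nb_def)
    have *: "\<exists>u\<in>G.nb M2. h u = b \<and> d M1 M2 < 8 \<and> d M1 M2 = Suc (d M1 u)" if b: "b \<in> D.nb m" for b
    proof -
      have bP: "b \<in> P" using alt[OF mV b] m by simp
      obtain e where e: "e \<in> insert b (D.nb b)" "is_singleton {x \<in> V. h x = e}" using near[OF bP]
        by blast
      show ?thesis by (rule line_fibre_closer[OF mV b two[OF bP] e M ne])
    qed
    obtain u where u: "u \<in> G.nb M2" "h u = b" "d M1 M2 < 8" "d M1 M2 = Suc (d M1 u)"
      using *[OF bc(1)] by blast
    obtain w where w: "w \<in> G.nb M2" "h w = c" "d M1 M2 = Suc (d M1 w)" using *[OF bc(2)] by blast
    have "u = w" using G.closer_eq[OF M(1,2) u(1,3,4)] G.closer_eq[OF M(1,2) w(1) u(3) w(3)] by simp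
    then show False using u(2) w(2) bc(3) by simp
  qed
  have b0: "b0 \<in> V'" using P by blast
  obtain x where x: "x \<in> V" "h x = b0" using b0 h_onto by blast
  obtain W where W: "W \<subseteq> G.nb x" "card W = 3" using thick[OF x(1)]
    by (auto simp: at_least_three_def)
  obtain y1 y2 y3 where y: "W = {y1, y2, y3}" "y1 \<noteq> y2" "y2 \<noteq> y3" "y1 \<noteq> y3"
    using W(2) by (auto simp: card_3_iff)
  have yV: "y1 \<in> V" "y2 \<in> V" "y3 \<in> V" using W(1) y G.nbD by blast+
  have hy: "h v \<in> D.nb b0" if "v \<in> W" for v
    using that W(1) G.nbD[of v x] hV h_adj[OF x(1), of v] x(2) by (auto simp: D.nb_def)
  have hP: "h v \<in> V' - P" if "v \<in> W" for v
    using hy[OF that] alt[OF b0 hy[OF that]] P(2) D.nbD by blast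
  have "h y1 = h y2 \<or> h y1 = h y3 \<or> h y2 = h y3" using two[OF P(2)] hy y(1) by simp
  then show False using line[OF hP yV(1) yV(2)] line[OF hP yV(1) yV(3)] line[OF hP yV(2) yV(3)] y
    by fastforce
qed

end

section \<open>Weak generalized octagons as graphs\<close>

fun incident :: "('p, 'l) geometry \<Rightarrow> 'p + 'l \<Rightarrow> 'p + 'l \<Rightarrow> bool" where
  "incident G (Inl x) (Inr M) \<longleftrightarrow> (x, M) \<in> Incid G"
| "incident G (Inr M) (Inl x) \<longleftrightarrow> (x, M) \<in> Incid G"
| "incident G _ _ \<longleftrightarrow> False"

text \<open>Meaningful when some walk joins the two elements; in a weak generalized polygon this is
  \<open>weak_gon_walk\<close>.\<close>

definition gdist :: "('p, 'l) geometry \<Rightarrow> 'p + 'l \<Rightarrow> 'p + 'l \<Rightarrow> nat" where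
  "gdist G x y = (LEAST n. (incident G ^^ n) x y)"

lemma Inl_elements [simp]: "Inl x \<in> elements G \<longleftrightarrow> x \<in> Points G"
  and Inr_elements [simp]: "Inr M \<in> elements G \<longleftrightarrow> M \<in> Lines G"
  by (auto simp: elements_def)

lemma incident_sym: "incident G x y \<Longrightarrow> incident G y x"
  by (cases x; cases y) auto

lemma incident_isl: "incident G x y \<Longrightarrow> isl x \<longleftrightarrow> \<not> isl y"
  by (cases x; cases y) auto

lemma incident_elements: "geometry G \<Longrightarrow> incident G x y \<Longrightarrow> x \<in> elements G \<and> y \<in> elements G"
  by (cases x; cases y) (auto simp: geometry_def)

lemma incident_subgeometry:
  "subgeometry A G \<Longrightarrow> x \<in> elements A \<Longrightarrow> y \<in> elements A \<Longrightarrow> incident A x y \<longleftrightarrow> incident G x y"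
  by (cases x; cases y) (auto simp: subgeometry_def)

lemma subgeometry_elements: "subgeometry A G \<Longrightarrow> elements A \<subseteq> elements G"
  by (auto simp: subgeometry_def elements_def)

lemma walk_isl: "(incident G ^^ n) x y \<Longrightarrow> even n \<longleftrightarrow> (isl x \<longleftrightarrow> isl y)"
proof (induction n arbitrary: y)
  case (Suc n)
  then obtain z where "(incident G ^^ n) x z" "incident G z y" by auto
  then show ?case using Suc.IH[of z] incident_isl[of G z y] by auto
qed auto

lemma walk_sym: "(incident G ^^ n) x y \<Longrightarrow> (incident G ^^ n) y x"
proof (induction n arbitrary: y)
  case (Suc n)
  then obtain z where "(incident G ^^ n) x z" "incident G z y" by auto
  then show ?case using Suc.IH[of z] incident_sym by (metis relpowp_Suc_I2)
qed auto

text \<open>The equivalence in \<open>adj\<close> says that the cycle is induced, as a subgeometry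
  requires. Labels of an ordinary polygon start with a point, so a cycle that starts with a line is
  rotated by one.\<close>

lemma cycle_ordinary_gon:
  fixes c :: "nat \<Rightarrow> 'p + 'l"
  assumes geo: "geometry G" and k: "2 \<le> k" and inj: "inj_on c {..<2 * k}"
    and adj: "\<And>m n. m < 2 * k \<Longrightarrow> n < 2 * k \<Longrightarrow>
      incident G (c m) (c n) \<longleftrightarrow> n = (m + 1) mod (2 * k) \<or> m = (n + 1) mod (2 * k)"
  shows "\<exists>A. subgeometry A G \<and> ordinary_gon k A \<and> elements A = c ` {..<2 * k}"
proof -
  have pt: "\<exists>A. subgeometry A G \<and> ordinary_gon k A \<and> elements A = c ` {..<2 * k}"
    if inj: "inj_on c {..<2 * k}" and c0: "isl (c 0)" and
      adj: "\<And>m n. m < 2 * k \<Longrightarrow> n < 2 * k \<Longrightarrow>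
      incident G (c m) (c n) \<longleftrightarrow> n = (m + 1) mod (2 * k) \<or> m = (n + 1) mod (2 * k)" for c :: "nat \<Rightarrow> 'p + 'l"
  proof -
    have isl: "isl (c m) \<longleftrightarrow> even m" if "m < 2 * k" for m
      using that
    proof (induction m)
      case (Suc m)
      then have "incident G (c m) (c (Suc m))" using adj[of m "Suc m"] by auto
      then show ?case using Suc incident_isl by fastforce
    qed (use c0 in auto)
    define p l where "p i = projl (c (2 * i))" and "l i = projr (c (2 * i + 1))" for i
    have p: "c (2 * i) = Inl (p i)" and l: "c (2 * i + 1) = Inr (l i)" if "i < k" for i
      using isl[of "2 * i"] isl[of "2 * i + 1"] that by (auto simp: p_def l_def)
    define A where "A = \<lparr>Points = p ` {..<k}, Lines = l ` {..<k}, Incid = Incid G \<inter> (p ` {..<k} \<times> l ` {..<k})\<rparr>"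
    have cG: "c m \<in> elements G" if "m < 2 * k" for m
    proof -
      have "(m + 1) mod (2 * k) < 2 * k" using k by simp
      then have "incident G (c m) (c ((m + 1) mod (2 * k)))" using adj[OF that, of
        "(m + 1) mod (2 * k)"] by simp
      then show ?thesis using incident_elements[OF geo] by blast
    qed
    have "p i \<in> Points G" "l i \<in> Lines G" if "i < k" for i
      using cG[of "2 * i"] cG[of "2 * i + 1"] p[OF that] l[OF that] that by auto
    then have sub: "subgeometry A G" by (auto simp: subgeometry_def A_def)
    have ip: "inj_on p {..<k}"
    proof (rule inj_onI)
      fix i j assume ij: "i \<in> {..<k}" "j \<in> {..<k}" "p i = p j"
      then have "c (2 * i) = c (2 * j)" using p by simp
      then show "i = j" using inj_onD[OF inj, of "2 * i" "2 * j"] ij by simp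
    qed
    have il: "inj_on l {..<k}"
    proof (rule inj_onI)
      fix i j assume ij: "i \<in> {..<k}" "j \<in> {..<k}" "l i = l j"
      then have "c (2 * i + 1) = c (2 * j + 1)" using l by simp
      then show "i = j" using inj_onD[OF inj, of "2 * i + 1" "2 * j + 1"] ij by simp
    qed
    have inc: "(p i, l j) \<in> Incid A \<longleftrightarrow> i = j \<or> i = (j + 1) mod k" if "i < k" "j < k" for i j
    proof -
      have "(p i, l j) \<in> Incid A \<longleftrightarrow> incident G (c (2 * i)) (c (2 * j + 1))"
        using p[OF that(1)] l[OF that(2)] that by (auto simp: A_def)
      also have "\<dots> \<longleftrightarrow> 2 * j + 1 = (2 * i + 1) mod (2 * k) \<or> 2 * i = (2 * j + 1 + 1) mod (2 * k)"
        by (rule adj) (use that in auto)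
      also have "(2 * i + 1) mod (2 * k) = 2 * i + 1" using that by simp
      also have "(2 * j + 1 + 1) mod (2 * k) = 2 * ((j + 1) mod k)"
        using mult_mod_right[of 2 "j + 1" k] by simp
      finally show ?thesis by auto
    qed
    have "ordinary_gon k A"
      unfolding ordinary_gon_def
    proof (intro conjI exI[of _ p] exI[of _ l])
      show "geometry A" by (auto simp: geometry_def A_def)
      show "bij_betw p {..<k} (Points A)" "bij_betw l {..<k} (Lines A)"
        using ip il by (auto simp: bij_betw_def A_def)
    qed (use k inc in auto)
    moreover have "elements A = c ` {..<2 * k}"
    proof
      show "elements A \<subseteq> c ` {..<2 * k}"
      proof
        fix x assume "x \<in> elements A"
        then obtain i where i: "i < k" "x = Inl (p i) \<or> x = Inr (l i)"
          by (auto simp: elements_def A_def)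
        then have "x = c (2 * i) \<or> x = c (2 * i + 1)" using p[OF i(1)] l[OF i(1)] by auto
        then show "x \<in> c ` {..<2 * k}" using i(1) by auto
      qed
      show "c ` {..<2 * k} \<subseteq> elements A"
      proof
        fix x assume "x \<in> c ` {..<2 * k}"
        then obtain m where m: "m < 2 * k" "x = c m" by auto
        define i where "i = m div 2"
        have i: "i < k" "m = 2 * i \<or> m = 2 * i + 1" using m(1) by (auto simp: i_def)
        then show "x \<in> elements A" using p[OF i(1)] l[OF i(1)] m(2) by (auto simp: A_def)
      qed
    qed
    ultimately show ?thesis using sub by blast
  qed
  show ?thesis
  proof (cases "isl (c 0)")
    case True
    then show ?thesis using pt[OF inj _ adj] by blast
  next
    case False
    define s where "s m = (m + 1) mod (2 * k)" for m
    have s: "s m < 2 * k" for m using k by (simp add: s_def)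
    have s_inj: "s m = s n \<longleftrightarrow> m = n" if "m < 2 * k" "n < 2 * k" for m n
      using that k by (auto simp: s_def mod_if split: if_splits)
    have bij: "s ` {..<2 * k} = {..<2 * k}"
      by (rule endo_inj_surj) (use s s_inj in \<open>auto intro!: inj_onI\<close>)
    have "incident G (c 0) (c (s 0))" using adj[of 0 "s 0"] s[of 0] k by (auto simp: s_def)
    then have "isl ((c \<circ> s) 0)" using False incident_isl by auto
    moreover have "inj_on (c \<circ> s) {..<2 * k}"
      using s_inj inj bij by (intro comp_inj_on) (auto intro!: inj_onI)
    moreover have "incident G ((c \<circ> s) m) ((c \<circ> s) n) \<longleftrightarrow> n = (m + 1) mod (2 * k) \<or>
      m = (n + 1) mod (2 * k)"
      if mn: "m < 2 * k" "n < 2 * k" for m n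
    proof -
      have "incident G ((c \<circ> s) m) ((c \<circ> s) n) \<longleftrightarrow> s n = s (s m) \<or> s m = s (s n)"
        using adj[OF s s, of m n] by (simp add: s_def[of "s m"] s_def[of "s n"])
      also have "\<dots> \<longleftrightarrow> n = s m \<or> m = s n" using s_inj mn s by simp
      finally show ?thesis by (simp add: s_def)
    qed
    ultimately obtain A where "subgeometry A G" "ordinary_gon k A"
      "elements A = (c \<circ> s) ` {..<2 * k}"
      using pt[of "c \<circ> s"] by blast
    then show ?thesis using bij by (metis image_comp)
  qed
qed

text \<open>Incidence changes the level by one, so two paths with common ends close up to an induced
  cycle once meetings and cross chords are excluded. The lemma is used in two directions: against
  distinct short geodesics, with \<open>gdist\<close> as level, and to construct apartments.\<close>

lemma bigon_ordinary_gon: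
  fixes g1 g2 :: "nat \<Rightarrow> 'p + 'l"
  assumes geo: "geometry G" and k: "2 \<le> k"
    and ends: "g1 0 = g2 0" "g1 k = g2 k"
    and path: "\<And>i. i < k \<Longrightarrow> incident G (g1 i) (g1 (Suc i))"
      "\<And>i. i < k \<Longrightarrow> incident G (g2 i) (g2 (Suc i))"
    and lev: "\<And>i. i \<le> k \<Longrightarrow> lev (g1 i) = i" "\<And>i. i \<le> k \<Longrightarrow> lev (g2 i) = i"
    and step: "\<And>i j x y. i \<le> k \<Longrightarrow> j \<le> k \<Longrightarrow> x \<in> {g1 i, g2 i} \<Longrightarrow> y \<in> {g1 j, g2 j} \<Longrightarrow> incident G x y \<Longrightarrow>
       lev x = Suc (lev y) \<or> lev y = Suc (lev x)"
    and disj: "\<And>i. 0 < i \<Longrightarrow> i < k \<Longrightarrow> g1 i \<noteq> g2 i"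
    and chord: "\<And>i. 0 < i \<Longrightarrow> Suc i < k \<Longrightarrow> \<not> incident G (g1 i) (g2 (Suc i))"
      "\<And>i. 0 < i \<Longrightarrow> Suc i < k \<Longrightarrow> \<not> incident G (g2 i) (g1 (Suc i))"
  shows "\<exists>A. subgeometry A G \<and> ordinary_gon k A \<and> elements A = g1 ` {..k} \<union> g2 ` {..k}"
proof -
  \<comment> \<open>Out along \<open>g1\<close> and back along \<open>g2\<close>; \<open>h\<close>
    gives the level of a position.\<close>
  define c where "c m = (if m \<le> k then g1 m else g2 (2 * k - m))" for m
  define h where "h m = (if m \<le> k then m else 2 * k - m)" for m
  have h: "h m \<le> k" "c m \<in> {g1 (h m), g2 (h m)}" "lev (c m) = h m" if "m < 2 * k" for m
    using that lev by (auto simp: c_def h_def)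
  have ne: "g1 (2 * k - m) \<noteq> g2 (2 * k - m)" if "\<not> m \<le> k" "m < 2 * k" for m
    by (rule disj) (use that in linarith)+
  have inj: "inj_on c {..<2 * k}"
  proof (rule inj_onI)
    fix m n assume mn: "m \<in> {..<2 * k}" "n \<in> {..<2 * k}" "c m = c n"
    then have "h m = h n" using h(3)[of m] h(3)[of n] by simp
    then show "m = n"
      using mn ne[of m] ne[of n] by (auto simp: h_def c_def split: if_splits)
  qed
  have up: "n = (m + 1) mod (2 * k) \<or> m = (n + 1) mod (2 * k)"
    if mn: "m < 2 * k" "n < 2 * k" and i: "incident G (c m) (c n)" and l: "h n = Suc (h m)" for m n
  proof (cases "m \<le> k"; cases "n \<le> k")
    assume a: "m \<le> k" "\<not> n \<le> k"
    then have n: "n = 2 * k - Suc m" "Suc m < k" using l mn by (auto simp: h_def)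
    have "m = 0" using chord(1)[of m] i a n by (cases "m = 0") (auto simp: c_def)
    then show ?thesis using n k by (auto simp: mod_if)
  next
    assume a: "\<not> m \<le> k" "n \<le> k"
    then have n: "m = 2 * k - (n - 1)" "0 < n - 1" "n - 1 < k" using l mn by (auto simp: h_def)
    have "n = k" using chord(2)[of "n - 1"] i a n by (cases "n = k") (auto simp: c_def)
    then show ?thesis using n k by (auto simp: mod_if)
  qed (use l mn k in \<open>auto simp: h_def mod_if\<close>)
  have next_: "incident G (c m) (c n)" if mn: "m < 2 * k" "n = (m + 1) mod (2 * k)" for m n
  proof -
    consider "m < k" | "m = k" | "k < m" "m + 1 < 2 * k" | "m + 1 = 2 * k" using mn(1) by linarith
    then show ?thesis
    proof cases
      case 1
      then show ?thesis using mn path(1)[of m] by (auto simp: c_def)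
    next
      case 2
      then have "n = k + 1" using mn k by (auto simp: mod_if)
      then show ?thesis using 2 ends(2) incident_sym[OF path(2)[of "k - 1"]] k by (auto simp: c_def)
    next
      case 3
      then have "n = m + 1" using mn by simp
      moreover have "2 * k - m = Suc (2 * k - (m + 1))" using 3 by simp
      ultimately show ?thesis using 3 incident_sym[OF path(2)[of "2 * k - (m + 1)"]]
        by (auto simp: c_def)
    next
      case 4
      then have "n = 0" "2 * k - m = Suc 0" "\<not> m \<le> k" using mn k by auto
      then show ?thesis using ends(1) incident_sym[OF path(2)[of 0]] k by (auto simp: c_def)
    qed
  qed
  have "\<exists>A. subgeometry A G \<and> ordinary_gon k A \<and> elements A = c ` {..<2 * k}"
  proof (rule cycle_ordinary_gon[OF geo k inj])
    fix m n assume mn: "m < 2 * k" "n < 2 * k"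
    show "incident G (c m) (c n) \<longleftrightarrow> n = (m + 1) mod (2 * k) \<or> m = (n + 1) mod (2 * k)"
    proof
      assume i: "incident G (c m) (c n)"
      have "h m = Suc (h n) \<or> h n = Suc (h m)"
        using step[OF h(1)[OF mn(1)] h(1)[OF mn(2)] h(2)[OF mn(1)] h(2)[OF mn(2)] i] h(3)[OF mn(1)] h(3)[OF mn(2)] by simp
      then show "n = (m + 1) mod (2 * k) \<or> m = (n + 1) mod (2 * k)"
        using up[OF mn i] up[OF mn(2,1) incident_sym[OF i]] by blast
    next
      assume "n = (m + 1) mod (2 * k) \<or> m = (n + 1) mod (2 * k)"
      then show "incident G (c m) (c n)" using next_[OF mn(1)] next_[OF mn(2)] incident_sym by blast
    qed
  qed
  moreover have "c ` {..<2 * k} = g1 ` {..k} \<union> g2 ` {..k}"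
  proof
    show "c ` {..<2 * k} \<subseteq> g1 ` {..k} \<union> g2 ` {..k}" by (auto simp: c_def)
    show "g1 ` {..k} \<union> g2 ` {..k} \<subseteq> c ` {..<2 * k}"
    proof
      fix x assume "x \<in> g1 ` {..k} \<union> g2 ` {..k}"
      then consider i where "i \<le> k" "x = g1 i" | i where "i \<le> k" "x = g2 i" by blast
      then show "x \<in> c ` {..<2 * k}"
      proof cases
        case 1
        then show ?thesis using k by (intro image_eqI[of _ _ i]) (auto simp: c_def)
      next
        case 2
        show ?thesis
        proof (cases "i = 0 \<or> i = k")
          case True
          then show ?thesis using 2 ends k by (intro image_eqI[of _ _ i]) (auto simp: c_def)
        next
          case False
          then show ?thesis using 2 by (intro image_eqI[of _ _ "2 * k - i"]) (auto simp: c_def)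
        qed
      qed
    qed
  qed
  ultimately show ?thesis by simp
qed

text \<open>The parametrisation is periodic on all naturals, so walks may run past the starting
  element.\<close>

lemma ordinary_gon_cycle:
  assumes "ordinary_gon k A"
  shows "\<exists>c. elements A = c ` {..<2 * k} \<and> inj_on c {..<2 * k} \<and>
    (\<forall>m. incident A (c m) (c (Suc m))) \<and> (\<forall>m. c (m + 2 * k) = c m)"
proof -
  from assms obtain p l where k: "2 \<le> k" and p: "bij_betw p {..<k} (Points A)" and l:
    "bij_betw l {..<k} (Lines A)"
    and inc: "\<And>i j. i < k \<Longrightarrow> j < k \<Longrightarrow> (p i, l j) \<in> Incid A \<longleftrightarrow> i = j \<or> i = (j + 1) mod k"
    unfolding ordinary_gon_def by blast
  define c where "c m = (if even m then Inl (p ((m div 2) mod k)) else Inr (l ((m div 2) mod k)))"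
    for m
  have c2: "c (2 * i) = Inl (p i)" "c (Suc (2 * i)) = Inr (l i)" if "i < k" for i
    using that by (simp_all add: c_def)
  show ?thesis
  proof (intro exI[of _ c] conjI allI)
    show "elements A = c ` {..<2 * k}"
    proof
      show "elements A \<subseteq> c ` {..<2 * k}"
      proof
        fix x assume x: "x \<in> elements A"
        have "\<exists>i<k. x = Inl (p i) \<or> x = Inr (l i)"
        proof (cases x)
          case (Inl a)
          then have "a \<in> p ` {..<k}" using x p by (simp add: bij_betw_def)
          then show ?thesis using Inl by auto
        next
          case (Inr a)
          then have "a \<in> l ` {..<k}" using x l by (simp add: bij_betw_def)
          then show ?thesis using Inr by auto
        qed
        then obtain i where i: "i < k" "x = Inl (p i) \<or> x = Inr (l i)" by blast
        then have "x = c (2 * i) \<or> x = c (Suc (2 * i))" using c2 by auto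
        then show "x \<in> c ` {..<2 * k}" using i(1) by auto
      qed
      have "c m \<in> elements A" for m
      proof -
        have "m div 2 mod k < k" using k by simp
        then have "p (m div 2 mod k) \<in> Points A" "l (m div 2 mod k) \<in> Lines A"
          using p l by (auto simp: bij_betw_def)
        then show ?thesis by (simp add: c_def)
      qed
      then show "c ` {..<2 * k} \<subseteq> elements A" by blast
    qed
    show "inj_on c {..<2 * k}"
    proof (rule inj_onI)
      fix m n assume mn: "m \<in> {..<2 * k}" "n \<in> {..<2 * k}" "c m = c n"
      then have lt: "m div 2 < k" "n div 2 < k" by auto
      have par: "even m \<longleftrightarrow> even n" using mn(3) by (auto simp: c_def split: if_splits)
      have "m div 2 = n div 2"
        using mn(3) lt par inj_onD[OF bij_betw_imp_inj_on[OF p], of "m div 2" "n div 2"]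
          inj_onD[OF bij_betw_imp_inj_on[OF l], of "m div 2" "n div 2"]
        by (auto simp: c_def split: if_splits)
      then show "m = n" using par by (metis dvd_mult_div_cancel odd_two_times_div_two_succ)
    qed
    show "c (m + 2 * k) = c m" for m by (simp add: c_def)
    show "incident A (c m) (c (Suc m))" for m
    proof (cases "even m")
      case True
      then obtain i where "m = 2 * i" by blast
      then show ?thesis using inc[of "i mod k" "i mod k"] k by (simp add: c_def)
    next
      case False
      then obtain i where i: "m = 2 * i + 1" by (rule oddE)
      have "Suc i mod k = (i mod k + 1) mod k" by (simp add: mod_Suc_eq)
      then show ?thesis using inc[of "Suc i mod k" "i mod k"] k i by (simp add: c_def)
    qed
  qed
qed

lemma ordinary_gon_walk:
  assumes "ordinary_gon k A" "x \<in> elements A" "y \<in> elements A"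
  shows "\<exists>n\<le>k. (incident A ^^ n) x y"
proof -
  from ordinary_gon_cycle[OF assms(1)] obtain c where c: "elements A = c ` {..<2 * k}"
    "inj_on c {..<2 * k}"
    "\<forall>m. incident A (c m) (c (Suc m))" "\<forall>m. c (m + 2 * k) = c m"
    by (elim exE conjE)
  note c = c(1,2) c(3,4)[rule_format]
  have w: "(incident A ^^ n) (c m) (c (m + n))" for m n
    by (induction n) (use c(3) in auto)
  have *: "\<exists>n\<le>k. (incident A ^^ n) (c m) (c m')" if "m \<le> m'" "m' < 2 * k" for m m'
  proof (cases "m' - m \<le> k")
    case True
    then show ?thesis using w[of "m' - m" m] that by auto
  next
    case False
    have "(incident A ^^ (m + 2 * k - m')) (c m') (c m)" using w[of
      "m + 2 * k - m'" m'] c(4)[of m] that by simp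
    then show ?thesis using False walk_sym by (intro exI[of _ "m + 2 * k - m'"]) auto
  qed
  obtain m m' where m: "m < 2 * k" "m' < 2 * k" "x = c m" "y = c m'" using assms c(1) by auto
  then show ?thesis using *[of m m'] *[of m' m] walk_sym by (metis nat_le_linear)
qed

lemma ordinary_gon_two_neighbours:
  assumes "ordinary_gon k A" "x \<in> elements A"
  shows "\<exists>y\<in>elements A. \<exists>z\<in>elements A. incident A x y \<and> incident A x z \<and> y \<noteq> z"
proof -
  have k: "2 \<le> k" using assms(1) by (simp add: ordinary_gon_def)
  from ordinary_gon_cycle[OF assms(1)] obtain c where c: "elements A = c ` {..<2 * k}"
    "inj_on c {..<2 * k}"
    "\<forall>m. incident A (c m) (c (Suc m))" "\<forall>m. c (m + 2 * k) = c m"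
    by (elim exE conjE)
  note c = c(1,2) c(3,4)[rule_format]
  obtain m where m: "m < 2 * k" "x = c m" using assms(2) c(1) by auto
  define a b where "a = (if Suc m < 2 * k then Suc m else 0)" and
    "b = (if m = 0 then 2 * k - 1 else m - 1)"
  have ab: "a < 2 * k" "b < 2 * k" "a \<noteq> b" using m k by (auto simp: a_def b_def)
  have "c a = c (Suc m)" 
  proof (cases "Suc m < 2 * k")
    case False
    then have "Suc m = 2 * k" using m(1) by simp
    then show ?thesis using c(4)[of 0] by (simp add: a_def)
  qed (simp add: a_def)
  moreover have "c (Suc b) = c m" using c(4)[of 0] m k by (auto simp: b_def)
  ultimately have "incident A x (c a)" "incident A x (c b)"
    using c(3)[of m] c(3)[of b] m incident_sym[of A "c b"] by auto
  moreover have "c a \<noteq> c b" using inj_onD[OF c(2), of a b] ab by auto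
  ultimately show ?thesis using ab c(1) by auto
qed

lemma subgeometry_walk:
  assumes "subgeometry A G" "geometry A" "(incident A ^^ n) x y"
  shows "(incident G ^^ n) x y"
proof (rule relpowp_mono[OF _ assms(3)])
  fix x y assume "incident A x y"
  then show "incident G x y" using incident_elements[OF assms(2)] incident_subgeometry[OF assms(1)]
    by blast
qed

lemma gdist_le: "(incident G ^^ n) x y \<Longrightarrow> gdist G x y \<le> n"
  unfolding gdist_def by (rule Least_le)

lemma gdist_walk: "(incident G ^^ n) x y \<Longrightarrow> (incident G ^^ gdist G x y) x y"
  unfolding gdist_def by (rule LeastI)

lemma gdist_geodesic:
  assumes "(incident G ^^ gdist G x y) x y"
  shows "\<exists>g. g 0 = x \<and> g (gdist G x y) = y \<and> (\<forall>i < gdist G x y. incident G (g i) (g (Suc i))) \<and>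
    (\<forall>i \<le> gdist G x y. gdist G x (g i) = i)"
proof -
  let ?n = "gdist G x y"
  obtain g where g: "g 0 = x" "g ?n = y" "\<And>i. i < ?n \<Longrightarrow> incident G (g i) (g (Suc i))"
    using assms unfolding relpowp_fun_conv by blast
  have fwd: "(incident G ^^ i) x (g i)" if "i \<le> ?n" for i
    using that by (induction i) (use g in auto)
  have bwd: "(incident G ^^ n) (g i) (g (i + n))" if "i + n \<le> ?n" for i n
    using that by (induction n) (use g in auto)
  have "gdist G x (g i) = i" if i: "i \<le> ?n" for i
  proof (rule antisym)
    show "gdist G x (g i) \<le> i" using fwd[OF i] by (rule gdist_le)
    have "(incident G ^^ (gdist G x (g i) + (?n - i))) x y"
      using relpowp_trans[OF gdist_walk[OF fwd[OF i]] bwd[of i "?n - i"]] i g(2) by simp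
    then have "?n \<le> gdist G x (g i) + (?n - i)" by (rule gdist_le)
    then show "i \<le> gdist G x (g i)" using i by simp
  qed
  then show ?thesis using g by blast
qed

text \<open>The existence of a shortest pair of distinct geodesics with common ends is refuted by the
  ordinary polygon that they bound.\<close>

lemma weak_gon_unique:
  assumes geo: "geometry G" and small: "\<And>k A. 2 \<le> k \<Longrightarrow> k < m \<Longrightarrow> subgeometry A G \<Longrightarrow> \<not> ordinary_gon k A"
    and conn: "\<And>x y. x \<in> elements G \<Longrightarrow> y \<in> elements G \<Longrightarrow> \<exists>n. (incident G ^^ n) x y"
    and "x \<in> elements G" "y \<in> elements G" "gdist G x y < m"
    and "incident G y z" "incident G y z'" "gdist G x y = Suc (gdist G x z)"
      "gdist G x y = Suc (gdist G x z')"
  shows "z = z'"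
  using assms(4-)
proof (induction "gdist G x y" arbitrary: x y z z' rule: less_induct)
  case less
  show ?case
  proof (rule ccontr)
    assume ne: "z \<noteq> z'"
    let ?d = "gdist G x" and ?k = "gdist G x y"
    have W: "(incident G ^^ gdist G u v) u v" if "u \<in> elements G" "v \<in> elements G" for u v
      using conn[OF that] gdist_walk by blast
    have tri: "gdist G u w \<le> gdist G u v + gdist G v w"
      if "u \<in> elements G" "v \<in> elements G" "w \<in> elements G" for u v w
      using relpowp_trans[OF W[OF that(1,2)] W[OF that(2,3)]] by (rule gdist_le)
    have zV: "z \<in> elements G" "z' \<in> elements G"
      using incident_elements[OF geo] less.prems(4,5) by blast+
    from gdist_geodesic[OF W[OF less.prems(1) zV(1)]]
    obtain g1 where g1: "g1 0 = x" "g1 (?d z) = z" "\<forall>i < ?d z. incident G (g1 i) (g1 (Suc i))"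
      "\<forall>i \<le> ?d z. ?d (g1 i) = i"
      by (elim exE conjE)
    note g1 = g1(1,2) g1(3,4)[rule_format]
    from gdist_geodesic[OF W[OF less.prems(1) zV(2)]]
    obtain g2 where g2: "g2 0 = x" "g2 (?d z') = z'" "\<forall>i < ?d z'. incident G (g2 i) (g2 (Suc i))"
      "\<forall>i \<le> ?d z'. ?d (g2 i) = i"
      by (elim exE conjE)
    note g2 = g2(1,2) g2(3,4)[rule_format]
    have dz: "?d z = ?k - 1" "?d z' = ?k - 1" using less.prems(6,7) by auto
    have k2: "2 \<le> ?k"
    proof (rule ccontr)
      assume "\<not> 2 \<le> ?k"
      then have "?d z = 0" "?d z' = 0" using dz by auto
      then have "z = x" "z' = x" using g1(1,2) g2(1,2) by auto
      then show False using ne by simp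
    qed
    define h1 h2 where "h1 i = (if i = ?k then y else g1 i)" and
      "h2 i = (if i = ?k then y else g2 i)" for i
    have path: "incident G (h1 i) (h1 (Suc i))" "incident G (h2 i) (h2 (Suc i))" if "i < ?k" for i
    proof -
      have "incident G (h1 i) (h1 (Suc i)) \<and> incident G (h2 i) (h2 (Suc i))"
      proof (cases "i = ?k - 1")
        case True
        then show ?thesis using g1(2) g2(2) dz k2 less.prems(4,5)[THEN incident_sym]
          by (auto simp: h1_def h2_def)
      next
        case False
        then show ?thesis using g1(3)[of i] g2(3)[of i] dz that by (auto simp: h1_def h2_def)
      qed
      then show "incident G (h1 i) (h1 (Suc i))" "incident G (h2 i) (h2 (Suc i))" by auto
    qed
    have lev: "?d (h1 i) = i" "?d (h2 i) = i" if "i \<le> ?k" for i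
      using that g1(4)[of i] g2(4)[of i] dz by (auto simp: h1_def h2_def)
    have hV: "h1 i \<in> elements G" "h2 i \<in> elements G" if "i \<le> ?k" for i
    proof -
      have "h1 i \<in> elements G \<and> h2 i \<in> elements G"
      proof (cases "i = ?k")
        case True then show ?thesis using less.prems(2) by (simp add: h1_def h2_def)
      next
        case False
        then have "i < ?k" using that by simp
        then show ?thesis using path[of i] incident_elements[OF geo] by blast
      qed
      then show "h1 i \<in> elements G" "h2 i \<in> elements G" by auto
    qed
    have last: "h1 (?k - 1) = z" "h2 (?k - 1) = z'" using g1(2) g2(2) dz k2
      by (auto simp: h1_def h2_def)
    \<comment> \<open>If the geodesics met at an inner element, the final steps towards
      \<open>y\<close> seen from there would be a shorter instance and \<open>z = z'\<close> would
      follow.\<close>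
    have disj: "h1 i \<noteq> h2 i" if i: "0 < i" "i < ?k" for i
    proof
      assume eq: "h1 i = h2 i"
      have fwd: "(incident G ^^ n) (h1 j) (h1 (j + n)) \<and> (incident G ^^ n) (h2 j) (h2 (j + n))" if
        "j + n \<le> ?k" for j n
        using that by (induction n) (use path in auto)
      let ?w = "h1 i"
      have wV: "?w \<in> elements G" "?d ?w = i" using hV lev i by auto
      have ar: "i + (?k - 1 - i) = ?k - 1" "i + (?k - i) = ?k" using i by simp_all
      have "(incident G ^^ (?k - 1 - i)) ?w z" "(incident G ^^ (?k - 1 - i)) ?w z'"
        using fwd[of i "?k - 1 - i"] unfolding ar last eq by simp_all
      note b = this[THEN gdist_le]
      have "(incident G ^^ (?k - i)) ?w y" using fwd[of i "?k - i"] unfolding ar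
        by (simp add: h1_def)
      note wy = this[THEN gdist_le]
      have "?k \<le> i + gdist G ?w y" using tri[OF less.prems(1) wV(1) less.prems(2)] wV(2) by simp
      moreover have "?k - 1 \<le> i + gdist G ?w z" "?k - 1 \<le> i + gdist G ?w z'"
        using tri[OF less.prems(1) wV(1) zV(1)] tri[OF less.prems(1) wV(1) zV(2)] wV(2) dz
          by simp_all
      ultimately have "gdist G ?w y = ?k - i" "gdist G ?w z = ?k - 1 - i"
        "gdist G ?w z' = ?k - 1 - i"
        using b wy by auto
      then have "z = z'"
        using i less.prems by (intro less.hyps[of ?w y] wV) auto
      then show False using ne by simp
    qed
    \<comment> \<open>A chord gives an element of level \<open>Suc i\<close>, below that of
      \<open>y\<close>, two neighbours of level \<open>i\<close>: again a shorter instance.\<close>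
    have chord: "\<not> incident G (h1 i) (h2 (Suc i))" "\<not> incident G (h2 i) (h1 (Suc i))"
      if i: "0 < i" "Suc i < ?k" for i
    proof -
      have i': "i < ?k" "i \<le> ?k" "Suc i \<le> ?k" using i by auto
      have d2: "?d (h2 (Suc i)) = Suc i" "?d (h1 (Suc i)) = Suc i" "?d (h1 i) = i" "?d (h2 i) = i"
        using lev i' by auto
      have p: "incident G (h1 (Suc i)) (h1 i)" "incident G (h2 (Suc i)) (h2 i)"
        using path[OF i'(1)] incident_sym by auto
      show "\<not> incident G (h1 i) (h2 (Suc i))"
      proof
        assume a: "incident G (h1 i) (h2 (Suc i))"
        have "h1 i = h2 i"
          by (rule less.hyps[of x "h2 (Suc i)"])
            (use d2 i less.prems hV[OF i'(3)] p incident_sym[OF a] in auto)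
        then show False using disj i i' by blast
      qed
      show "\<not> incident G (h2 i) (h1 (Suc i))"
      proof
        assume a: "incident G (h2 i) (h1 (Suc i))"
        have "h1 i = h2 i"
          by (rule less.hyps[of x "h1 (Suc i)"])
            (use d2 i less.prems hV[OF i'(3)] p incident_sym[OF a] in auto)
        then show False using disj i i' by blast
      qed
    qed
    have step: "?d u = Suc (?d v) \<or> ?d v = Suc (?d u)" if uv: "u \<in> elements G" "v \<in> elements G"
      "incident G u v" for u v
    proof -
      have 1: "(incident G ^^ 1) u v" "(incident G ^^ 1) v u" using uv(3) incident_sym
        unfolding relpowp_1 by auto
      have "?d v \<le> ?d u + 1" using relpowp_trans[OF W[OF less.prems(1) uv(1)] 1(1)]
        by (rule gdist_le)
      moreover have "?d u \<le> ?d v + 1" using relpowp_trans[OF W[OF less.prems(1) uv(2)] 1(2)]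
        by (rule gdist_le)
      moreover have "?d u \<noteq> ?d v"
        using walk_isl[OF W[OF less.prems(1) uv(1)]] walk_isl[OF W[OF less.prems(1) uv(2)]] incident_isl[OF uv(3)] by auto
      ultimately show ?thesis by auto
    qed
    have "\<exists>A. subgeometry A G \<and> ordinary_gon ?k A \<and> elements A = h1 ` {..?k} \<union> h2 ` {..?k}"
    proof (rule bigon_ordinary_gon[of _ _ _ _ ?d])
      show "?d u = Suc (?d v) \<or> ?d v = Suc (?d u)"
        if "i \<le> ?k" "j \<le> ?k" "u \<in> {h1 i, h2 i}" "v \<in> {h1 j, h2 j}" "incident G u v" for i j u v
        using step[of u v] hV that by auto
    qed (use geo k2 path lev disj chord g1(1) g2(1) in \<open>auto simp: h1_def h2_def\<close>)
    then show False using small[OF k2 less.prems(3)] by blast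
  qed
qed

text \<open>Apartments bound the diameter and supply two neighbours; the absence of smaller polygons
  makes projections unique.\<close>

theorem weak_gon_octagon:
  assumes "weak_generalized_gon 8 G"
  shows "octagon (elements G) (incident G) (gdist G)"
proof -
  have geo: "geometry G"
    and gon: "\<And>x y. x \<in> elements G \<Longrightarrow> y \<in> elements G \<Longrightarrow>
      \<exists>A. subgeometry A G \<and> ordinary_gon 8 A \<and> x \<in> elements A \<and> y \<in> elements A"
    and small: "\<And>k A. 2 \<le> k \<Longrightarrow> k < 8 \<Longrightarrow> subgeometry A G \<Longrightarrow> \<not> ordinary_gon k A"
    using assms unfolding weak_generalized_gon_def by blast+
  have og: "geometry A" if "ordinary_gon 8 A" for A :: "('a, 'b) geometry"
    using that by (simp add: ordinary_gon_def)
  have walk8: "\<exists>n\<le>8. (incident G ^^ n) x y" if "x \<in> elements G" "y \<in> elements G" for x y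
    using gon[OF that] ordinary_gon_walk og subgeometry_walk by metis
  have W: "(incident G ^^ gdist G x y) x y" if "x \<in> elements G" "y \<in> elements G" for x y
    using walk8[OF that] gdist_walk by blast
  show ?thesis
  proof
    fix x y assume xy: "x \<in> elements G" "y \<in> elements G"
    show "gdist G x y = gdist G y x"
      using gdist_le[OF walk_sym[OF W[OF xy]]] gdist_le[OF walk_sym[OF W[OF xy(2,1)]]] by simp
    show z: "gdist G x y = 0 \<longleftrightarrow> x = y"
      using W[OF xy] gdist_le[of 0 G x y] by (auto simp: relpowp_0_I)
    show "gdist G x y = 1 \<longleftrightarrow> incident G x y"
    proof
      assume "gdist G x y = 1"
      then have "(incident G ^^ 1) x y" using W[OF xy] by metis
      then show "incident G x y" unfolding relpowp_1 .
    next
      assume a: "incident G x y"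
      then have "gdist G x y \<le> 1" using gdist_le[of 1 G x y] unfolding relpowp_1 by simp
      moreover have "x \<noteq> y" using incident_isl[OF a] by auto
      ultimately show "gdist G x y = 1" using z by linarith
    qed
    show "gdist G x y \<le> 8" using walk8[OF xy] gdist_le le_trans by blast
    show "\<exists>z\<in>elements G. incident G y z \<and> gdist G x y = Suc (gdist G x z)" if ne: "x \<noteq> y"
    proof -
      obtain n where n: "gdist G x y = Suc n" using z ne by (cases "gdist G x y") auto
      then obtain w where w: "(incident G ^^ n) x w" "incident G w y" using W[OF xy] by auto
      have wV: "w \<in> elements G" using incident_elements[OF geo w(2)] by simp
      have "(incident G ^^ Suc (gdist G x w)) x y" using W[OF xy(1) wV] w(2) by auto
      then have "Suc n \<le> Suc (gdist G x w)" using gdist_le n by metis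
      moreover have "gdist G x w \<le> n" using w(1) by (rule gdist_le)
      ultimately show ?thesis using n wV w(2) incident_sym by (intro bexI[of _ w]) auto
    qed
    fix v assume v: "v \<in> elements G"
    show "gdist G x v = Suc (gdist G x y) \<or> gdist G x y = Suc (gdist G x v)" if i: "incident G y v"
    proof -
      have "(incident G ^^ Suc (gdist G x y)) x v" "(incident G ^^ Suc (gdist G x v)) x y"
        using W[OF xy] W[OF xy(1) v] i incident_sym[OF i] by auto
      then have "gdist G x v \<le> Suc (gdist G x y)" "gdist G x y \<le> Suc (gdist G x v)"
        using gdist_le by blast+
      moreover have "gdist G x v \<noteq> gdist G x y"
        using walk_isl[OF W[OF xy]] walk_isl[OF W[OF xy(1) v]] incident_isl[OF i] by auto
      ultimately show ?thesis by auto
    qed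
    fix v' assume "v' \<in> elements G"
    show "v = v'" if "gdist G x y < 8" "incident G y v" "incident G y v'"
      "gdist G x y = Suc (gdist G x v)" "gdist G x y = Suc (gdist G x v')"
      by (rule weak_gon_unique[OF geo small _ xy that]) (use walk8 in blast)+
  next
    fix x assume x: "x \<in> elements G"
    obtain A where A: "subgeometry A G" "ordinary_gon 8 A" "x \<in> elements A" using gon[OF x x]
      by blast
    from ordinary_gon_two_neighbours[OF A(2,3)]
    show "\<exists>y\<in>elements G. \<exists>z\<in>elements G. incident G x y \<and> incident G x z \<and> y \<noteq> z"
      using incident_subgeometry[OF A(1)] A(3) subgeometry_elements[OF A(1)] by blast
  qed
qed

section \<open>Generated subgeometries\<close>

context octagon
begin

lemma closer_step:
  assumes "x \<in> V" "u \<in> V" "v \<in> nb u" "d x u = i" "d x v = Suc i" "Suc i < 8"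
  shows "closer x v = u"
  using assms nbD[OF assms(3)] nb_sym[OF assms(2,3)] by (intro closer_eq) auto

lemma geodesic_to:
  assumes x: "x \<in> V" and "y \<in> V"
  shows "\<exists>g. g 0 = x \<and> g (d x y) = y \<and> (\<forall>i \<le> d x y. g i \<in> V \<and> d x (g i) = i) \<and>
    (\<forall>i < d x y. g (Suc i) \<in> nb (g i))"
  using assms(2)
proof (induction "d x y" arbitrary: y)
  case 0
  then show ?case using dist_0[OF x, of y] by (intro exI[of _ "\<lambda>_. x"]) auto
next
  case (Suc n)
  have "x \<noteq> y" using Suc.hyps(2) dist_0[OF x Suc.prems] by auto
  note c = closer[OF x Suc.prems this]
  have cV: "closer x y \<in> V" using c(1) nbD by blast
  have n: "n = d x (closer x y)" using c(2) Suc.hyps(2) by simp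
  from Suc.hyps(1)[OF n cV] obtain g where g: "g 0 = x" "g n = closer x y"
    "\<forall>i \<le> n. g i \<in> V \<and> d x (g i) = i" "\<forall>i < n. g (Suc i) \<in> nb (g i)"
    unfolding n[symmetric] by (elim exE conjE)
  have "y \<in> nb (closer x y)" using nb_sym[OF Suc.prems c(1)] .
  moreover have dy: "d x y = Suc n" using Suc.hyps(2) by simp
  ultimately show ?case
    unfolding dy
    using g Suc.prems dy by (intro exI[of _ "g(Suc n := y)"]) (auto simp: le_Suc_eq less_Suc_eq)
qed

lemma geodesic_through:
  assumes x: "x \<in> V" and y: "y \<in> V"
  shows "\<exists>g. g 0 = x \<and> g (d x y) = y \<and> (\<forall>i \<le> 8. g i \<in> V \<and> d x (g i) = i) \<and>
    (\<forall>i < 8. g (Suc i) \<in> nb (g i))"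
proof -
  have "\<exists>g. g 0 = x \<and> g (d x y) = y \<and> (\<forall>i \<le> k. g i \<in> V \<and> d x (g i) = i) \<and>
    (\<forall>i < k. g (Suc i) \<in> nb (g i))"
    if "d x y \<le> k" "k \<le> 8" for k
    using that
  proof (induction k rule: dec_induct)
    case base
    show ?case using geodesic_to[OF x y] .
  next
    case (step k)
    then obtain g where g: "g 0 = x" "g (d x y) = y" "\<forall>i \<le> k. g i \<in> V \<and> d x (g i) = i"
      "\<forall>i < k. g (Suc i) \<in> nb (g i)"
      by auto
    have gk: "g k \<in> V" "d x (g k) = k" using g(3) by auto
    obtain w where w: "w \<in> nb (g k)" "w \<noteq> closer x (g k)" using other_neighbour[OF gk(1)] by blast
    have "d x w = Suc k" using farther[OF x gk(1) w(1) _ w(2)] gk(2) step by simp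
    moreover have "w \<in> V" using w(1) nbD by blast
    ultimately show ?case
      using g w(1) step.hyps by (intro exI[of _ "g(Suc k := w)"]) (auto simp: le_Suc_eq less_Suc_eq)
  qed
  then show ?thesis using dist_le[OF x y] by blast
qed

text \<open>Two geodesics lead from \<open>x\<close> to an opposite element, one through
  \<open>y\<close> and one with a different first step. Uniqueness of projections from
  \<open>x\<close> traces any meeting below level 8 back to equal first steps, and excludes chords
  as well.\<close>

lemma apartment:
  assumes x: "x \<in> V" and y: "y \<in> V"
  shows "\<exists>g1 g2. g1 0 = x \<and> g2 0 = x \<and> g1 8 = g2 8 \<and> y \<in> g1 ` {..8} \<and>
    (\<forall>i\<le>8. g1 i \<in> V \<and> g2 i \<in> V \<and> d x (g1 i) = i \<and> d x (g2 i) = i) \<and>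
    (\<forall>i<8. adj (g1 i) (g1 (Suc i)) \<and> adj (g2 i) (g2 (Suc i))) \<and>
    (\<forall>i. 0 < i \<longrightarrow> i < 8 \<longrightarrow> g1 i \<noteq> g2 i) \<and>
    (\<forall>i. 0 < i \<longrightarrow> Suc i < 8 \<longrightarrow> \<not> adj (g1 i) (g2 (Suc i)) \<and> \<not> adj (g2 i) (g1 (Suc i)))"
proof -
  from geodesic_through[OF x y] obtain g1 where g1: "g1 0 = x" "g1 (d x y) = y"
    "\<forall>i \<le> 8. g1 i \<in> V \<and> d x (g1 i) = i" "\<forall>i < 8. g1 (Suc i) \<in> nb (g1 i)"
    by (elim exE conjE)
  define z where "z = g1 8"
  have z: "z \<in> V" "d x z = 8" using g1(3) by (auto simp: z_def)
  obtain b where b: "b \<in> nb x" "b \<noteq> g1 1" using other_neighbour[OF x] by blast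
  have bV: "b \<in> V" using b nbD by blast
  have "d z b = 7"
    using nb_step[OF z(1) x b(1)] dist_sym[OF x z(1)] z(2) dist_le[OF z(1) bV] by auto
  then have bz: "d b z = 7" using dist_sym[OF bV z(1)] by simp
  from geodesic_to[OF bV z(1)] obtain h where h: "h 0 = b" "h 7 = z"
    "\<forall>i \<le> 7. h i \<in> V \<and> d b (h i) = i" "\<forall>i < 7. h (Suc i) \<in> nb (h i)"
    unfolding bz by (elim exE conjE)
  \<comment> \<open>Descending from \<open>z\<close>: the distance of \<open>h i\<close> from
    \<open>x\<close> differs by one from that of \<open>h (Suc i)\<close> and also from the distance
    \<open>i\<close> between \<open>h i\<close> and \<open>b\<close>. Only \<open>Suc i\<close> fits
    both.\<close>
  have hx: "d x (h i) = Suc i" if "i \<le> 7" for i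
    using that
  proof (induction i rule: inc_induct)
    case base
    then show ?case using h(2) z(2) by simp
  next
    case (step i)
    have V: "h i \<in> V" "h (Suc i) \<in> V" "h (Suc i) \<in> nb (h i)" "d b (h i) = i"
      using h(3,4) step.hyps by auto
    have "d x (h (Suc i)) = Suc (d x (h i)) \<or> d x (h i) = Suc (d x (h (Suc i)))"
      by (rule nb_step[OF x V(1,3)])
    moreover have "d (h i) b = Suc (d (h i) x) \<or> d (h i) x = Suc (d (h i) b)"
      by (rule nb_step[OF V(1) x b(1)])
    ultimately show ?case using step.IH V(4) dist_sym[OF V(1) x] dist_sym[OF V(1) bV] by arith
  qed
  define g2 where "g2 i = (if i = 0 then x else h (i - 1))" for i
  have g2V: "g2 i \<in> V" "d x (g2 i) = i" if "i \<le> 8" for i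
    using that x h(3) hx[of "i - 1"] dist_0[OF x x] by (auto simp: g2_def)
  have g2n: "g2 (Suc i) \<in> nb (g2 i)" if "i < 8" for i
  proof (cases i)
    case 0
    then show ?thesis using b(1) h(1) by (simp add: g2_def)
  next
    case (Suc j)
    then show ?thesis using h(4) that by (simp add: g2_def)
  qed
  have g1V: "g1 i \<in> V" "d x (g1 i) = i" if "i \<le> 8" for i using g1(3) that by auto
  have g1n: "g1 (Suc i) \<in> nb (g1 i)" if "i < 8" for i using g1(4) that by auto
  have c1: "closer x (g1 (Suc i)) = g1 i" and c2: "closer x (g2 (Suc i)) = g2 i" if "Suc i < 8"
    for i
    using closer_step[OF x, of "g1 i" "g1 (Suc i)" i] closer_step[OF x, of "g2 i" "g2 (Suc i)" i]
      g1V g1n g2V g2n that by auto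
  have disj: "g1 (Suc i) \<noteq> g2 (Suc i)" if "Suc i < 8" for i
    using that
  proof (induction i)
    case 0
    then show ?case using b(2) h(1) by (simp add: g2_def)
  next
    case (Suc i)
    then show ?case using c1[of "Suc i"] c2[of "Suc i"] by (metis Suc_lessD)
  qed
  have disj': "g1 i \<noteq> g2 i" if "0 < i" "i < 8" for i
    using disj[of "i - 1"] that by simp
  have nbI: "v \<in> nb u" if "adj u v" "v \<in> V" for u v using that by (simp add: nb_def)
  show ?thesis
  proof (rule exI[of _ g1], rule exI[of _ g2], intro conjI allI impI)
    show "g1 8 = g2 8" using h(2) by (simp add: g2_def z_def)
    show "y \<in> g1 ` {..8}" using g1(2) dist_le[OF x y] by (intro image_eqI[of _ _ "d x y"]) auto
    show "adj (g1 i) (g1 (Suc i))" "adj (g2 i) (g2 (Suc i))" if "i < 8" for i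
      using g1n[OF that] g2n[OF that] nbD by blast+
    show "\<not> adj (g1 i) (g2 (Suc i))" if i: "0 < i" "Suc i < 8" for i
    proof
      assume a: "adj (g1 i) (g2 (Suc i))"
      have "closer x (g2 (Suc i)) = g1 i"
        by (rule closer_step[OF x, of _ _ i]) (use g1V[of i] g2V[of "Suc i"] nbI[OF a] i in auto)
      then show False using c2[OF i(2)] disj'[of i] i by simp
    qed
    show "\<not> adj (g2 i) (g1 (Suc i))" if i: "0 < i" "Suc i < 8" for i
    proof
      assume a: "adj (g2 i) (g1 (Suc i))"
      have "closer x (g1 (Suc i)) = g2 i"
        by (rule closer_step[OF x, of _ _ i]) (use g2V[of i] g1V[of "Suc i"] nbI[OF a] i in auto)
      then show False using c1[OF i(2)] disj'[of i] i by simp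
    qed
  qed (use g1(1) g1V g2V disj' in \<open>auto simp: g2_def\<close>)
qed

end

text \<open>The polygon is built inside \<open>A\<close>, so a subset that satisfies the graph
  conditions contains apartments of its own.\<close>

lemma octagon_ordinary_gon:
  assumes geo: "geometry G" and oct: "octagon A (incident G) \<delta>" and xy: "x \<in> A" "y \<in> A"
  shows "\<exists>B. subgeometry B G \<and> ordinary_gon 8 B \<and> elements B \<subseteq> A \<and> x \<in> elements B \<and> y \<in> elements B"
proof -
  interpret octagon A "incident G" \<delta> by (rule oct)
  from apartment[OF xy] obtain g1 g2 where g: "g1 0 = x" "g2 0 = x" "g1 8 = g2 8" "y \<in> g1 ` {..8}"
    and V: "\<forall>i\<le>8. g1 i \<in> A \<and> g2 i \<in> A \<and> \<delta> x (g1 i) = i \<and> \<delta> x (g2 i) = i"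
    and p: "\<forall>i<8. incident G (g1 i) (g1 (Suc i)) \<and> incident G (g2 i) (g2 (Suc i))"
    and ne: "\<forall>i. 0 < i \<longrightarrow> i < 8 \<longrightarrow> g1 i \<noteq> g2 i"
    and ch: "\<forall>i. 0 < i \<longrightarrow> Suc i < 8 \<longrightarrow> \<not> incident G (g1 i) (g2 (Suc i)) \<and>
      \<not> incident G (g2 i) (g1 (Suc i))"
    by (elim exE conjE)
  have gA: "g1 i \<in> A" "g2 i \<in> A" and gd: "\<delta> x (g1 i) = i" "\<delta> x (g2 i) = i" if "i \<le> 8" for i
    using V that by auto
  have path: "incident G (g1 i) (g1 (Suc i))" "incident G (g2 i) (g2 (Suc i))" if "i < 8" for i
    using p that by auto
  have disj: "g1 i \<noteq> g2 i" if "0 < i" "i < 8" for i using ne that by blast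
  have chord: "\<not> incident G (g1 i) (g2 (Suc i))" "\<not> incident G (g2 i) (g1 (Suc i))" if "0 < i"
    "Suc i < 8" for i
    using ch that by blast+
  have "\<exists>B. subgeometry B G \<and> ordinary_gon 8 B \<and> elements B = g1 ` {..8} \<union> g2 ` {..8}"
  proof (rule bigon_ordinary_gon[OF geo _ _ _ path gd _ disj chord])
    fix i j u v assume a: "i \<le> 8" "j \<le> 8" "u \<in> {g1 i, g2 i}" "v \<in> {g1 j, g2 j}" "incident G u v"
    then have "u \<in> A" "v \<in> A" using gA by auto
    then show "\<delta> x u = Suc (\<delta> x v) \<or> \<delta> x v = Suc (\<delta> x u)" using dist_step[OF xy(1) _ _ a(5)]
      by blast
  qed (use g in auto)
  then obtain B where B: "subgeometry B G" "ordinary_gon 8 B" "elements B = g1 ` {..8} \<union> g2 ` {..8}"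
    by blast
  moreover have "elements B \<subseteq> A" using B(3) gA by auto
  moreover have "x \<in> elements B" using B(3) g(1) by (metis UnI1 atMost_iff imageI zero_le)
  moreover have "y \<in> elements B" using B(3) g(4) by simp
  ultimately show ?thesis by blast
qed

text \<open>A suboctagon is isometrically embedded, hence its own projections are the ambient
  ones.\<close>

lemma sub_gon_closed:
  assumes G: "weak_generalized_gon 8 G" and A: "sub_gon 8 A G"
    and xy: "x \<in> elements A" "y \<in> elements A" "x \<noteq> y" "gdist G x y < 8"
  shows "octagon.closer (elements G) (incident G) (gdist G) x y \<in> elements A"
proof -
  interpret G: octagon "elements G" "incident G" "gdist G" by (rule weak_gon_octagon[OF G])
  have sub: "subgeometry A G" and wA: "weak_generalized_gon 8 A" using A by (auto simp: sub_gon_def)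
  interpret A: octagon "elements A" "incident A" "gdist A" by (rule weak_gon_octagon[OF wA])
  have AG: "u \<in> elements G" if "u \<in> elements A" for u using that subgeometry_elements[OF sub]
    by blast
  have inc: "incident A u v \<longleftrightarrow> incident G u v" if "u \<in> elements A" "v \<in> elements A" for u v
    by (rule incident_subgeometry[OF sub that])
  have nb: "v \<in> G.nb u" if "v \<in> A.nb u" "u \<in> elements A" for u v
    using that inc AG by (auto simp: A.nb_def G.nb_def)
  have eq: "gdist G u v = gdist A u v" if u: "u \<in> elements A" and "v \<in> elements A" for u v
    using that(2)
  proof (induction "gdist A u v" arbitrary: v rule: less_induct)
    case less
    show ?case
    proof (cases "u = v")
      case True
      then show ?thesis using G.dist_0[OF AG[OF u] AG[OF less.prems]] A.dist_0[OF u less.prems]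
        by simp
    next
      case False
      define z where "z = A.closer u v"
      have z: "z \<in> A.nb v" "gdist A u v = Suc (gdist A u z)"
        using A.closer[OF u less.prems False] by (simp_all add: z_def)
      have zA: "z \<in> elements A" using z(1) A.nbD by blast
      have dz: "gdist G u z = gdist A u z" using less.hyps[OF _ zA] z(2) by simp
      \<comment> \<open>If \<open>v\<close> were nearer to \<open>u\<close> than \<open>z\<close> in
        \<open>G\<close>, then \<open>v\<close> and the inner projection of \<open>u\<close> onto
        \<open>z\<close> would both be the ambient projection, although their inner distances from
        \<open>u\<close> differ by two.\<close>
      have "\<not> gdist G u z = Suc (gdist G u v)"
      proof
        assume a: "gdist G u z = Suc (gdist G u v)"
        have "u \<noteq> z" using a G.dist_0[OF AG[OF u] AG[OF zA]] by auto
        note c = A.closer[OF u zA this]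
        have cA: "A.closer u z \<in> elements A" using c(1) A.nbD by blast
        have dc: "gdist G u (A.closer u z) = gdist A u (A.closer u z)"
          by (rule less.hyps[OF _ cA]) (use c(2) z(2) in simp)
        have lt: "gdist G u z < 8" using z(2) A.dist_le[OF u less.prems] dz by simp
        have "G.closer u z = v"
          by (rule G.closer_eq[OF AG[OF u] AG[OF zA] G.nb_sym[OF AG[OF less.prems] nb[OF z(1) less.prems]] lt a])
        moreover have "G.closer u z = A.closer u z"
          by (rule G.closer_eq[OF AG[OF u] AG[OF zA] nb[OF c(1) zA] lt]) (use dc dz c(2) in simp)
        ultimately have "v = A.closer u z" by simp
        then show False using c(2) z(2) by simp
      qed
      then show ?thesis using G.nb_step[OF AG[OF u] AG[OF less.prems] nb[OF z(1) less.prems]] dz z(2) by auto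
    qed
  qed
  note c = A.closer[OF xy(1-3)]
  have cA: "A.closer x y \<in> elements A" using c(1) A.nbD by blast
  have "G.closer x y = A.closer x y"
    by (rule G.closer_eq[OF AG[OF xy(1)] AG[OF xy(2)] nb[OF c(1) xy(2)] xy(4)])
      (use c(2) eq xy cA in simp)
  then show ?thesis using cA by simp
qed

lemma weak_gon_sub_gon: "weak_generalized_gon n G \<Longrightarrow> sub_gon n G G"
  by (auto simp: sub_gon_def subgeometry_def weak_generalized_gon_def geometry_def)

text \<open>\<open>G\<close> itself is among the intersected geometries, so the intersection stays
  inside \<open>G\<close> and keeps the induced incidence.\<close>

lemma generated_subgeometry:
  fixes G :: "('a, 'b) geometry"
  assumes G: "weak_generalized_gon n G" and S: "S \<subseteq> Points G"
  shows "subgeometry (generated n G S) G"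
    and "x \<in> elements (generated n G S) \<longleftrightarrow> (\<forall>A. sub_gon n A G \<and> S \<subseteq> Points A \<longrightarrow> x \<in> elements A)"
proof -
  note GG = weak_gon_sub_gon[OF G]
  have sub: "Incid A = Incid G \<inter> (Points A \<times> Lines A)" "Points A \<subseteq> Points G" "Lines A \<subseteq> Lines G"
    if "sub_gon n A G" for A using that by (auto simp: sub_gon_def subgeometry_def)
  have "Points (generated n G S) \<subseteq> Points G" "Lines (generated n G S) \<subseteq> Lines G"
    using GG S by (auto simp: generated_def)
  moreover have "Incid (generated n G S) = Incid G \<inter> (Points (generated n G S) \<times> Lines (generated n G S))"
  proof (intro set_eqI)
    fix z :: "'a \<times> 'b"
    obtain u M where z: "z = (u, M)" by (cases z)
    have "z \<in> Incid (generated n G S) \<longleftrightarrow> (\<forall>A. sub_gon n A G \<and> S \<subseteq> Points A \<longrightarrow> z \<in> Incid A)"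
      by (auto simp: generated_def)
    also have "\<dots> \<longleftrightarrow> (\<forall>A. sub_gon n A G \<and> S \<subseteq> Points A \<longrightarrow> z \<in> Incid G \<and> u \<in> Points A \<and> M \<in> Lines A)"
      using sub(1) z by blast
    also have "\<dots> \<longleftrightarrow> z \<in> Incid G \<inter> (Points (generated n G S) \<times> Lines (generated n G S))"
      using GG S z by (auto simp: generated_def)
    finally show "z \<in> Incid (generated n G S) \<longleftrightarrow>
      z \<in> Incid G \<inter> (Points (generated n G S) \<times> Lines (generated n G S))" .
  qed
  ultimately show "subgeometry (generated n G S) G" by (simp add: subgeometry_def)
  show "x \<in> elements (generated n G S) \<longleftrightarrow> (\<forall>A. sub_gon n A G \<and> S \<subseteq> Points A \<longrightarrow> x \<in> elements A)"
    by (cases x) (auto simp: generated_def)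
qed

text \<open>Establishes the premise of local finite generation: the graph conditions give apartments
  inside \<open>H\<close>, and a smaller polygon in \<open>H\<close> would be one in
  \<open>G\<close>.\<close>

lemma octagon_sub_gon:
  assumes G: "weak_generalized_gon 8 G" and sub: "subgeometry H G" and ne: "elements H \<noteq> {}"
    and oct: "octagon (elements H) (incident G) \<delta>"
  shows "sub_gon 8 H G"
proof -
  have geo: "geometry G" using G by (simp add: weak_generalized_gon_def)
  have trans: "subgeometry A G" if "subgeometry A H" for A :: "('a, 'b) geometry"
    using that sub by (auto simp: subgeometry_def)
  have H: "geometry H" using sub by (auto simp: subgeometry_def geometry_def)
  have "\<exists>A. subgeometry A H \<and> ordinary_gon 8 A \<and> x \<in> elements A \<and> y \<in> elements A"
    if xy: "x \<in> elements H" "y \<in> elements H" for x y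
  proof -
    obtain B where B: "subgeometry B G" "ordinary_gon 8 B" "elements B \<subseteq> elements H"
      "x \<in> elements B" "y \<in> elements B"
      using octagon_ordinary_gon[OF geo oct xy] by blast
    have pl: "Points B \<subseteq> Points H" "Lines B \<subseteq> Lines H"
      using subsetD[OF B(3), of "Inl _"] subsetD[OF B(3), of "Inr _"] by auto
    have i: "Incid B = Incid G \<inter> (Points B \<times> Lines B)" "Incid H = Incid G \<inter> (Points H \<times> Lines H)"
      using B(1) sub by (simp_all add: subgeometry_def)
    have "Incid B = Incid H \<inter> (Points B \<times> Lines B)" unfolding i(2) by (subst i(1)) (use pl in blast)
    then have "subgeometry B H" using pl by (simp add: subgeometry_def)
    then show ?thesis using B(2,4,5) by blast
  qed
  moreover have "\<not> (\<exists>A. subgeometry A H \<and> ordinary_gon k A)" if "2 \<le> k" "k < 8" for k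
    using G trans that unfolding weak_generalized_gon_def by blast
  ultimately show ?thesis using sub H ne unfolding sub_gon_def weak_generalized_gon_def by simp
qed

lemma locally_finite_octagon:
  assumes G: "weak_generalized_gon 8 G" and lfg: "locally_finitely_generated 8 G"
  shows "octagon.locally_finite (elements G) (incident G) (gdist G)"
proof -
  interpret G: octagon "elements G" "incident G" "gdist G" by (rule weak_gon_octagon[OF G])
  have pts: "\<exists>a b. a \<noteq> b \<and> a \<in> Points G \<and> b \<in> Points G \<and> (a, M) \<in> Incid G \<and> (b, M) \<in> Incid G"
    if "M \<in> Lines G" for M
  proof -
    have "Inr M \<in> elements G" using that by simp
    from G.two_neighbours[OF this] obtain y z where yz: "y \<in> elements G" "z \<in> elements G"
      "incident G (Inr M) y" "incident G (Inr M) z" "y \<noteq> z" by blast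
    then show ?thesis by (cases y; cases z) auto
  qed
  then obtain pa pb where pab: "\<And>M. M \<in> Lines G \<Longrightarrow> pa M \<noteq> pb M \<and> pa M \<in> Points G \<and> pb M \<in> Points G \<and>
     (pa M, M) \<in> Incid G \<and> (pb M, M) \<in> Incid G" by metis
  show ?thesis
    unfolding G.locally_finite_def
  proof (intro allI impI)
    fix T :: "('a + 'b) set" assume T: "finite T \<and> T \<subseteq> elements G"
    \<comment> \<open>Generating sets consist of points, so each line of \<open>T\<close> is
      replaced by two of its points; it reappears as the projection of one onto the other.\<close>
    define S where "S = projl ` {x \<in> T. isl x} \<union> pa ` projr ` {x \<in> T. \<not> isl x} \<union> pb ` projr ` {x \<in> T. \<not> isl x}"
    have lin: "projr x \<in> Lines G" if "x \<in> T" "\<not> isl x" for x using that T by (cases x) auto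
    have poi: "projl x \<in> Points G" if "x \<in> T" "isl x" for x using that T by (cases x) auto
    have S: "finite S" "S \<subseteq> Points G" using T pab lin poi by (auto simp: S_def)
    define H where "H = generated 8 G S"
    have subH: "subgeometry H G" using generated_subgeometry(1)[OF G S(2)] by (simp add: H_def)
    have elH: "x \<in> elements H \<longleftrightarrow> (\<forall>A. sub_gon 8 A G \<and> S \<subseteq> Points A \<longrightarrow> x \<in> elements A)" for x
      using generated_subgeometry(2)[OF G S(2)] by (simp add: H_def)
    have TH: "T \<subseteq> elements H"
    proof
      fix x assume x: "x \<in> T"
      show "x \<in> elements H"
        unfolding elH
      proof (intro allI impI)
        fix A assume A: "sub_gon 8 A G \<and> S \<subseteq> Points A"
        show "x \<in> elements A"
        proof (cases x)
          case (Inl a)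
          then have "a \<in> S" using x by (force simp: S_def)
          then show ?thesis using A Inl by auto
        next
          case (Inr M)
          then have M: "pa M \<in> S" "pb M \<in> S" "M \<in> Lines G" using x T by (force simp: S_def)+
          let ?a = "Inl (pa M)" and ?b = "Inl (pb M)"
          have ab: "?a \<in> elements A" "?b \<in> elements A" using A M by auto
          have abG: "?a \<in> elements G" "?b \<in> elements G" "x \<in> elements G" using pab[OF M(3)] M(3) Inr
            by auto
          have n: "x \<in> G.nb ?a" "x \<in> G.nb ?b" "?b \<in> G.nb x" using pab[OF M(3)] M(3) Inr
            by (auto simp: G.nb_def)
          have d1: "gdist G ?a x = 1" by (rule G.dist_nb[OF abG(1) n(1)])
          have ne: "(?a :: 'a + 'b) \<noteq> ?b" using pab[OF M(3)] by auto
          have d2: "gdist G ?a ?b = 2"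
            using G.nb_step[OF abG(1,3) n(3)] d1 G.dist_0[OF abG(1,2)] ne by auto
          have "G.closer ?a ?b = x" by (rule G.closer_eq[OF abG(1,2) n(2)]) (use d1 d2 in auto)
          then show ?thesis using sub_gon_closed[OF G _ ab ne] A d2 by auto
        qed
      qed
    qed
    have closed: "G.closer x y \<in> elements H" if xy: "x \<in> elements H" "y \<in> elements H" "x \<noteq> y"
      "gdist G x y < 8" for x y
      unfolding elH
    proof (intro allI impI)
      fix A assume A: "sub_gon 8 A G \<and> S \<subseteq> Points A"
      then show "G.closer x y \<in> elements A" using sub_gon_closed[OF G _ _ _ xy(3,4)] xy(1,2) elH
        by blast
    qed
    have HG: "elements H \<subseteq> elements G" by (rule subgeometry_elements[OF subH])
    have fin: "finite (elements H)"
      if two: "\<forall>x\<in>elements H. \<exists>y\<in>elements H. \<exists>z\<in>elements H. incident G x y \<and> incident G x z \<and> y \<noteq> z"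
    proof (cases "elements H = {}")
      case False
      have "octagon (elements H) (incident G) (gdist G)"
        by (rule G.octagon_subset[OF HG closed]) (use two in blast)+
      then have "sub_gon 8 H G" by (rule octagon_sub_gon[OF G subH False])
      then have "finite (Points H) \<and> finite (Lines H)"
        using lfg S unfolding locally_finitely_generated_def H_def by blast
      then show ?thesis by (simp add: elements_def)
    qed simp
    show "\<exists>A. T \<subseteq> A \<and> A \<subseteq> elements G \<and> (\<forall>x\<in>A. \<forall>y\<in>A. x \<noteq> y \<and> gdist G x y < 8 \<longrightarrow> G.closer x y \<in> A) \<and>
       ((\<forall>x\<in>A. \<exists>y\<in>A. \<exists>z\<in>A. incident G x y \<and> incident G x z \<and> y \<noteq> z) \<longrightarrow> finite A)"
      by (intro exI[of _ "elements H"] conjI ballI impI) (use TH HG closed fin in blast)+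
  qed
qed

section \<open>Orders and labels of an ordinary octagon\<close>

lemma card_of_minus_one:
  assumes "b \<in> X" shows "|X| =o |X - {b}| +c cone"
proof -
  have "bij_betw (\<lambda>x. if x = b then Inr () else Inl x) X ((X - {b}) <+> {()})"
    using assms by (auto simp: bij_betw_def inj_on_def image_iff split: if_splits)
  then show ?thesis unfolding csum_def cone_def Field_card_of using card_of_ordIso by blast
qed

lemma card_of_minus_swap:
  assumes "b \<in> X" "c \<in> X" shows "|X - {b}| =o |X - {c}|"
proof -
  have "bij_betw (\<lambda>x. if x = c then b else x) (X - {b}) (X - {c})"
    using assms by (auto simp: bij_betw_def inj_on_def image_iff split: if_splits)
  then show ?thesis using card_of_ordIso by blast
qed

lemma csum_cone_bij:
  assumes "|X| =o s +c cone"
  obtains \<phi> where "bij_betw \<phi> X (Field s <+> {()})"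
  using assms unfolding csum_def cone_def Field_card_of card_of_ordIso[symmetric] by blast

text \<open>A bijection with the disjoint sum makes the field of \<open>s\<close> finite, so that
  one can be cancelled from \<open>s + 1 = 2\<close>.\<close>

lemma csum_cone_eq_2:
  assumes "|X| =o s +c cone" "Card_order s" "card X = 2"
  shows "s =o cone"
proof -
  obtain \<phi> where \<phi>: "bij_betw \<phi> X (Field s <+> {()})" using csum_cone_bij[OF assms(1)] by blast
  have "finite X" using assms(3) by (metis card.infinite zero_neq_numeral)
  then have "finite (Field s)" using \<phi> bij_betw_finite finite_PlusD(1) by blast
  moreover have "card (Field s <+> {()}) = 2" using bij_betw_same_card[OF \<phi>] assms(3) by simp
  ultimately have "card (Field s) = 1" by (simp add: card_Plus)
  then obtain x where x: "Field s = {x}" by (rule card_1_singletonE)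
  have "s =o |Field s|" using card_of_Field_ordIso[OF assms(2)] ordIso_symmetric by blast
  moreover have "|Field s| =o cone"
  proof -
    have "bij_betw (\<lambda>_. ()) (Field s) {()}" by (simp add: x bij_betw_def)
    then show ?thesis unfolding cone_def using card_of_ordIso by blast
  qed
  ultimately show ?thesis by (rule ordIso_transitive)
qed

lemma cone_csum_cone_eq_2:
  assumes "|X| =o cone +c cone" shows "card X = 2"
proof -
  obtain \<phi> where \<phi>: "bij_betw \<phi> X (Field cone <+> {()})" using csum_cone_bij[OF assms] by blast
  show ?thesis using bij_betw_same_card[OF \<phi>] by (simp add: cone_def Field_card_of card_Plus)
qed

lemma nb_geometry:
  assumes "octagon (elements G) (incident G) \<delta>"
  shows "octagon.nb (elements G) (incident G) (Inl x) = Inr ` lines_through G x"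
    and "octagon.nb (elements G) (incident G) (Inr M) = Inl ` points_on G M"
proof -
  interpret octagon "elements G" "incident G" \<delta> by (rule assms)
  have "y \<in> nb (Inl x) \<longleftrightarrow> y \<in> Inr ` lines_through G x" for y
    by (cases y) (auto simp: nb_def lines_through_def)
  then show "nb (Inl x) = Inr ` lines_through G x" by blast
  have "y \<in> nb (Inr M) \<longleftrightarrow> y \<in> Inl ` points_on G M" for y
    by (cases y) (auto simp: nb_def points_on_def)
  then show "nb (Inr M) = Inl ` points_on G M" by blast
qed

lemma at_least_three_image: "inj_on f A \<Longrightarrow> at_least_three A \<Longrightarrow> at_least_three (f ` A)"
  unfolding at_least_three_def by (metis card_image image_mono inj_on_subset)

lemma at_least_threeE:
  assumes "at_least_three A" obtains w where "w \<in> A" "w \<noteq> y" "w \<noteq> z"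
proof -
  obtain W where W: "W \<subseteq> A" "card W = 3" using assms by (auto simp: at_least_three_def)
  have "\<not> W \<subseteq> {y, z}"
  proof
    assume "W \<subseteq> {y, z}"
    then have "card W \<le> card {y, z}" by (intro card_mono) auto
    also have "\<dots> \<le> 2" by (simp add: card_insert_if)
    finally show False using W(2) by simp
  qed
  then show ?thesis using W(1) that by blast
qed

lemma thick_nb:
  assumes "thick_generalized_gon 8 G" "x \<in> elements G"
  shows "at_least_three (octagon.nb (elements G) (incident G) x)"
proof -
  have o: "octagon (elements G) (incident G) (gdist G)"
    by (rule weak_gon_octagon) (use assms(1) in \<open>simp add: thick_generalized_gon_def\<close>)
  show ?thesis
    using assms by (cases x) (auto simp: nb_geometry[OF o] thick_generalized_gon_def intro!: at_least_three_image)
qed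

lemma weak_gon_apartment:
  assumes "weak_generalized_gon n G" "x \<in> elements G" "y \<in> elements G"
  shows "\<exists>A. subgeometry A G \<and> ordinary_gon n A \<and> x \<in> elements A \<and> y \<in> elements A"
  using assms unfolding weak_generalized_gon_def by (elim conjE) (drule (1) bspec)+

lemma weak_gon_walk:
  assumes "weak_generalized_gon n G" "x \<in> elements G" "y \<in> elements G"
  shows "(incident G ^^ gdist G x y) x y"
proof -
  obtain A where A: "subgeometry A G" "ordinary_gon n A" "x \<in> elements A" "y \<in> elements A"
    using weak_gon_apartment[OF assms] by blast
  then have geo: "geometry A" by (simp add: ordinary_gon_def)
  obtain k where "(incident A ^^ k) x y" using ordinary_gon_walk[OF A(2-4)] by blast
  then have "(incident G ^^ k) x y" by (rule subgeometry_walk[OF A(1) geo])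
  then show ?thesis by (rule gdist_walk)
qed

text \<open>The cardinals are realised by a line without one of its points and a pencil without one
  of its lines, hence on the types that \<open>class_a\<close> prescribes. Bijections of
  neighbourhoods cover infinite orders.\<close>

lemma thick_has_order:
  fixes G :: "('p, 'l) geometry"
  assumes thick: "thick_generalized_gon 8 G"
    and L: "L \<in> Lines G" "b \<in> points_on G L" and x: "x \<in> Points G" "N \<in> lines_through G x"
  shows "has_order G ( |points_on G L - {b}| ) ( |lines_through G x - {N}| )"
proof -
  have w: "weak_generalized_gon 8 G" using thick by (simp add: thick_generalized_gon_def)
  have o: "octagon (elements G) (incident G) (gdist G)" by (rule weak_gon_octagon[OF w])
  interpret octagon "elements G" "incident G" "gdist G" by (rule o)
  have three: "\<exists>w\<in>nb u. w \<noteq> y \<and> w \<noteq> z" if "u \<in> elements G" for u y z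
    using at_least_threeE[OF thick_nb[OF thick that]] by metis
  have bij: "\<exists>f. bij_betw f (nb u) (nb v)" if "u \<in> elements G" "v \<in> elements G" "isl u = isl v"
    for u v
    using thick_bij[OF three that(1,2)] walk_isl[OF weak_gon_walk[OF w that(1,2)]] that(3) by blast
  have lines: "|points_on G M| =o |points_on G L|" if M: "M \<in> Lines G" for M
  proof -
    have "bij_betw Inl (points_on G M) (nb (Inr M))" "bij_betw Inl (points_on G L) (nb (Inr L))"
      by (simp_all add: nb_geometry[OF o] bij_betw_def)
    moreover obtain f where "bij_betw f (nb (Inr M)) (nb (Inr L))" using bij[of "Inr M"
      "Inr L"] M L(1) by auto
    ultimately show ?thesis unfolding card_of_ordIso[symmetric]
      by (meson bij_betw_inv bij_betw_trans)
  qed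
  have points: "|lines_through G y| =o |lines_through G x|" if y: "y \<in> Points G" for y
  proof -
    have "bij_betw Inr (lines_through G y) (nb (Inl y))"
      "bij_betw Inr (lines_through G x) (nb (Inl x))"
      by (simp_all add: nb_geometry[OF o] bij_betw_def)
    moreover obtain f where "bij_betw f (nb (Inl y)) (nb (Inl x))" using bij[of "Inl y"
      "Inl x"] y x(1) by auto
    ultimately show ?thesis unfolding card_of_ordIso[symmetric]
      by (meson bij_betw_inv bij_betw_trans)
  qed
  show ?thesis
    unfolding has_order_def
    by (intro conjI ballI card_of_Card_order ordIso_transitive[OF lines card_of_minus_one[OF L(2)]]
      ordIso_transitive[OF points card_of_minus_one[OF x(2)]])
qed

definition octagon_labels :: "('q, 'm) geometry \<Rightarrow> (nat \<Rightarrow> 'q) \<Rightarrow> (nat \<Rightarrow> 'm) \<Rightarrow> bool" where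
  "octagon_labels G p l \<longleftrightarrow> geometry G \<and> bij_betw p {..<8} (Points G) \<and> bij_betw l {..<8} (Lines G) \<and>
     (\<forall>i<8. \<forall>j<8. (p i, l j) \<in> Incid G \<longleftrightarrow> i = j \<or> i = (j + 1) mod 8)"

text \<open>The cycle is rotated so that a prescribed line, later the one with a singleton fibre,
  gets label 0.\<close>

lemma ordinary_octagon_labels:
  assumes "ordinary_gon 8 G" "m \<in> Lines G"
  obtains p l where "octagon_labels G p l" "l 0 = m"
proof -
  obtain p l where geo: "geometry G" and p: "bij_betw p {..<8::nat} (Points G)" and l:
    "bij_betw l {..<8::nat} (Lines G)"
    and inc: "\<And>i j. i < 8 \<Longrightarrow> j < 8 \<Longrightarrow> (p i, l j) \<in> Incid G \<longleftrightarrow> i = j \<or> i = (j + 1) mod 8"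
    using assms(1) unfolding ordinary_gon_def by blast
  have "m \<in> l ` {..<8}" using assms(2) l by (simp add: bij_betw_def)
  then obtain k where k: "k < 8" "m = l k" by auto
  have rot: "bij_betw (\<lambda>i. (i + k) mod 8) {..<8} {..<8}"
  proof -
    have inj: "inj_on (\<lambda>i. (i + k) mod 8) {..<8}"
    proof (rule inj_onI)
      fix i j assume "i \<in> {..<8::nat}" "j \<in> {..<8::nat}" "(i + k) mod 8 = (j + k) mod 8"
      then have ij: "i < 8" "j < 8" "(i + k) mod 8 = (j + k) mod 8" by auto
      \<comment> \<open>Adding \<open>7 * k\<close> undoes the shift by \<open>k\<close> modulo
        8.\<close>
      have "(i + k + 7 * k) mod 8 = (j + k + 7 * k) mod 8" by (rule mod_add_cong[OF ij(3) refl])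
      moreover have "n + k + 7 * k = n + k * 8" for n by simp
      ultimately show "i = j" using ij(1,2) by simp
    qed
    moreover have "(\<lambda>i. (i + k) mod 8) ` {..<8} = {..<8}" by (rule endo_inj_surj[OF _ _ inj]) auto
    ultimately show ?thesis by (simp add: bij_betw_def)
  qed
  have "octagon_labels G (p \<circ> (\<lambda>i. (i + k) mod 8)) (l \<circ> (\<lambda>i. (i + k) mod 8))"
    unfolding octagon_labels_def
  proof (intro conjI allI impI)
    show "bij_betw (p \<circ> (\<lambda>i. (i + k) mod 8)) {..<8} (Points G)" by (rule bij_betw_trans[OF rot p])
    show "bij_betw (l \<circ> (\<lambda>i. (i + k) mod 8)) {..<8} (Lines G)" by (rule bij_betw_trans[OF rot l])
    fix i j :: nat assume ij: "i < 8" "j < 8"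
    have "((i + k) mod 8 = (j + k) mod 8 \<or> (i + k) mod 8 = ((j + k) mod 8 + 1) mod 8) \<longleftrightarrow> i = j \<or>
      i = (j + 1) mod 8"
    proof -
      have r: "(m + k) mod 8 = (n + k) mod 8 \<longleftrightarrow> m = n" if "m < 8" "n < 8" for m n
        using inj_on_eq_iff[OF bij_betw_imp_inj_on[OF rot]] that by simp
      have "((j + k) mod 8 + 1) mod 8 = ((j + 1) mod 8 + k) mod 8" by presburger
      then show ?thesis using r[OF ij] r[OF ij(1), of "(j + 1) mod 8"] by simp
    qed
    then show "((p \<circ> (\<lambda>i. (i + k) mod 8)) i, (l \<circ> (\<lambda>i. (i + k) mod 8)) j) \<in> Incid G \<longleftrightarrow> i = j \<or>
      i = (j + 1) mod 8"
      using inc[of "(i + k) mod 8" "(j + k) mod 8"] by simp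
  qed (rule geo)
  moreover have "(l \<circ> (\<lambda>i. (i + k) mod 8)) 0 = m" using k by simp
  ultimately show ?thesis using that by blast
qed

context
  fixes G :: "('q, 'm) geometry" and p l
  assumes labels: "octagon_labels G p l"
begin

lemma label_incid: "i < 8 \<Longrightarrow> j < 8 \<Longrightarrow> (p i, l j) \<in> Incid G \<longleftrightarrow> i = j \<or> i = (j + 1) mod 8"
  using labels by (simp add: octagon_labels_def)

lemma label_point: "x \<in> Points G \<Longrightarrow> \<exists>i<8. x = p i" and label_line: "M \<in> Lines G \<Longrightarrow> \<exists>i<8. M = l i"
  using labels by (auto simp: octagon_labels_def bij_betw_def)

lemma label_inj: "i < 8 \<Longrightarrow> j < 8 \<Longrightarrow> p i = p j \<longleftrightarrow> i = j" "i < 8 \<Longrightarrow> j < 8 \<Longrightarrow> l i = l j \<longleftrightarrow> i = j"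
  using labels by (auto simp: octagon_labels_def bij_betw_def inj_on_eq_iff)

lemma label_in: "i < 8 \<Longrightarrow> p i \<in> Points G" "i < 8 \<Longrightarrow> l i \<in> Lines G"
  using labels by (auto simp: octagon_labels_def bij_betw_def)

lemma joining_label:
  assumes "i < 8" "j < 8" "j = (i + 1) mod 8"
  shows "joining_line G (p i) (p j) = l i" "joining_line G (p j) (p i) = l i"
    "collinear G (p i) (p j)"
proof -
  have on: "(p i, l i) \<in> Incid G" "(p j, l i) \<in> Incid G" using assms label_incid by auto
  have uniq: "M = l i" if M: "M \<in> Lines G" "(p i, M) \<in> Incid G" "(p j, M) \<in> Incid G" for M
  proof -
    obtain k where k: "k < 8" "M = l k" using label_line[OF M(1)] by blast
    then have "i = k \<or> i = (k + 1) mod 8" "j = k \<or> j = (k + 1) mod 8" using M label_incid assms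
      by auto
    moreover have "(n + 1) mod 8 = (if n = 7 then 0 else n + 1)" if "n < 8" for n :: nat
      using that by auto
    ultimately have "k = i" using assms k(1) by (auto split: if_splits)
    then show ?thesis using k by simp
  qed
  show "joining_line G (p i) (p j) = l i" "joining_line G (p j) (p i) = l i"
    unfolding joining_line_def by (rule the_equality; use on uniq label_in assms in blast)+
  have "i \<noteq> j" using assms by (cases "i = 7") auto
  then show "collinear G (p i) (p j)"
    using on label_in label_inj assms by (auto simp: collinear_def)
qed

end

section \<open>The two classes\<close>

text \<open>Position on the cycle of length 16: \<open>p i\<close> lies between
  \<open>l (i - 1)\<close> and \<open>l i\<close>, indices modulo 8, so points get odd and lines
  even values.\<close>

definition label_pos :: "(nat \<Rightarrow> 'q) \<Rightarrow> (nat \<Rightarrow> 'm) \<Rightarrow> 'q + 'm \<Rightarrow> int" where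
  "label_pos p l = case_sum (\<lambda>x. 2 * int (the_inv_into {..<8} p x) - 1) (\<lambda>M. 2 * int (the_inv_into {..<8} l M))"

lemma label_pos_simps:
  assumes "octagon_labels G p l" "i < 8"
  shows "label_pos p l (Inl (p i)) = 2 * int i - 1" "label_pos p l (Inr (l i)) = 2 * int i"
  using assms by (auto simp: label_pos_def octagon_labels_def bij_betw_def the_inv_into_f_f)

locale octagon_onto_ordinary =
  octagon "elements S" "incident S" "gdist S"
  for S :: "('p, 'l) geometry" +
  fixes G :: "('q, 'm) geometry" and f g p l
  assumes geoS: "geometry S" and labels: "octagon_labels G p l" and epi: "epimorphism S G f g"
begin

lemma f_point: "x \<in> Points S \<Longrightarrow> \<exists>i<8. f x = p i" and g_line: "M \<in> Lines S \<Longrightarrow> \<exists>i<8. g M = l i"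
  using epi label_point[OF labels, of "f x"] label_line[OF labels, of "g M"]
    unfolding epimorphism_def by blast+

lemma f_onto: "i < 8 \<Longrightarrow> \<exists>x\<in>Points S. f x = p i" and g_onto: "i < 8 \<Longrightarrow> \<exists>M\<in>Lines S. g M = l i"
proof -
  assume "i < 8"
  then have "p i \<in> f ` Points S" "l i \<in> g ` Lines S"
    using epi label_in[OF labels] by (auto simp: epimorphism_def)
  then show "\<exists>x\<in>Points S. f x = p i" "\<exists>M\<in>Lines S. g M = l i" by (metis imageE)+
qed

lemma incid_index:
  assumes "(x, M) \<in> Incid S" "f x = p i" "g M = l j" "i < 8" "j < 8"
  shows "i = j \<or> i = (j + 1) mod 8"
  using assms epi label_incid[OF labels, of i j] by (force simp: epimorphism_def morphism_def)

definition \<psi> :: "'p + 'l \<Rightarrow> int" where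
  "\<psi> = label_pos p l \<circ> map_sum f g"

lemma \<psi>_simps:
  "f x = p i \<Longrightarrow> i < 8 \<Longrightarrow> \<psi> (Inl x) = 2 * int i - 1" "g M = l i \<Longrightarrow> i < 8 \<Longrightarrow> \<psi> (Inr M) = 2 * int i"
  using label_pos_simps[OF labels] by (simp_all add: \<psi>_def)

lemma \<psi>_step:
  assumes "(x, M) \<in> Incid S"
  shows "16 dvd \<psi> (Inr M) - \<psi> (Inl x) - 1 \<or> 16 dvd \<psi> (Inr M) - \<psi> (Inl x) + 1"
proof -
  have "x \<in> Points S" "M \<in> Lines S" using assms geoS by (auto simp: geometry_def)
  then obtain i j where ij: "i < 8" "f x = p i" "j < 8" "g M = l j" using f_point g_line by blast
  have "i = j \<or> i = (j + 1) mod 8" using incid_index[OF assms] ij by blast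
  then show ?thesis using ij by (cases "j = 7") (auto simp: \<psi>_simps)
qed

sublocale octagon_map "elements S" "incident S" "gdist S" \<psi>
proof
  fix x y assume xy: "x \<in> elements S" "y \<in> elements S" "incident S x y"
  show "16 dvd \<psi> y - \<psi> x - 1 \<or> 16 dvd \<psi> y - \<psi> x + 1"
  proof (cases x; cases y)
    fix a M assume "x = Inl a" "y = Inr M"
    then show ?thesis using \<psi>_step[of a M] xy(3) by simp
  next
    fix a M assume "x = Inr M" "y = Inl a"
    moreover have "16 dvd z - w - 1 \<or> 16 dvd z - w + 1 \<Longrightarrow> 16 dvd w - z - 1 \<or> 16 dvd w - z + 1"
      for w z :: int
      by presburger
    ultimately show ?thesis using \<psi>_step[of a M] xy(3) by simp
  qed (use xy in auto)
next
  fix i :: int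
  \<comment> \<open>One index serves both parities: \<open>i\<close> is congruent to
    \<open>2 * n - 1\<close> or to \<open>2 * n\<close>.\<close>
  define n where "n = nat ((i + 1) div 2 mod 8)"
  have n: "n < 8" "int n = (i + 1) div 2 mod 8" by (auto simp: n_def nat_less_iff)
  obtain x where x: "x \<in> Points S" "f x = p n" using f_onto[OF n(1)] by blast
  obtain M where M: "M \<in> Lines S" "g M = l n" using g_onto[OF n(1)] by blast
  have "16 dvd 2 * ((i + 1) div 2 mod 8) - 1 - i \<or> 16 dvd 2 * ((i + 1) div 2 mod 8) - i"
    by presburger
  then have "16 dvd \<psi> (Inl x) - i \<or> 16 dvd \<psi> (Inr M) - i"
    using \<psi>_simps(1)[OF x(2) n(1)] \<psi>_simps(2)[OF M(2) n(1)] n(2) by simp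
  then show "\<exists>x\<in>elements S. 16 dvd \<psi> x - i" using x(1) M(1) by (metis Inl_elements Inr_elements)
qed

definition F :: "nat \<Rightarrow> 'p set" where "F i = point_fibre S f (p i)"
definition K :: "nat \<Rightarrow> 'l set" where "K i = {M \<in> Lines S. g M = l i}"

lemma fib_F: "i < 8 \<Longrightarrow> fib (2 * int i - 1) = Inl ` F i" and fib_K:
  "i < 8 \<Longrightarrow> fib (2 * int i) = Inr ` K i"
proof -
  assume i: "i < 8"
  have P: "16 dvd \<psi> (Inl x) - (2 * int i - 1) \<longleftrightarrow> f x = p i" and P': "\<not> 16 dvd \<psi> (Inl x) - 2 * int i"
    if x: "x \<in> Points S" for x
  proof -
    obtain j where j: "j < 8" "f x = p j" using f_point[OF x] by blast
    have "16 dvd 2 * int j - 1 - (2 * int i - 1) \<longleftrightarrow> j = i" using i j(1) by presburger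
    then show "16 dvd \<psi> (Inl x) - (2 * int i - 1) \<longleftrightarrow> f x = p i"
      using \<psi>_simps(1)[OF j(2,1)] label_inj(1)[OF labels j(1) i] j(2) by simp
    have "\<not> 16 dvd 2 * int j - 1 - 2 * int i" by presburger
    then show "\<not> 16 dvd \<psi> (Inl x) - 2 * int i" using \<psi>_simps(1)[OF j(2,1)] by simp
  qed
  have Q: "16 dvd \<psi> (Inr M) - 2 * int i \<longleftrightarrow> g M = l i" and Q': "\<not> 16 dvd \<psi> (Inr M) - (2 * int i - 1)"
    if M: "M \<in> Lines S" for M
  proof -
    obtain j where j: "j < 8" "g M = l j" using g_line[OF M] by blast
    have "16 dvd 2 * int j - 2 * int i \<longleftrightarrow> j = i" using i j(1) by presburger
    then show "16 dvd \<psi> (Inr M) - 2 * int i \<longleftrightarrow> g M = l i"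
      using \<psi>_simps(2)[OF j(2,1)] label_inj(2)[OF labels j(1) i] j(2) by simp
    have "\<not> 16 dvd 2 * int j - (2 * int i - 1)" by presburger
    then show "\<not> 16 dvd \<psi> (Inr M) - (2 * int i - 1)" using \<psi>_simps(2)[OF j(2,1)] by simp
  qed
  have "y \<in> fib (2 * int i - 1) \<longleftrightarrow> y \<in> Inl ` F i" for y
    using P Q' by (cases y) (auto simp: fib_def F_def point_fibre_def)
  then show "fib (2 * int i - 1) = Inl ` F i" by blast
  have "y \<in> fib (2 * int i) \<longleftrightarrow> y \<in> Inr ` K i" for y
    using Q P' by (cases y) (auto simp: fib_def K_def)
  then show "fib (2 * int i) = Inr ` K i" by blast
qed

lemma lift_line:
  assumes "i < 8" "x \<in> F i"
  shows "\<exists>M\<in>K i. (x, M) \<in> Incid S" "j < 8 \<Longrightarrow> i = (j + 1) mod 8 \<Longrightarrow> \<exists>M\<in>K j. (x, M) \<in> Incid S"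
proof -
  have x: "Inl x \<in> fib (2 * int i - 1)" using fib_F assms by blast
  then have xV: "Inl x \<in> elements S" using fibD by blast
  obtain y where "y \<in> nb (Inl x)" "y \<in> fib (2 * int i)"
    using up_nonempty[OF xV] up_fib[OF x] by auto
  then show "\<exists>M\<in>K i. (x, M) \<in> Incid S" using fib_K[OF assms(1)] by (auto simp: nb_def)
  assume j: "j < 8" "i = (j + 1) mod 8"
  obtain y where y: "y \<in> nb (Inl x)" "y \<in> fib (2 * int i - 1 - 1)"
    using dn_nonempty[OF xV] dn_fib[OF x] by auto
  have "16 dvd (2 * int i - 1 - 1) - 2 * int j" using j by (cases "j = 7") auto
  then have "y \<in> Inr ` K j" using y(2) fib_cong fib_K[OF j(1)] by blast
  then show "\<exists>M\<in>K j. (x, M) \<in> Incid S" using y(1) by (auto simp: nb_def)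
qed

lemma lift_point:
  assumes "i < 8" "M \<in> K i"
  shows "\<exists>x\<in>F i. (x, M) \<in> Incid S" "j < 8 \<Longrightarrow> j = (i + 1) mod 8 \<Longrightarrow> \<exists>x\<in>F j. (x, M) \<in> Incid S"
proof -
  have M: "Inr M \<in> fib (2 * int i)" using fib_K assms by blast
  then have MV: "Inr M \<in> elements S" using fibD by blast
  obtain y where "y \<in> nb (Inr M)" "y \<in> fib (2 * int i - 1)"
    using dn_nonempty[OF MV] dn_fib[OF M] by auto
  then show "\<exists>x\<in>F i. (x, M) \<in> Incid S" using fib_F[OF assms(1)] by (auto simp: nb_def)
  assume j: "j < 8" "j = (i + 1) mod 8"
  obtain y where y: "y \<in> nb (Inr M)" "y \<in> fib (2 * int i + 1)"
    using up_nonempty[OF MV] up_fib[OF M] by auto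
  have "16 dvd (2 * int i + 1) - (2 * int j - 1)" using j assms(1) by (cases "i = 7") auto
  then have "y \<in> Inl ` F j" using y(2) fib_cong fib_F[OF j(1)] by blast
  then show "\<exists>x\<in>F j. (x, M) \<in> Incid S" using y(1) by (auto simp: nb_def)
qed

lemma F_disjoint: "\<lbrakk>i < 8; j < 8; x \<in> F i; x \<in> F j\<rbrakk> \<Longrightarrow> i = j"
  and K_disjoint: "\<lbrakk>i < 8; j < 8; M \<in> K i; M \<in> K j\<rbrakk> \<Longrightarrow> i = j"
  using label_inj[OF labels, of i j] by (auto simp: F_def K_def point_fibre_def)

lemma F_points: "x \<in> F i \<Longrightarrow> x \<in> Points S" and K_lines: "M \<in> K i \<Longrightarrow> M \<in> Lines S"
  by (auto simp: F_def K_def point_fibre_def)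

lemma incid_line:
  assumes "(x, M) \<in> Incid S" "x \<in> F i" "i < 8" "h < 8" "i = (h + 1) mod 8"
  shows "M \<in> K i \<or> M \<in> K h"
proof -
  have M: "M \<in> Lines S" using assms geoS by (auto simp: geometry_def)
  obtain k where k: "k < 8" "g M = l k" using g_line[OF M] by blast
  have "i = k \<or> i = (k + 1) mod 8" using incid_index[OF assms(1) _ k(2) assms(3) k(1)] assms(2)
    by (simp add: F_def point_fibre_def)
  then have "k = i \<or> k = h" using k(1) assms(4,5) by (cases "k = 7"; cases "h = 7") auto
  then show ?thesis using k M by (auto simp: K_def)
qed

lemma incid_point:
  assumes "(x, M) \<in> Incid S" "M \<in> K i" "i < 8" "j = (i + 1) mod 8"
  shows "x \<in> F i \<or> x \<in> F j"
proof -
  have x: "x \<in> Points S" using assms geoS by (auto simp: geometry_def)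
  obtain k where k: "k < 8" "f x = p k" using f_point[OF x] by blast
  have "k = i \<or> k = (i + 1) mod 8" using incid_index[OF assms(1) k(2) _ k(1) assms(3)] assms(2)
    by (simp add: K_def)
  then show ?thesis using k x assms(4) by (auto simp: F_def point_fibre_def)
qed

text \<open>The recursive identities of class (a) hold for every epimorphism onto an ordinary
  octagon, since incidences lift along the cycle in both directions. What distinguishes class (a) is
  the single line over one edge.\<close>

lemma neighbours:
  assumes i: "i < 8" and h: "h < 8" "i = (h + 1) mod 8" and j: "j < 8" "j = (i + 1) mod 8"
  shows "F j = collinear_with_some S (F i) - (F h \<union> F i)"
    "F h = collinear_with_some S (F i) - (F i \<union> F j)"
    "K i = lines_meeting S (F i) - K h" "K h = lines_meeting S (F i) - K i"
proof -
  have ne: "i \<noteq> h" "i \<noteq> j" "h \<noteq> j" using i h j by (cases "h = 7"; cases "i = 7"; auto)+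
  have near: "y \<in> F h \<or> y \<in> F i \<or> y \<in> F j" if "collinear S y x" "x \<in> F i" for x y
  proof -
    obtain M where M: "(y, M) \<in> Incid S" "(x, M) \<in> Incid S" using \<open>collinear S y x\<close>
      by (auto simp: collinear_def)
    then show ?thesis
      using incid_line[OF M(2) \<open>x \<in> F i\<close> i h] incid_point[OF M(1) _ i j(2)] incid_point[OF M(1) _ h]
        by blast
  qed
  have col: "collinear S y x" if "(y, M) \<in> Incid S" "(x, M) \<in> Incid S" "y \<in> F m" "x \<in> F i" "m < 8"
    "m \<noteq> i" for x y M m
    using that F_disjoint[OF that(5) i that(3)] geoS by (auto simp: collinear_def geometry_def)
  have j1: "y \<in> collinear_with_some S (F i)" if y: "y \<in> F j" for y
  proof -
    obtain M where M: "M \<in> K i" "(y, M) \<in> Incid S" using lift_line(2)[OF j(1) y i j(2)] by blast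
    obtain x where "x \<in> F i" "(x, M) \<in> Incid S" using lift_point(1)[OF i M(1)] by blast
    then show ?thesis using col[OF M(2) _ y _ j(1)] ne F_points[OF y]
      by (auto simp: collinear_with_some_def)
  qed
  have h1: "y \<in> collinear_with_some S (F i)" if y: "y \<in> F h" for y
  proof -
    obtain M where M: "M \<in> K h" "(y, M) \<in> Incid S" using lift_line(1)[OF h(1) y] by blast
    obtain x where "x \<in> F i" "(x, M) \<in> Incid S" using lift_point(2)[OF h(1) M(1) i h(2)] by blast
    then show ?thesis using col[OF M(2) _ y _ h(1)] ne F_points[OF y]
      by (auto simp: collinear_with_some_def)
  qed
  show "F j = collinear_with_some S (F i) - (F h \<union> F i)"
    "F h = collinear_with_some S (F i) - (F i \<union> F j)"
    using near j1 h1 F_disjoint[OF i j(1)] F_disjoint[OF h(1) j(1)] F_disjoint[OF i h(1)] ne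
    by (auto simp: collinear_with_some_def)
  show "K i = lines_meeting S (F i) - K h" "K h = lines_meeting S (F i) - K i"
    using lift_point(1)[OF i] lift_point(2)[OF h(1) _ i h(2)] incid_line[OF _ _ i h] K_disjoint[OF i h(1)] ne K_lines
    by (auto simp: lines_meeting_def)
qed

lemma class_a_if_singleton:
  assumes thick: "thick_generalized_gon 8 S" and L: "K 0 = {L}"
  shows "class_a S G f g"
proof -
  have LS: "L \<in> Lines S" using L K_lines by blast
  have on: "points_on S L = F 1 \<union> F 0"
  proof
    show "points_on S L \<subseteq> F 1 \<union> F 0"
      using incid_point[of _ L 0 1] L by (auto simp: points_on_def)
    have "(x, L) \<in> Incid S" if "x \<in> F 0 \<or> x \<in> F 1" for x
      using lift_line(1)[of 0 x] lift_line(2)[of 1 x 0] that L by auto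
    then show "F 1 \<union> F 0 \<subseteq> points_on S L" using F_points by (auto simp: points_on_def)
  qed
  obtain b c where bc: "b \<in> F 0" "c \<in> F 1" using lift_point(1)[of 0 L] lift_point(2)[of 0 L 1] L
    by auto
  have disj: "F 1 \<inter> F 0 = {}" using F_disjoint[of 0 1] by auto
  have bcL: "b \<in> points_on S L" "c \<in> points_on S L" using bc on by auto
  have bS: "b \<in> Points S" "L \<in> lines_through S b" using bcL LS
    by (auto simp: points_on_def lines_through_def)
  define u where "u = card_of (points_on S L - {b})"
  have ord: "has_order S u (card_of (lines_through S b - {L}))"
    unfolding u_def by (rule thick_has_order[OF thick LS bcL(1) bS])
  \<comment> \<open>\<open>F 1\<close> misses \<open>b\<close>. For \<open>F 0\<close>, which
    contains \<open>b\<close>, the point \<open>c\<close> is removed instead and the two cardinals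
    are compared.\<close>
  have Cu: "card_of (F 1) \<le>o u" unfolding u_def using on disj bc by (intro card_of_mono1) auto
  have "card_of (F 0) \<le>o card_of (points_on S L - {c})" using on disj bc
    by (intro card_of_mono1) auto
  also have "card_of (points_on S L - {c}) =o u" unfolding u_def
    by (rule card_of_minus_swap[OF bcL(2,1)])
  finally have Bu: "card_of (F 0) \<le>o u" .
  have one: "cone \<le>o card_of X" if ne: "X \<noteq> {}" for X :: "'p set"
  proof -
    obtain x where "x \<in> X" using ne by blast
    then have "inj_on (\<lambda>_. x) {()} \<and> (\<lambda>_. x) ` {()} \<subseteq> X" by auto
    then show ?thesis unfolding cone_def using card_of_ordLeq by blast
  qed
  note j = joining_label[OF labels]
  have jl: "joining_line G (p 1) (p 0) = l 0" "joining_line G (p 1) (p 2) = l 1"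
    "joining_line G (p 7) (p 0) = l 7"
    "joining_line G (p 2) (p 3) = l 2" "joining_line G (p 2) (p 1) = l 1"
    "joining_line G (p 7) (p 6) = l 6"
    "joining_line G (p 3) (p 4) = l 3" "joining_line G (p 5) (p 6) = l 5"
    "joining_line G (p 5) (p 4) = l 4"
    "joining_line G (p 6) (p 5) = l 5"
    by (rule j(1) j(2); simp; fail)+
  have cl: "collinear G (p 7) (p 0)" "collinear G (p 0) (p 1)" "collinear G (p 1) (p 2)"
    "collinear G (p 2) (p 3)"
    "collinear G (p 3) (p 4)" "collinear G (p 4) (p 5)" "collinear G (p 5) (p 6)"
    "collinear G (p 6) (p 7)"
    by (rule j(3); simp)+
  have lf: "line_fibre S G g (p 1) (p 0) = K 0" "line_fibre S G g (p 1) (p 2) = K 1"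
    "line_fibre S G g (p 7) (p 0) = K 7"
    "line_fibre S G g (p 2) (p 3) = K 2" "line_fibre S G g (p 2) (p 1) = K 1"
    "line_fibre S G g (p 7) (p 6) = K 6"
    "line_fibre S G g (p 3) (p 4) = K 3" "line_fibre S G g (p 5) (p 6) = K 5"
    "line_fibre S G g (p 5) (p 4) = K 4"
    "line_fibre S G g (p 6) (p 5) = K 5"
    unfolding line_fibre_def K_def jl by (rule refl)+
  have n: "F 2 = collinear_with_some S (F 1) - (F 0 \<union> F 1)" "K 1 = lines_meeting S (F 1) - K 0"
    "F 7 = collinear_with_some S (F 0) - (F 0 \<union> F 1)" "K 7 = lines_meeting S (F 0) - K 0"
    "F 3 = collinear_with_some S (F 2) - (F 1 \<union> F 2)" "K 2 = lines_meeting S (F 2) - K 1"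
    "F 6 = collinear_with_some S (F 7) - (F 7 \<union> F 0)" "K 6 = lines_meeting S (F 7) - K 7"
    "F 4 = collinear_with_some S (F 3) - (F 2 \<union> F 3)" "K 3 = lines_meeting S (F 3) - K 2"
    "F 5 = collinear_with_some S (F 6) - (F 6 \<union> F 7)" "K 5 = lines_meeting S (F 6) - K 6"
    "K 4 = lines_meeting S (F 5) - K 5" "K 4 = lines_meeting S (F 4) - K 3"
    by (rule neighbours[of 1 0 2] neighbours[of 0 7 1] neighbours[of 2 1 3] neighbours[of 7 6 0]
      neighbours[of 3 2 4] neighbours[of 6 5 7] neighbours[of 5 4 6] neighbours[of 4 3 5]; simp)+
  have e8: "{..<8::nat} = {7, 0, 1, 2, 3, 4, 5, 6}"
    by (simp add: lessThan_nat_numeral lessThan_Suc insert_commute)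
  have pts: "Points G = {p 7, p 0, p 1, p 2, p 3, p 4, p 5, p 6}"
    using labels unfolding octagon_labels_def bij_betw_def e8 by auto
  have dist: "distinct [p 7, p 0, p 1, p 2, p 3, p 4, p 5, p 6]" by (simp add: label_inj[OF labels])
  note F = F_def[symmetric]
  show ?thesis
    unfolding class_a_def Let_def
  \<comment> \<open>The line \<open>l 0\<close> joins \<open>p 0\<close> and \<open>p 1\<close>,
    which play \<open>b\<close> and \<open>c\<close>; hence \<open>p 7\<close> is \<open>a\<close>,
    and \<open>p 2\<close> to \<open>p 6\<close> are \<open>d\<close> to \<open>h\<close>.\<close>
  proof (rule exI[of _ u], rule exI[of _ "card_of (lines_through S b - {L})"], rule exI[of _
    "p 7"], rule exI[of _ "p 0"],
      rule exI[of _ "p 1"], rule exI[of _ "p 2"], rule exI[of _ "p 3"], rule exI[of _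
        "p 4"], rule exI[of _ "p 5"],
      rule exI[of _ "p 6"], unfold F lf, intro conjI bexI[of _ L])
    show "F 1 \<union> F 0 = points_on S L" "F 1 \<inter> F 0 = {}" using on disj by auto
    show "cone \<le>o card_of (F 1)" "cone \<le>o card_of (F 0)" using one bc by blast+
    show "card_of (F 1) \<le>o u" "card_of (F 0) \<le>o u" by (rule Cu Bu)+
    show "F 2 = collinear_with_some S (F 1) - points_on S L"
      "F 7 = collinear_with_some S (F 0) - points_on S L"
      unfolding on using n(1,3) by blast+
    show "F 5 = collinear_with_some S (F 6) - (F 7 \<union> F 6)" using n(11) by blast
    show "K 1 = lines_meeting S (F 1) - {L}" "K 7 = lines_meeting S (F 0) - {L}" using n(2,4) L
      by simp_all
  qed (rule ord dist pts cl n L LS)+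
qed

end

theorem class_a_of_line_fibre:
  assumes thick: "thick_generalized_gon 8 S" and G: "ordinary_gon 8 G" and epi:
    "epimorphism S G f g"
    and m: "{M \<in> Lines S. g M = m} = {L}"
  shows "class_a S G f g"
proof -
  have w: "weak_generalized_gon 8 S" using thick by (simp add: thick_generalized_gon_def)
  have "L \<in> Lines S" "g L = m" using m by auto
  then have "m \<in> Lines G" using epi by (auto simp: epimorphism_def)
  then obtain p l where pl: "octagon_labels G p l" "l 0 = m" by (rule ordinary_octagon_labels[OF G])
  interpret octagon "elements S" "incident S" "gdist S" by (rule weak_gon_octagon[OF w])
  interpret octagon_onto_ordinary S G f g p l
    by unfold_locales (use w pl epi in \<open>simp_all add: weak_generalized_gon_def\<close>)
  show ?thesis by (rule class_a_if_singleton[OF thick]) (use m pl in \<open>simp add: K_def\<close>)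
qed

section \<open>Duality and the existence of both classes\<close>

lemma dual_simps [simp]:
  "Points (dual G) = Lines G" "Lines (dual G) = Points G"
  "(M, x) \<in> Incid (dual G) \<longleftrightarrow> (x, M) \<in> Incid G"
  "dual (dual G) = G"
  by (simp_all add: dual_def)

lemma geometry_dual: "geometry G \<Longrightarrow> geometry (dual G)"
  by (auto simp: geometry_def dual_def)

lemma subgeometry_dual: "subgeometry A G \<Longrightarrow> subgeometry (dual A) (dual G)"
  by (auto simp: subgeometry_def dual_def)

lemma elements_dual: "x \<in> elements (dual G) \<longleftrightarrow> case_sum Inr Inl x \<in> elements G"
  by (cases x) auto

lemma ordinary_gon_dual:
  assumes "ordinary_gon k G" shows "ordinary_gon k (dual G)"
proof -
  obtain p l where k: "2 \<le> k" and geo: "geometry G" and p: "bij_betw p {..<k} (Points G)" and l: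
    "bij_betw l {..<k} (Lines G)"
    and inc: "\<And>i j. i < k \<Longrightarrow> j < k \<Longrightarrow> (p i, l j) \<in> Incid G \<longleftrightarrow> i = j \<or> i = (j + 1) mod k"
    using assms unfolding ordinary_gon_def by blast
  \<comment> \<open>With points and lines exchanged, the former points have to be shifted by one to
    restore the incidence pattern \<open>i = j\<close> or \<open>i = (j + 1) mod k\<close>.\<close>
  define s where "s j = (j + 1) mod k" for j
  have s: "s j < k" for j using k by (simp add: s_def)
  have s_inj: "s i = s j \<longleftrightarrow> i = j" if "i < k" "j < k" for i j
    using that k by (auto simp: s_def mod_if split: if_splits)
  have "bij_betw s {..<k} {..<k}"
    unfolding bij_betw_def
  proof
    show inj: "inj_on s {..<k}" using s_inj by (auto intro!: inj_onI)
    show "s ` {..<k} = {..<k}" by (rule endo_inj_surj[OF _ _ inj]) (use s in auto)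
  qed
  then have ps: "bij_betw (p \<circ> s) {..<k} (Lines (dual G))" using p by (simp add: bij_betw_trans)
  show ?thesis
    unfolding ordinary_gon_def
  proof (intro conjI exI[of _ l] exI[of _ "p \<circ> s"] allI impI)
    fix i j assume ij: "i < k" "j < k"
    show "(l i, (p \<circ> s) j) \<in> Incid (dual G) \<longleftrightarrow> i = j \<or> i = (j + 1) mod k"
      using inc[OF s ij(1), of j] s_inj[OF ij] by (auto simp: s_def)
  qed (use k geometry_dual[OF geo] ps l in simp_all)
qed

lemma weak_generalized_gon_dual:
  assumes "weak_generalized_gon n G" shows "weak_generalized_gon n (dual G)"
proof -
  have n: "3 \<le> n" and geo: "geometry G" and ne: "elements G \<noteq> {}"
    and gon: "\<And>x y. x \<in> elements G \<Longrightarrow> y \<in> elements G \<Longrightarrow>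
      \<exists>A. subgeometry A G \<and> ordinary_gon n A \<and> x \<in> elements A \<and> y \<in> elements A"
    and small: "\<And>k A. 2 \<le> k \<Longrightarrow> k < n \<Longrightarrow> subgeometry A G \<Longrightarrow> \<not> ordinary_gon k A"
    using assms unfolding weak_generalized_gon_def by blast+
  have "elements (dual G) \<noteq> {}" using ne by (auto simp: elements_def)
  moreover have "\<exists>A. subgeometry A (dual G) \<and> ordinary_gon n A \<and> x \<in> elements A \<and> y \<in> elements A"
    if xy: "x \<in> elements (dual G)" "y \<in> elements (dual G)" for x y
  proof -
    obtain A where "subgeometry A G" "ordinary_gon n A" "case_sum Inr Inl x \<in> elements A"
      "case_sum Inr Inl y \<in> elements A"
      using gon xy unfolding elements_dual by blast
    then show ?thesis using subgeometry_dual ordinary_gon_dual elements_dual by blast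
  qed
  moreover have "\<not> (\<exists>A. subgeometry A (dual G) \<and> ordinary_gon k A)" if k: "2 \<le> k" "k < n" for k
  proof
    assume "\<exists>A. subgeometry A (dual G) \<and> ordinary_gon k A"
    then obtain A where A: "subgeometry A (dual G)" "ordinary_gon k A" by blast
    have "subgeometry (dual A) G" using subgeometry_dual[OF A(1)] by simp
    then show False using small[OF k] ordinary_gon_dual[OF A(2)] by blast
  qed
  ultimately show ?thesis using n geometry_dual[OF geo] unfolding weak_generalized_gon_def by blast
qed

lemma thick_generalized_gon_dual:
  "thick_generalized_gon n G \<Longrightarrow> thick_generalized_gon n (dual G)"
proof -
  have "lines_through (dual G) M = points_on G M" "points_on (dual G) x = lines_through G x" for M x
    by (auto simp: lines_through_def points_on_def)
  then show "thick_generalized_gon n G \<Longrightarrow> thick_generalized_gon n (dual G)"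
    by (simp add: thick_generalized_gon_def weak_generalized_gon_dual)
qed

lemma epimorphism_dual: "epimorphism G H f g \<Longrightarrow> epimorphism (dual G) (dual H) g f"
  by (auto simp: epimorphism_def morphism_def)

theorem class_b_of_point_fibre:
  assumes "thick_generalized_gon 8 S" "ordinary_gon 8 G" "epimorphism S G f g"
    and "{x \<in> Points S. f x = a} = {b}"
  shows "class_b S G f g"
  unfolding class_b_def
  by (rule class_a_of_line_fibre) (use assms in \<open>auto intro: thick_generalized_gon_dual ordinary_gon_dual epimorphism_dual\<close>)

text \<open>The fold at a line \<open>L\<close> takes the value 0 only at \<open>L\<close>, so it
  becomes a map of class (a) once its values are translated into labels. Lines have even and points
  odd distance from \<open>L\<close>, which keeps the two kinds apart.\<close>

theorem class_a_exists:
  fixes S :: "('p, 'l) geometry" and G :: "('q, 'm) geometry"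
  assumes thick: "thick_generalized_gon 8 S" and G: "ordinary_gon 8 G"
  shows "\<exists>f g. epimorphism S G f g \<and> class_a S G f g"
proof -
  have w: "weak_generalized_gon 8 S" using thick by (simp add: thick_generalized_gon_def)
  then have geo: "geometry S" by (simp add: weak_generalized_gon_def)
  interpret octagon "elements S" "incident S" "gdist S" by (rule weak_gon_octagon[OF w])
  obtain x where x: "x \<in> elements S" using w by (auto simp: weak_generalized_gon_def)
  obtain y where y: "y \<in> nb x" using other_neighbour[OF x] by blast
  have "\<exists>L. L \<in> Lines S"
    using x y by (cases x; cases y) (auto simp: nb_def)
  then obtain L where L: "L \<in> Lines S" by blast
  have LV: "Inr L \<in> elements S" using L by simp
  obtain c where c: "c \<in> nb (Inr L)" using other_neighbour[OF LV] by blast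
  obtain b where b: "b \<in> nb (Inr L)" "b \<noteq> c" using other_neighbour[OF LV] by blast
  let ?\<phi> = "fold_map (Inr L) {c}"
  interpret F: octagon_map "elements S" "incident S" "gdist S" ?\<phi>
    by (rule octagon_map_fold[OF LV c _ b(1)]) (use b in auto)
  have parity: "even (?\<phi> v) \<longleftrightarrow> \<not> isl v" if v: "v \<in> elements S" for v
    using walk_isl[OF weak_gon_walk[OF w LV v]] fold_map_cases[OF LV v, of "{c}"] by auto
  obtain p l where pl: "octagon_labels G p l"
  proof -
    have "Lines G \<noteq> {}" using G unfolding ordinary_gon_def bij_betw_def
      by (auto simp: lessThan_empty_iff)
    then show ?thesis using ordinary_octagon_labels[OF G] that by blast
  qed
  note inc = label_incid[OF pl] and lin = label_in[OF pl] and linj = label_inj[OF pl]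
  \<comment> \<open>Inverts \<open>label_pos\<close> modulo 16: the values \<open>2 * i - 1\<close>
    at a point and \<open>2 * i\<close> at a line both give the index \<open>i\<close>.\<close>
  define ix where "ix v = nat ((?\<phi> v + 1) div 2 mod 8)" for v
  have ix: "ix v < 8" "int (ix v) = (?\<phi> v + 1) div 2 mod 8" for v
    by (auto simp: ix_def nat_less_iff)
  define f where "f a = p (ix (Inl a))" for a
  define g where "g M = l (ix (Inr M))" for M
  have "epimorphism S G f g"
    unfolding epimorphism_def morphism_def
  proof (intro conjI allI impI)
    show 1: "f ` Points S \<subseteq> Points G" and 2: "g ` Lines S \<subseteq> Lines G" using lin ix
      by (auto simp: f_def g_def)
    have F: "\<exists>v\<in>elements S. 16 dvd ?\<phi> v - k" for k using F.onto by blast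
    show "f ` Points S = Points G"
    proof
      show "Points G \<subseteq> f ` Points S"
      proof
        fix z assume "z \<in> Points G"
        then obtain i where i: "i < 8" "z = p i" using label_point[OF pl] by blast
        obtain v where v: "v \<in> elements S" "16 dvd ?\<phi> v - (2 * int i - 1)" using F by blast
        have "odd (?\<phi> v)" using v(2) by presburger
        then obtain a where a: "v = Inl a" using parity[OF v(1)] by (cases v) auto
        obtain q where "?\<phi> v - (2 * int i - 1) = 16 * q" using v(2) by (rule dvdE)
        then have "?\<phi> v + 1 = 2 * (int i + q * 8)" by simp
        then have "(?\<phi> v + 1) div 2 mod 8 = int i" using i(1) by simp
        then have "ix v = i" by (simp add: ix_def)
        then show "z \<in> f ` Points S" using i(2) v(1) a by (auto simp: f_def)
      qed
    qed (rule 1)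
    show "g ` Lines S = Lines G"
    proof
      show "Lines G \<subseteq> g ` Lines S"
      proof
        fix z assume "z \<in> Lines G"
        then obtain i where i: "i < 8" "z = l i" using label_line[OF pl] by blast
        obtain v where v: "v \<in> elements S" "16 dvd ?\<phi> v - 2 * int i" using F by blast
        have "even (?\<phi> v)" using v(2) by presburger
        then obtain M where M: "v = Inr M" using parity[OF v(1)] by (cases v) auto
        obtain q where "?\<phi> v - 2 * int i = 16 * q" using v(2) by (rule dvdE)
        then have "?\<phi> v + 1 = 2 * (int i + q * 8) + 1" by simp
        then have "(?\<phi> v + 1) div 2 = int i + q * 8" by simp
        then have "(?\<phi> v + 1) div 2 mod 8 = int i" using i(1) by simp
        then have "ix v = i" by (simp add: ix_def)
        then show "z \<in> g ` Lines S" using i(2) v(1) M by (auto simp: g_def)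
      qed
    qed (rule 2)
    fix a M assume aM: "(a, M) \<in> Incid S"
    then have V: "Inl a \<in> elements S" "Inr M \<in> elements S" using geo by (auto simp: geometry_def)
    let ?x = "?\<phi> (Inl a)" and ?m = "?\<phi> (Inr M)"
    have h: "16 dvd ?m - ?x - 1 \<or> 16 dvd ?m - ?x + 1" using F.hom[OF V] aM by simp
    have "odd ?x" "even ?m" using parity[OF V(1)] parity[OF V(2)] by auto
    then obtain i j where i: "?x = 2 * i + 1" and j: "?m = 2 * j" by (meson evenE oddE)
    have "8 dvd j - (i + 1) \<or> 8 dvd j + 1 - (i + 1)" using h unfolding i j by presburger
    then have "(i + 1) mod 8 = j mod 8 \<or> (i + 1) mod 8 = (j + 1) mod 8" by (metis mod_eq_dvd_iff)
    moreover have "(?x + 1) div 2 = i + 1" "(?m + 1) div 2 = j" unfolding i j by simp_all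
    ultimately have "(?x + 1) div 2 mod 8 = (?m + 1) div 2 mod 8 \<or>
      (?x + 1) div 2 mod 8 = ((?m + 1) div 2 mod 8 + 1) mod 8"
      by (simp add: mod_simps)
    then have "int (ix (Inl a)) = int (ix (Inr M)) \<or>
      int (ix (Inl a)) = int ((ix (Inr M) + 1) mod 8)"
      unfolding ix(2) by (simp add: ix(2) of_nat_mod add.commute)
    then have "ix (Inl a) = ix (Inr M) \<or> ix (Inl a) = (ix (Inr M) + 1) mod 8"
      by (simp only: of_nat_eq_iff)
    then show "(f a, g M) \<in> Incid G" using inc[OF ix(1) ix(1)] by (simp add: f_def g_def)
  qed
  moreover have "{M \<in> Lines S. g M = l 0} = {L}"
  proof -
    have "g M = l 0 \<longleftrightarrow> M = L" if M: "M \<in> Lines S" for M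
    proof -
      have MV: "Inr M \<in> elements S" using M by simp
      have "g M = l 0 \<longleftrightarrow> ix (Inr M) = 0" using linj(2)[OF ix(1), of 0] by (simp add: g_def)
      also have "\<dots> \<longleftrightarrow> (?\<phi> (Inr M) + 1) div 2 mod 8 = 0" using ix(2)[of "Inr M"] by linarith
      also have "\<dots> \<longleftrightarrow> 16 dvd ?\<phi> (Inr M)" 
      proof -
        obtain k where k: "?\<phi> (Inr M) = 2 * k" using parity[OF MV] by (auto elim: evenE)
        show ?thesis unfolding k by presburger
      qed
      also have "\<dots> \<longleftrightarrow> M = L" using fold_map_0_iff[OF LV MV] by simp
      finally show ?thesis .
    qed
    then show ?thesis using L by auto
  qed
  ultimately show ?thesis using class_a_of_line_fibre[OF thick G] by blast
qed

theorem class_b_exists: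
  assumes "thick_generalized_gon 8 S" "ordinary_gon 8 G"
  shows "\<exists>f g. epimorphism S G f g \<and> class_b S G f g"
proof -
  obtain f g where fg: "epimorphism (dual S) (dual G) f g" "class_a (dual S) (dual G) f g"
    using class_a_exists[OF thick_generalized_gon_dual[OF assms(1)] ordinary_gon_dual[OF assms(2)]]
      by blast
  have "epimorphism S G g f" using epimorphism_dual[OF fg(1)] by simp
  then show ?thesis using fg(2) unfolding class_b_def by blast
qed

text \<open>When all degrees are 2, an apartment contains every neighbour of its elements, so by
  connectedness it is the whole geometry.\<close>

lemma ordinary_gon_if_degree_2:
  assumes w: "weak_generalized_gon 8 G"
    and deg: "\<And>x. x \<in> Points G \<Longrightarrow> card (lines_through G x) = 2"
      "\<And>M. M \<in> Lines G \<Longrightarrow> card (points_on G M) = 2"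
  shows "ordinary_gon 8 G"
proof -
  have geo: "geometry G" using w by (simp add: weak_generalized_gon_def)
  have o: "octagon (elements G) (incident G) (gdist G)" by (rule weak_gon_octagon[OF w])
  interpret octagon "elements G" "incident G" "gdist G" by (rule o)
  obtain x where x: "x \<in> elements G" using w by (auto simp: weak_generalized_gon_def)
  obtain A where A: "subgeometry A G" "ordinary_gon 8 A" "x \<in> elements A"
    using weak_gon_apartment[OF w x x] by blast
  have card: "card (nb z) = 2" if z: "z \<in> elements G" for z
    using z deg by (cases z) (auto simp: nb_geometry[OF o] card_image)
  have AG: "elements A \<subseteq> elements G" by (rule subgeometry_elements[OF A(1)])
  have nbA: "nb z \<subseteq> elements A" if z: "z \<in> elements A" for z
  proof -
    obtain y1 y2 where y: "y1 \<in> elements A" "y2 \<in> elements A" "incident A z y1" "incident A z y2"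
      "y1 \<noteq> y2"
      using ordinary_gon_two_neighbours[OF A(2) z] by blast
    have "{y1, y2} \<subseteq> nb z" using y AG incident_subgeometry[OF A(1) z] by (auto simp: nb_def)
    moreover have "card (nb z) = 2" using card z AG by blast
    moreover from this have "finite (nb z)" by (metis card.infinite zero_neq_numeral)
    ultimately have "nb z = {y1, y2}" using y(5) card_subset_eq[of "nb z" "{y1, y2}"] by simp
    then show ?thesis using y by simp
  qed
  have "y \<in> elements A" if "y \<in> elements G" for y
    using that
  proof (induction "gdist G x y" arbitrary: y)
    case 0
    then show ?case using dist_0[OF x] A(3) by metis
  next
    case (Suc n)
    have "x \<noteq> y" using Suc.hyps(2) dist_0[OF x Suc.prems] by auto
    note c = closer[OF x Suc.prems this]
    have "closer x y \<in> elements A"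
      by (rule Suc.hyps(1)) (use c Suc.hyps(2) nbD in auto)
    then show ?case using nbA nb_sym[OF Suc.prems c(1)] by blast
  qed
  then have el: "elements G \<subseteq> elements A" by blast
  have "Points G \<subseteq> Points A" "Lines G \<subseteq> Lines A"
    using subsetD[OF el, of "Inl _"] subsetD[OF el, of "Inr _"] by auto
  then have PL: "Points A = Points G" "Lines A = Lines G" using A(1) by (auto simp: subgeometry_def)
  then have "Incid A = Incid G" using A(1) geo by (auto simp: subgeometry_def geometry_def)
  then have "A = G" using PL by (intro geometry.equality) simp_all
  then show ?thesis using A(2) by simp
qed

lemma two_or_at_least_three:
  assumes "x \<in> X" "y \<in> X" "x \<noteq> y"
  shows "card X = 2 \<or> at_least_three X"
proof (cases "X \<subseteq> {x, y}")
  case True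
  then have "X = {x, y}" using assms by blast
  then show ?thesis using assms(3) by simp
next
  case False
  then obtain z where "z \<in> X" "z \<noteq> x" "z \<noteq> y" by blast
  then have "{x, y, z} \<subseteq> X" "card {x, y, z} = 3" using assms by auto
  then show ?thesis unfolding at_least_three_def by blast
qed

theorem corollary5p4:
  fixes \<Gamma> :: "('p, 'l) geometry"
  assumes "thick_generalized_gon 8 \<Gamma>"
    and "locally_finitely_generated 8 \<Gamma>"
  shows
    "(\<forall>(\<Delta> :: ('q, 'm) geometry) (s :: 's rel) f g.
        thin_generalized_gon_of_order 8 \<Delta> s \<and> epimorphism \<Gamma> \<Delta> f g \<longrightarrow>
          s =o cone \<and> ordinary_gon 8 \<Delta> \<and> (class_a \<Gamma> \<Delta> f g \<or> class_b \<Gamma> \<Delta> f g)) \<and>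
     (\<forall>\<Delta> :: ('q, 'm) geometry. ordinary_gon 8 \<Delta> \<longrightarrow>
        (\<exists>f g. epimorphism \<Gamma> \<Delta> f g \<and> class_a \<Gamma> \<Delta> f g) \<and>
        (\<exists>f g. epimorphism \<Gamma> \<Delta> f g \<and> class_b \<Gamma> \<Delta> f g))"
proof (rule conjI)
  note thick = assms(1)
  have w: "weak_generalized_gon 8 \<Gamma>" using thick by (simp add: thick_generalized_gon_def)
  have geo: "geometry \<Gamma>" using w by (simp add: weak_generalized_gon_def)
  have o: "octagon (elements \<Gamma>) (incident \<Gamma>) (gdist \<Gamma>)" by (rule weak_gon_octagon[OF w])
  have sing: "\<exists>i. is_singleton (octagon_map.fib (elements \<Gamma>) \<psi> i)"
    if "octagon_map (elements \<Gamma>) (incident \<Gamma>) (gdist \<Gamma>) \<psi>" for \<psi>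
    by (rule octagon_map.singleton_fibre[OF that thick_nb[OF thick] locally_finite_octagon[OF w assms(2)]])
  show "\<forall>(\<Delta> :: ('q, 'm) geometry) (s :: 's rel) f g.
        thin_generalized_gon_of_order 8 \<Delta> s \<and> epimorphism \<Gamma> \<Delta> f g \<longrightarrow>
          s =o cone \<and> ordinary_gon 8 \<Delta> \<and> (class_a \<Gamma> \<Delta> f g \<or> class_b \<Gamma> \<Delta> f g)"
  proof (intro allI impI)
    fix \<Delta> :: "('q, 'm) geometry" and s :: "'s rel" and f g
    assume a: "thin_generalized_gon_of_order 8 \<Delta> s \<and> epimorphism \<Gamma> \<Delta> f g"
    then have wD: "weak_generalized_gon 8 \<Delta>" and ord: "has_order \<Delta> s cone" and epi:
      "epimorphism \<Gamma> \<Delta> f g"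
      by (auto simp: thin_generalized_gon_of_order_def)
    have oD: "octagon (elements \<Delta>) (incident \<Delta>) (gdist \<Delta>)" by (rule weak_gon_octagon[OF wD])
    interpret D: octagon "elements \<Delta>" "incident \<Delta>" "gdist \<Delta>" by (rule oD)
    have s: "Card_order s" and lin: "\<And>M. M \<in> Lines \<Delta> \<Longrightarrow> |points_on \<Delta> M| =o s +c cone"
      and poi: "\<And>x. x \<in> Points \<Delta> \<Longrightarrow> |lines_through \<Delta> x| =o cone +c cone"
      using ord by (auto simp: has_order_def)
    have pts2: "card (lines_through \<Delta> x) = 2" if "x \<in> Points \<Delta>" for x
      by (rule cone_csum_cone_eq_2[OF poi[OF that]])
    obtain x0 where x0: "x0 \<in> Points \<Delta>"
    proof -
      obtain x where x: "x \<in> elements \<Delta>" using wD by (auto simp: weak_generalized_gon_def)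
      obtain y where "y \<in> D.nb x" using D.other_neighbour[OF x] by blast
      then have "\<exists>x. x \<in> Points \<Delta>" using x by (cases x; cases y) (auto simp: D.nb_def)
      then show ?thesis using that by blast
    qed
    have lines2: "card (points_on \<Delta> M) = 2 \<or> at_least_three (points_on \<Delta> M)" if M: "M \<in> Lines \<Delta>"
      for M
    proof -
      have "Inr M \<in> elements \<Delta>" using M by simp
      from D.two_neighbours[OF this] obtain y z where yz: "y \<in> elements \<Delta>" "z \<in> elements \<Delta>"
        "incident \<Delta> (Inr M) y" "incident \<Delta> (Inr M) z" "y \<noteq> z" by blast
      then obtain a b where "y = Inl a" "z = Inl b" by (cases y; cases z) auto
      then show ?thesis using yz two_or_at_least_three[of a "points_on \<Delta> M" b]
        by (auto simp: points_on_def)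
    qed
    show "s =o cone \<and> ordinary_gon 8 \<Delta> \<and> (class_a \<Gamma> \<Delta> f g \<or> class_b \<Gamma> \<Delta> f g)"
    \<comment> \<open>All lines have the same cardinal number of points. So one line with two points
      gives \<open>s = 1\<close> and an ordinary octagon; otherwise every line has at least three
      points, and the points form the side of degree two in
      \<open>no_epi_onto_double\<close>.\<close>
    proof (cases "\<exists>M\<in>Lines \<Delta>. card (points_on \<Delta> M) = 2")
      case True
      then obtain M0 where M0: "M0 \<in> Lines \<Delta>" "card (points_on \<Delta> M0) = 2" by blast
      have s1: "s =o cone" by (rule csum_cone_eq_2[OF lin[OF M0(1)] s M0(2)])
      have "card (points_on \<Delta> M) = 2" if M: "M \<in> Lines \<Delta>" for M
      proof -
        have "|points_on \<Delta> M| =o |points_on \<Delta> M0|"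
          using ordIso_transitive[OF lin[OF M] ordIso_symmetric[OF lin[OF M0(1)]]] .
        then obtain h where "bij_betw h (points_on \<Delta> M) (points_on \<Delta> M0)"
          unfolding card_of_ordIso[symmetric] by blast
        then show ?thesis using M0(2) bij_betw_same_card by metis
      qed
      then have G: "ordinary_gon 8 \<Delta>" using ordinary_gon_if_degree_2[OF wD pts2] by blast
      obtain p l where pl: "octagon_labels \<Delta> p l"
        using ordinary_octagon_labels[OF G M0(1)] by blast
      interpret P: octagon_onto_ordinary \<Gamma> \<Delta> f g p l
        unfolding octagon_onto_ordinary_def octagon_onto_ordinary_axioms_def using o geo pl epi
          by blast
      obtain i where i: "is_singleton (P.fib i)" using sing[OF P.octagon_map_axioms] by blast
      define n where "n = nat ((i + 1) div 2 mod 8)"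
      have n: "n < 8" "int n = (i + 1) div 2 mod 8" by (auto simp: n_def nat_less_iff)
      have "16 dvd i - (2 * ((i + 1) div 2 mod 8) - 1) \<or> 16 dvd i - 2 * ((i + 1) div 2 mod 8)"
        by presburger
      then have "P.fib i = P.fib (2 * int n - 1) \<or> P.fib i = P.fib (2 * int n)"
        unfolding n(2) using P.fib_cong by blast
      then have "P.fib i = Inl ` P.F n \<or> P.fib i = Inr ` P.K n"
        using P.fib_F[OF n(1)] P.fib_K[OF n(1)] by simp
      then have "class_a \<Gamma> \<Delta> f g \<or> class_b \<Gamma> \<Delta> f g"
      proof
        assume "P.fib i = Inl ` P.F n"
        then have "card (P.F n) = 1" using i by (simp add: is_singleton_altdef card_image)
        then obtain b where "P.F n = {b}" by (rule card_1_singletonE)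
        then have "{x \<in> Points \<Gamma>. f x = p n} = {b}" by (simp add: P.F_def point_fibre_def)
        then show ?thesis using class_b_of_point_fibre[OF thick G epi] by blast
      next
        assume "P.fib i = Inr ` P.K n"
        then have "card (P.K n) = 1" using i by (simp add: is_singleton_altdef card_image)
        then obtain L where "P.K n = {L}" by (rule card_1_singletonE)
        then have "{M \<in> Lines \<Gamma>. g M = l n} = {L}" by (simp add: P.K_def)
        then show ?thesis using class_a_of_line_fibre[OF thick G epi] by blast
      qed
      then show ?thesis using s1 G by blast
    next
      case False
      have hom: "incident \<Delta> (map_sum f g x) (map_sum f g y)" if "incident \<Gamma> x y" for x y
        using that epi by (cases x; cases y) (auto simp: epimorphism_def morphism_def)
      have onto: "map_sum f g ` elements \<Gamma> = elements \<Delta>"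
      proof -
        have "map_sum f g ` elements \<Gamma> = Inl ` f ` Points \<Gamma> \<union> Inr ` g ` Lines \<Gamma>"
          by (simp add: elements_def Plus_def image_Un image_image)
        then show ?thesis using epi by (simp add: epimorphism_def elements_def Plus_def)
      qed
      interpret E: octagon_epi "elements \<Gamma>" "incident \<Gamma>" "gdist \<Gamma>" "elements \<Delta>" "incident \<Delta>"
        "gdist \<Delta>" "map_sum f g"
        unfolding octagon_epi_def octagon_epi_axioms_def using o oD hom onto by blast
      have False
      proof (rule E.no_epi_onto_double[OF sing thick_nb[OF thick]])
        show "Inl ` Points \<Delta> \<subseteq> elements \<Delta>" "Inl x0 \<in> Inl ` Points \<Delta>" using x0 by auto
        show "x = y \<or> x = z \<or> y = z"
          if b: "b \<in> Inl ` Points \<Delta>" and n: "x \<in> D.nb b" "y \<in> D.nb b" "z \<in> D.nb b" for b x y z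
        proof -
          obtain v where v: "b = Inl v" "v \<in> Points \<Delta>" using b by blast
          have "card (D.nb b) = 2" using pts2[OF v(2)] v(1)
            by (simp add: nb_geometry(1)[OF oD] card_image)
          then obtain y1 y2 where "D.nb b = {y1, y2}" by (auto simp: card_2_iff)
          then show ?thesis using n by auto
        qed
        show "at_least_three (D.nb x)" if x: "x \<in> elements \<Delta> - Inl ` Points \<Delta>" for x
        proof -
          obtain M where M: "x = Inr M" "M \<in> Lines \<Delta>" using x by (cases x) auto
          then have "at_least_three (points_on \<Delta> M)" using lines2 False by blast
          then show ?thesis unfolding M(1) nb_geometry(2)[OF oD]
            by (intro at_least_three_image) auto
        qed
        show "y \<in> Inl ` Points \<Delta> \<longleftrightarrow> x \<notin> Inl ` Points \<Delta>" if "x \<in> elements \<Delta>" "y \<in> D.nb x" for x y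
          using that by (cases x; cases y) (auto simp: D.nb_def)
      qed
      then show ?thesis ..
    qed
  qed
  show "\<forall>\<Delta> :: ('q, 'm) geometry. ordinary_gon 8 \<Delta> \<longrightarrow>
        (\<exists>f g. epimorphism \<Gamma> \<Delta> f g \<and> class_a \<Gamma> \<Delta> f g) \<and>
        (\<exists>f g. epimorphism \<Gamma> \<Delta> f g \<and> class_b \<Gamma> \<Delta> f g)"
    using class_a_exists[OF thick] class_b_exists[OF thick] by blast
qed

end
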